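(* A series–parallel graph $G$ is minimally $\frac{1}{2}$-tough if and only if $G$ is a series join of an arbitrary number (possibly zero) of pearls and at least two single edges, in which the first and the last joined pieces are single edges.
   Context: All graphs are finite and undirected; parallel edges are allowed. For a graph $H$, $c(H)$ denotes its number of connected components. A set $S\subseteq V(G)$ is a cutset if $c(G-S)>1$. For real $t$, $G$ is $t$-tough if $|S|\ge t\cdot c(G-S)$ for every cutset $S$; the toughness $\tau(G)$ is the largest $t$ for which $G$ is $t$-tough, with $\tau(K_n)=\infty$ (a graph is disconnected iff its toughness is $0$). $G$ is minimally $t$-tough if $\tau(G)=t$ and $\tau(G-e)<t$ for every edge $e$. A series–parallel graph $G(s,t)$ with terminals $s,t$ is either a single edge $st$, or is obtained from series–parallel graphs $G_1(s_1,t_1),\dots,G_k(s_k,t_k)$, $k\ge 2$, by a series join (identify $t_i$ with $s_{i+1}$ for $1\le i\le k-1$, set $s=s_1$, $t=t_k$) or a parallel join (identify all $s_i$ into $s$ and all $t_i$ into $t$). A pearl is the parallel join of two paths, each of length at least $2$ (its terminals are the common endpoints of the two paths); a single edge has its two endpoints as terminals. *)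

theory Defs
  imports "HOL-Library.Multiset" "HOL-Library.Extended_Real"
begin

section \<open>Multigraphs, components, toughness\<close>

text \<open>Each edge is the set of its two endpoints; parallel edges are repeated elements of the
  multiset of edges.\<close>

record 'a mgraph =
  verts :: "'a set"
  edges :: "'a set multiset"

definition wf_mgraph :: "'a mgraph \<Rightarrow> bool" where
  "wf_mgraph G \<longleftrightarrow> finite (verts G) \<and> (\<forall>e \<in># edges G. e \<subseteq> verts G \<and> card e = 2)"

definition adj :: "'a mgraph \<Rightarrow> ('a \<times> 'a) set" where
  "adj G = {(u, v). {u, v} \<in># edges G}"

definition reach :: "'a mgraph \<Rightarrow> ('a \<times> 'a) set" where
  "reach G = {(u, v). u \<in> verts G \<and> v \<in> verts G \<and> (u, v) \<in> (adj G)\<^sup>*}"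

definition num_comps :: "'a mgraph \<Rightarrow> nat" where
  "num_comps G = card (verts G // reach G)"

definition del_verts :: "'a mgraph \<Rightarrow> 'a set \<Rightarrow> 'a mgraph" where
  "del_verts G S = \<lparr>verts = verts G - S, edges = {#e \<in># edges G. e \<inter> S = {}#}\<rparr>"

text \<open>Removes a single copy of \<open>e\<close>; parallel copies stay.\<close>

definition del_edge :: "'a mgraph \<Rightarrow> 'a set \<Rightarrow> 'a mgraph" where
  "del_edge G e = \<lparr>verts = verts G, edges = edges G - {#e#}\<rparr>"

definition cutset :: "'a mgraph \<Rightarrow> 'a set \<Rightarrow> bool" where
  "cutset G S \<longleftrightarrow> S \<subseteq> verts G \<and> num_comps (del_verts G S) > 1"

definition tough :: "real \<Rightarrow> 'a mgraph \<Rightarrow> bool" where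
  "tough t G \<longleftrightarrow> (\<forall>S. cutset G S \<longrightarrow> real (card S) \<ge> t * real (num_comps (del_verts G S)))"

text \<open>The supremum is attained if \<open>G\<close> is finite and has a cutset, and it is \<open>\<infinity>\<close> if
  \<open>G\<close> is complete; see \<open>toughness_attained\<close> and \<open>toughness_complete\<close> below.\<close>

definition toughness :: "'a mgraph \<Rightarrow> ereal" where
  "toughness G = Sup {ereal t | t. tough t G}"

definition minimally_tough :: "real \<Rightarrow> 'a mgraph \<Rightarrow> bool" where
  "minimally_tough t G \<longleftrightarrow>
     toughness G = ereal t \<and> (\<forall>e \<in># edges G. toughness (del_edge G e) < ereal t)"

section \<open>Two-terminal graphs and joins\<close>

record 'a tgraph =
  grph :: "'a mgraph"
  src :: 'a
  snk :: 'a

text \<open>A join is taken of graphs that already share exactly the vertices to be identified, so that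
  it is their union; up to the names of the vertices this is the quotient of the disjoint
  union. Edge multiplicities add up.\<close>

definition glue :: "'a mgraph list \<Rightarrow> 'a mgraph" where
  "glue Gs = \<lparr>verts = (\<Union>G\<in>set Gs. verts G), edges = sum_list (map edges Gs)\<rparr>"

definition is_series_join :: "'a tgraph list \<Rightarrow> 'a tgraph \<Rightarrow> bool" where
  "is_series_join Ps H \<longleftrightarrow>
     length Ps \<ge> 2 \<and>
     (\<forall>i. Suc i < length Ps \<longrightarrow> snk (Ps ! i) = src (Ps ! Suc i)) \<and>
     (\<forall>i j. i < j \<and> j < length Ps \<longrightarrow>
        verts (grph (Ps ! i)) \<inter> verts (grph (Ps ! j)) = (if j = Suc i then {snk (Ps ! i)} else {})) \<and>
     grph H = glue (map grph Ps) \<and> src H = src (hd Ps) \<and> snk H = snk (last Ps)"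

definition is_parallel_join :: "'a tgraph list \<Rightarrow> 'a tgraph \<Rightarrow> bool" where
  "is_parallel_join Ps H \<longleftrightarrow>
     length Ps \<ge> 2 \<and>
     (\<forall>P \<in> set Ps. src P = src H \<and> snk P = snk H) \<and>
     (\<forall>i j. i < j \<and> j < length Ps \<longrightarrow>
        verts (grph (Ps ! i)) \<inter> verts (grph (Ps ! j)) = {src H, snk H}) \<and>
     grph H = glue (map grph Ps)"

definition is_single_edge :: "'a tgraph \<Rightarrow> bool" where
  "is_single_edge P \<longleftrightarrow> src P \<noteq> snk P \<and>
     grph P = \<lparr>verts = {src P, snk P}, edges = {#{src P, snk P}#}\<rparr>"

inductive sp_tgraph :: "'a tgraph \<Rightarrow> bool" where
  edge: "is_single_edge H \<Longrightarrow> sp_tgraph H"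
| series: "(\<And>P. P \<in> set Ps \<Longrightarrow> sp_tgraph P) \<Longrightarrow> is_series_join Ps H \<Longrightarrow> sp_tgraph H"
| parallel: "(\<And>P. P \<in> set Ps \<Longrightarrow> sp_tgraph P) \<Longrightarrow> is_parallel_join Ps H \<Longrightarrow> sp_tgraph H"

definition series_parallel :: "'a mgraph \<Rightarrow> bool" where
  "series_parallel G \<longleftrightarrow> (\<exists>s t. sp_tgraph \<lparr>grph = G, src = s, snk = t\<rparr>)"

text \<open>The length \<open>n\<close> of a path is its number of edges.\<close>

definition is_path :: "nat \<Rightarrow> 'a tgraph \<Rightarrow> bool" where
  "is_path n P \<longleftrightarrow> (\<exists>vs. distinct vs \<and> length vs = n + 1 \<and>
     grph P = \<lparr>verts = set vs, edges = mset (map2 (\<lambda>u v. {u, v}) vs (tl vs))\<rparr> \<and>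
     src P = hd vs \<and> snk P = last vs)"

definition is_pearl :: "'a tgraph \<Rightarrow> bool" where
  "is_pearl H \<longleftrightarrow> (\<exists>P Q m n. is_path m P \<and> is_path n Q \<and> m \<ge> 2 \<and> n \<ge> 2 \<and>
     is_parallel_join [P, Q] H)"

section \<open>Basic facts about these definitions\<close>

lemma in_sum_list_mset: "x \<in># sum_list Ms \<longleftrightarrow> (\<exists>M \<in> set Ms. x \<in># M)"
  by (induction Ms) auto

lemma wf_glue:
  assumes "\<And>G. G \<in> set Gs \<Longrightarrow> wf_mgraph G"
  shows "wf_mgraph (glue Gs)"
  using assms by (fastforce simp: wf_mgraph_def glue_def in_sum_list_mset)

lemma sp_tgraph_wf:
  "sp_tgraph H \<Longrightarrow> wf_mgraph (grph H) \<and> {src H, snk H} \<subseteq> verts (grph H) \<and> src H \<noteq> snk H"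
proof (induction rule: sp_tgraph.induct)
  case (edge H)
  then show ?case by (auto simp: is_single_edge_def wf_mgraph_def)
next
  case (series Ps H)
  from \<open>is_series_join Ps H\<close> have len: "length Ps \<ge> 2"
    and ov: "\<And>i j. i < j \<Longrightarrow> j < length Ps \<Longrightarrow> verts (grph (Ps ! i)) \<inter> verts (grph (Ps ! j))
               = (if j = Suc i then {snk (Ps ! i)} else {})"
    and H: "grph H = glue (map grph Ps)" "src H = src (hd Ps)" "snk H = snk (last Ps)"
    and nx: "\<And>i. Suc i < length Ps \<Longrightarrow> snk (Ps ! i) = src (Ps ! Suc i)"
    by (auto simp: is_series_join_def)
  have ne: "Ps \<noteq> []" using len by auto
  have wf: "wf_mgraph (grph H)"
    unfolding H using series.IH by (auto intro!: wf_glue)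
  have hl: "hd Ps = Ps ! 0" "last Ps = Ps ! (length Ps - 1)"
    using ne by (auto simp: hd_conv_nth last_conv_nth)
  have "src (hd Ps) \<in> verts (grph (hd Ps))" "snk (last Ps) \<in> verts (grph (last Ps))"
    using series.IH ne by auto
  moreover have "src (hd Ps) \<noteq> snk (last Ps)"
  proof
    assume eq: "src (hd Ps) = snk (last Ps)"
    then have "src (hd Ps) \<in> verts (grph (Ps ! 0)) \<inter> verts (grph (Ps ! (length Ps - 1)))"
      using calculation hl by auto
    also have "\<dots> = (if length Ps - 1 = Suc 0 then {snk (Ps ! 0)} else {})"
      using len by (intro ov) auto
    finally have "src (Ps ! 0) = snk (Ps ! 0)"
      using hl by (simp split: if_splits)
    moreover have "Ps ! 0 \<in> set Ps" using ne by simp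
    ultimately show False using series.IH by blast
  qed
  ultimately show ?case using wf H ne by (auto simp: glue_def)
next
  case (parallel Ps H)
  from \<open>is_parallel_join Ps H\<close> have len: "length Ps \<ge> 2" and H: "grph H = glue (map grph Ps)"
    and st: "\<And>P. P \<in> set Ps \<Longrightarrow> src P = src H \<and> snk P = snk H"
    by (auto simp: is_parallel_join_def)
  have "hd Ps \<in> set Ps" using len by (cases Ps) auto
  moreover have "wf_mgraph (grph H)"
    unfolding H using parallel.IH by (auto intro!: wf_glue)
  ultimately show ?case using parallel.IH st unfolding H glue_def by fastforce
qed

lemma toughness_no_cutset:
  assumes "\<And>S. \<not> cutset G S"
  shows "toughness G = \<infinity>"
proof -
  have "ereal t \<le> toughness G" for t
    unfolding toughness_def using assms by (intro Sup_upper) (auto simp: tough_def)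
  then show ?thesis by (metis ereal_top)
qed

lemma toughness_complete:
  assumes "\<And>u v. u \<in> verts G \<Longrightarrow> v \<in> verts G \<Longrightarrow> u \<noteq> v \<Longrightarrow> {u, v} \<in># edges G"
  shows "toughness G = \<infinity>"
proof (rule toughness_no_cutset)
  fix S
  have "reach (del_verts G S) `` {u} = verts G - S" if "u \<in> verts G - S" for u
    using that assms by (fastforce simp: reach_def adj_def del_verts_def)
  then have "verts (del_verts G S) // reach (del_verts G S) \<subseteq> {verts G - S}"
    by (auto simp: quotient_def del_verts_def)
  then have "num_comps (del_verts G S) \<le> card {verts G - S}"
    unfolding num_comps_def by (intro card_mono) auto
  then show "\<not> cutset G S" by (simp add: cutset_def)
qed

lemma toughness_attained:
  assumes "finite (verts G)" and "cutset G S"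
  shows "\<exists>t. toughness G = ereal t \<and> tough t G \<and> (\<forall>t'. tough t' G \<longrightarrow> t' \<le> t)"
proof -
  define R where "R = (\<lambda>S. real (card S) / real (num_comps (del_verts G S))) ` {S. cutset G S}"
  have "{S. cutset G S} \<subseteq> Pow (verts G)" by (auto simp: cutset_def)
  then have "finite R" unfolding R_def using assms(1) by (meson finite_Pow_iff finite_imageI finite_subset)
  moreover have "R \<noteq> {}" using assms(2) by (auto simp: R_def)
  moreover have tough_iff: "tough t G \<longleftrightarrow> (\<forall>r\<in>R. t \<le> r)" for t
    by (auto simp: tough_def R_def cutset_def field_simps)
  ultimately have iff: "tough t G \<longleftrightarrow> t \<le> Min R" for t by simp
  have "toughness G = ereal (Min R)"
    unfolding toughness_def by (rule Sup_eqI) (auto simp: iff)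
  then show ?thesis using iff by auto
qed

end

(*
  Let P be a piece with terminals p, q of a minimally 1/2-tough graph G, and let E be the rest of G.
  A set S of vertices of E that contains q but not p is tight if E - S has at least 2|S| components.
  If p and q are connected in E, then P is a path, or E has tight sets for both terminals and P is
  wide: for some set X of inner vertices, P - p - q - X has at least 2|X| + 2 components. This is shown
  by induction over series and parallel joins. A path is never in series with a wide piece, since
  the common vertex could be dropped from a tight set. In a parallel join every path has length at
  least two and contributes one component to the width, and tight sets come from the criticality of
  its first and last edges. Working with series compositions rather than uncrossing two critical sets
  avoids the trouble caused by edges between these sets.
  If p and q are disconnected in E, tight sets on both sides of a parallel join P together with X show
  that the width of P is at most two, so that P is the parallel join of exactly two paths.
*)
theory Submission
  imports Defs
begin

section \<open>Counting components\<close>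

text \<open>For toughness 1/2 the decisive quantity is the excess of a deleted set: the number of
  remaining components minus twice the size of the set. When two graphs are glued at a vertex their
  excesses add up, with -1 if the vertex is kept (two components merge) and +2 if it is deleted (it
  was charged twice). The constants come from here. In the whole graph a nonempty set has excess at
  most 0. So if E has a set of excess 0 that deletes q and keeps p, any such set of P has excess at
  most -1; with both terminals deleted, the excesses of P and E sum to at most -4. If both terminals
  are kept, the correction is -2, or -1 when both sides connect them; \<open>sep_bound\<close>
  controls this case. Toughness concerns the whole graph, whereas an induction over joins sees a
  piece only; therefore the environment is carried along and changes in every recursive call.
  Conversely, for a chain of pearls and edges, a bound on the excess that gains one unit per deleted
  terminal survives series joins. Deleting a single edge of the chain disconnects the graph; after
  deleting an edge of a pearl, one suitable terminal of the pearl leaves three components.\<close>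

definition step :: "'a set \<Rightarrow> 'a set set \<Rightarrow> ('a \<times> 'a) set" where
  "step U F = {(x, y). x \<in> U \<and> y \<in> U \<and> {x, y} \<in> F}"

definition linked :: "'a set \<Rightarrow> 'a set set \<Rightarrow> 'a \<Rightarrow> 'a \<Rightarrow> bool" where
  "linked U F x y \<longleftrightarrow> (x, y) \<in> (step U F)\<^sup>*"

definition component :: "'a set \<Rightarrow> 'a set set \<Rightarrow> 'a \<Rightarrow> 'a set" where
  "component U F x = {y. linked U F x y}"

text \<open>\<open>F\<close> is not restricted to \<open>U\<close>: edges that leave
  \<open>U\<close> are ignored, so deleting vertices only shrinks \<open>U\<close>. Multiplicities
  are dropped because they do not affect connectivity.\<close>

definition ncomps :: "'a set \<Rightarrow> 'a set set \<Rightarrow> nat" where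
  "ncomps U F = card (component U F ` U)"

lemma sym_step: "sym (step U F)"
  by (auto simp: sym_def step_def insert_commute)

lemma linked_refl [simp]: "linked U F x x"
  by (simp add: linked_def)

lemma linked_sym: "linked U F x y \<Longrightarrow> linked U F y x"
  unfolding linked_def using sym_step by (metis sym_rtrancl symD)

lemma linked_trans: "linked U F x y \<Longrightarrow> linked U F y z \<Longrightarrow> linked U F x z"
  unfolding linked_def by (rule rtrancl_trans)

lemma linked_edge: "x \<in> U \<Longrightarrow> y \<in> U \<Longrightarrow> {x, y} \<in> F \<Longrightarrow> linked U F x y"
  unfolding linked_def by (auto simp: step_def)

lemma linked_mono: "linked U F x y \<Longrightarrow> U \<subseteq> U' \<Longrightarrow> F \<subseteq> F' \<Longrightarrow> linked U' F' x y"
  unfolding linked_def by (rule rtrancl_mono[THEN subsetD]) (auto simp: step_def)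

lemma linked_closed:
  assumes "linked U F x y" "x \<in> K" "\<And>u v. u \<in> K \<Longrightarrow> u \<in> U \<Longrightarrow> v \<in> U \<Longrightarrow> {u, v} \<in> F \<Longrightarrow> v \<in> K"
  shows "y \<in> K"
  using assms(1)[unfolded linked_def] assms(2,3)
  by (induction rule: rtrancl_induct) (auto simp: step_def)

lemma linked_in: "linked U F x y \<Longrightarrow> x \<in> U \<Longrightarrow> y \<in> U"
  by (rule linked_closed)

lemma component_eq_iff: "component U F x = component U F y \<longleftrightarrow> linked U F x y"
  unfolding component_def by (auto intro: linked_trans linked_sym)

lemma component_self [simp]: "x \<in> component U F x"
  by (simp add: component_def)

lemma component_subset: "x \<in> U \<Longrightarrow> component U F x \<subseteq> U"
  by (auto simp: component_def intro: linked_in)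

lemma component_closed:
  assumes "x \<in> K" "\<And>u v. u \<in> K \<Longrightarrow> u \<in> U \<Longrightarrow> v \<in> U \<Longrightarrow> {u, v} \<in> F \<Longrightarrow> v \<in> K"
  shows "component U F x \<subseteq> K"
  using assms by (auto simp: component_def intro: linked_closed)

lemma ncomps_empty [simp]: "ncomps {} F = 0"
  by (simp add: ncomps_def)

lemma ncomps_ge1: "finite U \<Longrightarrow> U \<noteq> {} \<Longrightarrow> ncomps U F \<ge> 1"
  unfolding ncomps_def by (simp add: Suc_le_eq card_gt_0_iff)

lemma ncomps_le1_iff:
  assumes "finite U"
  shows "ncomps U F \<le> 1 \<longleftrightarrow> (\<forall>x\<in>U. \<forall>y\<in>U. linked U F x y)"
proof -
  have "ncomps U F \<le> 1 \<longleftrightarrow> (\<forall>a\<in>component U F ` U. \<forall>b\<in>component U F ` U. a = b)"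
    unfolding ncomps_def using assms card_le_Suc0_iff_eq[of "component U F ` U"] by simp
  then show ?thesis by (simp add: component_eq_iff)
qed

lemma ncomps_one_linked: "finite U \<Longrightarrow> ncomps U F = 1 \<Longrightarrow> x \<in> U \<Longrightarrow> y \<in> U \<Longrightarrow> linked U F x y"
  using ncomps_le1_iff[of U F] by auto

lemma ncomps_single [simp]: "ncomps {v} F = 1"
  by (simp add: ncomps_def)

lemma ncomps_cong:
  assumes "\<And>e. e \<subseteq> U \<Longrightarrow> e \<in> F \<longleftrightarrow> e \<in> F'"
  shows "ncomps U F = ncomps U F'"
proof -
  have "{x, y} \<in> F \<longleftrightarrow> {x, y} \<in> F'" if "x \<in> U" "y \<in> U" for x y
    using assms[of "{x, y}"] that by blast
  then have "step U F = step U F'" unfolding step_def by blast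
  then show ?thesis by (simp add: ncomps_def component_def linked_def)
qed

text \<open>A component of one side that avoids the overlap is a component of the union; the
  components that meet the overlap are counted by its image. Comparing both kinds in the two sides
  and in the union gives the formula. Edges may stick out of the union, since some of their ends may
  have been deleted.\<close>

lemma ncomps_glue_general:
  assumes fin: "finite A" "finite B"
    and hA: "\<And>e. e \<in> FA \<Longrightarrow> e \<inter> (A \<union> B) \<subseteq> A" and hB: "\<And>e. e \<in> FB \<Longrightarrow> e \<inter> (A \<union> B) \<subseteq> B"
  shows "ncomps (A \<union> B) (FA \<union> FB) + card (component A FA ` (A \<inter> B)) + card (component B FB ` (A \<inter> B))
    = ncomps A FA + ncomps B FB + card (component (A \<union> B) (FA \<union> FB) ` (A \<inter> B))"
proof -
  let ?U = "A \<union> B" and ?F = "FA \<union> FB" and ?W = "A \<inter> B"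
  \<comment> \<open>One argument for both sides: \<open>C\<close> is the side that contains
    \<open>x\<close> and \<open>D\<close> is the other one.\<close>
  have same: "component ?U ?F x = component C FC x"
    if C: "C \<subseteq> ?U" "FC \<subseteq> ?F" "x \<in> C" "component C FC x \<inter> ?W = {}" "?U - C \<subseteq> D" "?W = C \<inter> D"
      "\<And>e. e \<in> ?F \<Longrightarrow> e \<in> FC \<or> e \<inter> ?U \<subseteq> D" "\<And>e. e \<in> FC \<Longrightarrow> e \<inter> ?U \<subseteq> C" for C FC D x
  proof
    show "component C FC x \<subseteq> component ?U ?F x" using C by (auto simp: component_def intro: linked_mono)
    show "component ?U ?F x \<subseteq> component C FC x"
    proof (rule component_closed)
      fix u v assume u: "u \<in> component C FC x" "u \<in> ?U" "v \<in> ?U" "{u, v} \<in> ?F"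
      have uC: "u \<in> C" using u(1) component_subset[OF C(3)] by blast
      have "u \<notin> D" using u(1) C(4) C(6) uC by blast
      then have FC: "{u, v} \<in> FC" using C(7)[OF u(4)] u(2) by auto
      have "v \<in> C" using C(8)[OF FC] u(3) by auto
      then have "linked C FC u v" by (rule linked_edge[OF uC _ FC])
      then show "v \<in> component C FC x"
        using u(1) linked_trans[of C FC x u v] unfolding component_def by simp
    qed simp
  qed
  have sameA: "component ?U ?F x = component A FA x" if "x \<in> A" "component A FA x \<inter> ?W = {}" for x
  proof (rule same[where D = B])
    show "e \<in> FA \<or> e \<inter> ?U \<subseteq> B" if "e \<in> ?F" for e using that hB[of e] by blast
  qed (use that hA in simp_all, blast)
  have sameB: "component ?U ?F x = component B FB x" if "x \<in> B" "component B FB x \<inter> ?W = {}" for x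
  proof (rule same[where D = A])
    show "e \<in> FB \<or> e \<inter> ?U \<subseteq> A" if "e \<in> ?F" for e using that hA[of e] by blast
  qed (use that hB in simp_all, blast+)
  define CA where "CA = {K \<in> component A FA ` A. K \<inter> ?W = {}}"
  define CB where "CB = {K \<in> component B FB ` B. K \<inter> ?W = {}}"
  have hit: "component C FC x \<in> component C FC ` W'" if "component C FC x \<inter> W' \<noteq> {}"
    for C :: "'a set" and FC x W'
  proof -
    from that obtain w where w: "w \<in> W'" "linked C FC x w" unfolding component_def by blast
    then have "component C FC x = component C FC w" by (simp add: component_eq_iff)
    then show ?thesis using w by simp
  qed
  have split: "component C FC ` C = {K \<in> component C FC ` C. K \<inter> ?W = {}} \<union> component C FC ` ?W"
    if "?W \<subseteq> C" for C FC
  proof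
    show "component C FC ` C \<subseteq> {K \<in> component C FC ` C. K \<inter> ?W = {}} \<union> component C FC ` ?W"
    proof
      fix K assume K: "K \<in> component C FC ` C"
      show "K \<in> {K \<in> component C FC ` C. K \<inter> ?W = {}} \<union> component C FC ` ?W"
      proof (cases "K \<inter> ?W = {}")
        case False
        then show ?thesis using K hit[of C FC _ ?W] by blast
      qed (use K in blast)
    qed
    show "{K \<in> component C FC ` C. K \<inter> ?W = {}} \<union> component C FC ` ?W \<subseteq> component C FC ` C" using that by auto
  qed
  have disj: "{K \<in> component C FC ` C. K \<inter> ?W = {}} \<inter> component C' FC' ` ?W = {}" for C FC C' FC'
  proof -
    have "component C' FC' x \<inter> ?W \<noteq> {}" if "x \<in> ?W" for x using that component_self[of x C' FC'] by blast
    then show ?thesis by blast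
  qed
  have cnt: "ncomps C FC = card {K \<in> component C FC ` C. K \<inter> ?W = {}} + card (component C FC ` ?W)"
    if "?W \<subseteq> C" "finite C" for C FC
  proof -
    have "ncomps C FC = card ({K \<in> component C FC ` C. K \<inter> ?W = {}} \<union> component C FC ` ?W)"
      unfolding ncomps_def by (subst split[OF that(1)]) simp
    also have "\<dots> = card {K \<in> component C FC ` C. K \<inter> ?W = {}} + card (component C FC ` ?W)"
      by (rule card_Un_disjoint) (use that disj fin in auto)
    finally show ?thesis .
  qed
  have "component ?U ?F ` ?U = (CA \<union> CB) \<union> component ?U ?F ` ?W"
  proof
    show "component ?U ?F ` ?U \<subseteq> (CA \<union> CB) \<union> component ?U ?F ` ?W"
    proof
      fix K assume "K \<in> component ?U ?F ` ?U"
      then obtain x where x: "K = component ?U ?F x" "x \<in> ?U" by blast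
      show "K \<in> (CA \<union> CB) \<union> component ?U ?F ` ?W"
      proof (cases "K \<inter> ?W = {}")
        case False then show ?thesis using hit[of ?U ?F x ?W] x by blast
      next
        case True
        have sub: "component A FA x \<subseteq> K" "component B FB x \<subseteq> K"
          unfolding x by (auto simp: component_def intro: linked_mono)
        show ?thesis
        proof (cases "x \<in> A")
          case True
          then have "K = component A FA x" using sameA[of x] x sub \<open>K \<inter> ?W = {}\<close> by blast
          then show ?thesis using True \<open>K \<inter> ?W = {}\<close> by (auto simp: CA_def)
        next
          case False
          then have "x \<in> B" using x by blast
          then have "K = component B FB x" using sameB[of x] x sub \<open>K \<inter> ?W = {}\<close> by blast
          then show ?thesis using \<open>x \<in> B\<close> \<open>K \<inter> ?W = {}\<close> by (auto simp: CB_def)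
        qed
      qed
    qed
    show "(CA \<union> CB) \<union> component ?U ?F ` ?W \<subseteq> component ?U ?F ` ?U"
    proof -
      have "K \<in> component ?U ?F ` ?U" if "K \<in> CA" for K
        using that sameA unfolding CA_def by (auto simp del: component_self)
      moreover have "K \<in> component ?U ?F ` ?U" if "K \<in> CB" for K
        using that sameB unfolding CB_def by (auto simp del: component_self)
      ultimately show ?thesis by blast
    qed
  qed
  then have "ncomps ?U ?F = card ((CA \<union> CB) \<union> component ?U ?F ` ?W)" by (simp add: ncomps_def)
  also have "\<dots> = card (CA \<union> CB) + card (component ?U ?F ` ?W)"
    by (rule card_Un_disjoint) (use fin disj in \<open>auto simp: CA_def CB_def\<close>)
  also have "card (CA \<union> CB) = card CA + card CB"
  proof (rule card_Un_disjoint)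
    show "CA \<inter> CB = {}"
    proof (rule ccontr)
      assume "CA \<inter> CB \<noteq> {}"
      then obtain x y where *: "component A FA x = component B FB y" "x \<in> A" "y \<in> B" "component A FA x \<inter> ?W = {}"
        by (auto simp: CA_def CB_def)
      have "x \<in> B" using * component_subset[of y B FB] component_self[of x A FA] by blast
      then show False using * component_self[of x A FA] by blast
    qed
  qed (use fin in \<open>auto simp: CA_def CB_def\<close>)
  finally show ?thesis using cnt[of A FA] cnt[of B FB] fin unfolding CA_def CB_def by simp
qed

lemma card_component_pair:
  "p \<noteq> q \<Longrightarrow> card (component U F ` {p, q}) = (if linked U F p q then 1 else 2)"
  using component_eq_iff[of U F p q] by auto

lemma glue0:
  assumes "finite VA" "finite VB" "\<And>e. e \<in> FA \<Longrightarrow> e \<subseteq> VA" "\<And>e. e \<in> FB \<Longrightarrow> e \<subseteq> VB"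
    and "VA \<inter> VB \<subseteq> S"
  shows "ncomps (VA \<union> VB - S) (FA \<union> FB) = ncomps (VA - S) FA + ncomps (VB - S) FB"
proof -
  have "(VA - S) \<inter> (VB - S) = {}" "VA \<union> VB - S = (VA - S) \<union> (VB - S)" using assms by auto
  moreover have "e \<inter> ((VA - S) \<union> (VB - S)) \<subseteq> VA - S" if "e \<in> FA" for e using assms that by blast
  moreover have "e \<inter> ((VA - S) \<union> (VB - S)) \<subseteq> VB - S" if "e \<in> FB" for e using assms that by blast
  ultimately show ?thesis using ncomps_glue_general[of "VA - S" "VB - S" FA FB] assms by simp
qed

lemma glue1:
  assumes "finite VA" "finite VB" "\<And>e. e \<in> FA \<Longrightarrow> e \<subseteq> VA" "\<And>e. e \<in> FB \<Longrightarrow> e \<subseteq> VB"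
    and "VA \<inter> VB - S = {w}"
  shows "ncomps (VA \<union> VB - S) (FA \<union> FB) + 1 = ncomps (VA - S) FA + ncomps (VB - S) FB"
proof -
  have "(VA - S) \<inter> (VB - S) = {w}" "VA \<union> VB - S = (VA - S) \<union> (VB - S)" using assms by auto
  moreover have "e \<inter> ((VA - S) \<union> (VB - S)) \<subseteq> VA - S" if "e \<in> FA" for e using assms that by blast
  moreover have "e \<inter> ((VA - S) \<union> (VB - S)) \<subseteq> VB - S" if "e \<in> FB" for e using assms that by blast
  ultimately show ?thesis using ncomps_glue_general[of "VA - S" "VB - S" FA FB] assms by simp
qed

text \<open>Each of the two common vertices merges two components, unless the second merge closes a
  cycle. That happens exactly if both sides already connect \<open>p\<close> and
  \<open>q\<close>.\<close>

lemma glue2: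
  assumes "finite VA" "finite VB" "\<And>e. e \<in> FA \<Longrightarrow> e \<subseteq> VA" "\<And>e. e \<in> FB \<Longrightarrow> e \<subseteq> VB"
    and "VA \<inter> VB - S = {p, q}" "p \<noteq> q"
  shows "ncomps (VA \<union> VB - S) (FA \<union> FB) + 2 = ncomps (VA - S) FA + ncomps (VB - S) FB
    + (if linked (VA - S) FA p q \<and> linked (VB - S) FB p q then 1 else 0)"
proof -
  let ?A = "VA - S" and ?B = "VB - S"
  let ?U = "?A \<union> ?B" and ?F = "FA \<union> FB"
  have W: "?A \<inter> ?B = {p, q}" and U: "VA \<union> VB - S = ?U" using assms by auto
  have pq: "p \<in> ?A" "q \<in> ?A" "p \<in> ?B" "q \<in> ?B" using W by auto
  have hA: "e \<inter> ?U \<subseteq> ?A" if "e \<in> FA" for e using assms(3)[OF that] by auto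
  have hB: "e \<inter> ?U \<subseteq> ?B" if "e \<in> FB" for e using assms(4)[OF that] by auto
  \<comment> \<open>Starting at \<open>p\<close>, a walk can change sides only at \<open>p\<close>
    itself before it reaches \<open>q\<close>. So if no side connects the two, the union of the two
    components of \<open>p\<close> is closed under edges and misses \<open>q\<close>.\<close>
  have link: "linked ?U ?F p q \<longleftrightarrow> linked ?A FA p q \<or> linked ?B FB p q"
  proof
    show "linked ?U ?F p q" if "linked ?A FA p q \<or> linked ?B FB p q" using that by (auto intro: linked_mono)
    show "linked ?A FA p q \<or> linked ?B FB p q" if *: "linked ?U ?F p q"
    proof (rule ccontr)
      assume n: "\<not> (linked ?A FA p q \<or> linked ?B FB p q)"
      have "q \<in> component ?A FA p \<union> component ?B FB p"
      proof (rule linked_closed[OF *])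
        fix u v assume uv: "u \<in> component ?A FA p \<union> component ?B FB p" "u \<in> ?U" "v \<in> ?U" "{u, v} \<in> ?F"
        have nq: "u \<noteq> q" using n uv by (auto simp: component_def)
        show "v \<in> component ?A FA p \<union> component ?B FB p"
        proof (cases "{u, v} \<in> FA")
          case True
          have uvA: "u \<in> ?A" "v \<in> ?A" using hA[OF True] uv by auto
          have "u \<in> component ?A FA p"
          proof (cases "u \<in> component ?A FA p")
            case False
            then have "u \<in> ?B" using uv(1) component_subset[of p ?B FB] pq by blast
            then have "u = p" using W uvA nq by blast
            then show ?thesis by simp
          qed
          then show ?thesis using linked_trans[OF _ linked_edge[OF uvA True]] by (auto simp: component_def)
        next
          case False
          then have FB: "{u, v} \<in> FB" using uv by auto
          have uvB: "u \<in> ?B" "v \<in> ?B" using hB[OF FB] uv by auto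
          have "u \<in> component ?B FB p"
          proof (cases "u \<in> component ?B FB p")
            case False
            then have "u \<in> ?A" using uv(1) component_subset[of p ?A FA] pq by blast
            then have "u = p" using W uvB nq by blast
            then show ?thesis by simp
          qed
          then show ?thesis using linked_trans[OF _ linked_edge[OF uvB FB]] by (auto simp: component_def)
        qed
      qed simp
      then show False using n by (auto simp: component_def)
    qed
  qed
  have "ncomps ?U ?F + card (component ?A FA ` {p, q}) + card (component ?B FB ` {p, q})
    = ncomps ?A FA + ncomps ?B FB + card (component ?U ?F ` {p, q})"
    using ncomps_glue_general[of ?A ?B FA FB] hA hB assms(1,2) unfolding W by simp
  then show ?thesis unfolding U card_component_pair[OF assms(6)] using link by (auto split: if_splits)
qed

lemma ncomps_antimono:
  assumes "finite U" "F \<subseteq> F'"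
  shows "ncomps U F' \<le> ncomps U F"
proof -
  \<comment> \<open>A chosen element sends each component for \<open>F\<close> to the component for
    \<open>F'\<close> that contains it, and this map is onto.\<close>
  define g where "g K = component U F' (SOME x. x \<in> K)" for K
  have "g (component U F x) = component U F' x" if "x \<in> U" for x
  proof -
    have "(SOME y. y \<in> component U F x) \<in> component U F x" by (rule someI[of _ x]) simp
    then have "linked U F' x (SOME y. y \<in> component U F x)" using assms(2) by (auto simp: component_def intro: linked_mono)
    then show ?thesis unfolding g_def using component_eq_iff linked_sym by metis
  qed
  then have "component U F' ` U \<subseteq> g ` (component U F ` U)" by force
  then show ?thesis unfolding ncomps_def using assms(1) by (meson card_image_le card_mono finite_imageI le_trans)
qed

section \<open>Tightness of two-terminal pieces\<close>

definition join1 :: "'a set \<Rightarrow> 'a set set \<Rightarrow> 'a set \<Rightarrow> 'a set set \<Rightarrow> 'a \<Rightarrow> bool" where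
  "join1 VA FA VB FB w \<longleftrightarrow> finite VA \<and> finite VB \<and> (\<forall>e\<in>FA. e \<subseteq> VA) \<and> (\<forall>e\<in>FB. e \<subseteq> VB) \<and> VA \<inter> VB = {w}"

definition join2 :: "'a set \<Rightarrow> 'a set set \<Rightarrow> 'a set \<Rightarrow> 'a set set \<Rightarrow> 'a \<Rightarrow> 'a \<Rightarrow> bool" where
  "join2 VA FA VB FB p q \<longleftrightarrow> finite VA \<and> finite VB \<and> (\<forall>e\<in>FA. e \<subseteq> VA) \<and> (\<forall>e\<in>FB. e \<subseteq> VB)
     \<and> VA \<inter> VB = {p, q} \<and> p \<noteq> q"

lemma join1_commute: "join1 VA FA VB FB w \<Longrightarrow> join1 VB FB VA FA w"
  by (auto simp: join1_def)

lemma join2_commute: "join2 VA FA VB FB p q \<Longrightarrow> join2 VB FB VA FA p q"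
  by (auto simp: join2_def)

lemma join2_swap: "join2 VA FA VB FB p q \<Longrightarrow> join2 VA FA VB FB q p"
  by (auto simp: join2_def)

lemma card_Un_overlap:
  assumes "finite Y" "finite Z" "Y \<inter> Z = W"
  shows "card (Y \<union> Z) + card W = card Y + card Z"
  using card_Un_Int[OF assms(1,2)] assms(3) by simp

text \<open>In this family \<open>in\<close> means that the shared vertices are deleted on both
  sides, \<open>out\<close> that they are kept, and \<open>half\<close> that \<open>q\<close> is
  deleted and \<open>p\<close> is kept. Each rule pairs the count of components with the matching
  count of deleted vertices.\<close>

lemma join1_in:
  assumes "join1 VA FA VB FB w" "Y \<subseteq> VA" "Z \<subseteq> VB" "w \<in> Y" "w \<in> Z"
  shows "ncomps (VA \<union> VB - (Y \<union> Z)) (FA \<union> FB) = ncomps (VA - Y) FA + ncomps (VB - Z) FB"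
    and "card (Y \<union> Z) + 1 = card Y + card Z"
proof -
  have *: "VA \<inter> VB = {w}" "finite VA" "finite VB" using assms(1) by (auto simp: join1_def)
  have "VA - (Y \<union> Z) = VA - Y" "VB - (Y \<union> Z) = VB - Z" using * assms by auto
  then show "ncomps (VA \<union> VB - (Y \<union> Z)) (FA \<union> FB) = ncomps (VA - Y) FA + ncomps (VB - Z) FB"
    using glue0[of VA VB FA FB "Y \<union> Z"] assms by (simp add: join1_def)
  have "Y \<inter> Z = {w}" using * assms by auto
  then show "card (Y \<union> Z) + 1 = card Y + card Z"
    using card_Un_overlap[of Y Z "{w}"] * assms by (simp add: finite_subset)
qed

lemma join1_out:
  assumes "join1 VA FA VB FB w" "Y \<subseteq> VA" "Z \<subseteq> VB" "w \<notin> Y" "w \<notin> Z"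
  shows "ncomps (VA \<union> VB - (Y \<union> Z)) (FA \<union> FB) + 1 = ncomps (VA - Y) FA + ncomps (VB - Z) FB"
    and "card (Y \<union> Z) = card Y + card Z"
proof -
  have *: "VA \<inter> VB = {w}" "finite VA" "finite VB" using assms(1) by (auto simp: join1_def)
  have "VA - (Y \<union> Z) = VA - Y" "VB - (Y \<union> Z) = VB - Z" "VA \<inter> VB - (Y \<union> Z) = {w}" using * assms by auto
  then show "ncomps (VA \<union> VB - (Y \<union> Z)) (FA \<union> FB) + 1 = ncomps (VA - Y) FA + ncomps (VB - Z) FB"
    using glue1[of VA VB FA FB "Y \<union> Z" w] assms by (simp add: join1_def)
  have "Y \<inter> Z = {}" using * assms by auto
  then show "card (Y \<union> Z) = card Y + card Z"
    using card_Un_overlap[of Y Z "{}"] * assms by (simp add: finite_subset)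
qed

lemma join2_in:
  assumes "join2 VA FA VB FB p q" "Y \<subseteq> VA" "Z \<subseteq> VB" "p \<in> Y" "p \<in> Z" "q \<in> Y" "q \<in> Z"
  shows "ncomps (VA \<union> VB - (Y \<union> Z)) (FA \<union> FB) = ncomps (VA - Y) FA + ncomps (VB - Z) FB"
    and "card (Y \<union> Z) + 2 = card Y + card Z"
proof -
  have *: "VA \<inter> VB = {p, q}" "finite VA" "finite VB" "p \<noteq> q" using assms(1) by (auto simp: join2_def)
  have "VA - (Y \<union> Z) = VA - Y" "VB - (Y \<union> Z) = VB - Z" using * assms by auto
  then show "ncomps (VA \<union> VB - (Y \<union> Z)) (FA \<union> FB) = ncomps (VA - Y) FA + ncomps (VB - Z) FB"
    using glue0[of VA VB FA FB "Y \<union> Z"] assms by (simp add: join2_def)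
  have "Y \<inter> Z = {p, q}" using * assms by auto
  then show "card (Y \<union> Z) + 2 = card Y + card Z"
    using card_Un_overlap[of Y Z "{p, q}"] * assms by (simp add: finite_subset)
qed

lemma join2_half:
  assumes "join2 VA FA VB FB p q" "Y \<subseteq> VA" "Z \<subseteq> VB" "p \<notin> Y" "p \<notin> Z" "q \<in> Y" "q \<in> Z"
  shows "ncomps (VA \<union> VB - (Y \<union> Z)) (FA \<union> FB) + 1 = ncomps (VA - Y) FA + ncomps (VB - Z) FB"
    and "card (Y \<union> Z) + 1 = card Y + card Z"
proof -
  have *: "VA \<inter> VB = {p, q}" "finite VA" "finite VB" "p \<noteq> q" using assms(1) by (auto simp: join2_def)
  have "VA - (Y \<union> Z) = VA - Y" "VB - (Y \<union> Z) = VB - Z" using * assms by auto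
  moreover have "VA \<inter> VB - (Y \<union> Z) = {p}" using * assms by auto
  ultimately show "ncomps (VA \<union> VB - (Y \<union> Z)) (FA \<union> FB) + 1 = ncomps (VA - Y) FA + ncomps (VB - Z) FB"
    using glue1[of VA VB FA FB "Y \<union> Z" p] assms by (simp add: join2_def)
  have "Y \<inter> Z = {q}" using * assms by auto
  then show "card (Y \<union> Z) + 1 = card Y + card Z"
    using card_Un_overlap[of Y Z "{q}"] * assms by (simp add: finite_subset)
qed

lemma join2_out:
  assumes "join2 VA FA VB FB p q" "Y \<subseteq> VA" "Z \<subseteq> VB" "p \<notin> Y" "p \<notin> Z" "q \<notin> Y" "q \<notin> Z"
  shows "ncomps (VA \<union> VB - (Y \<union> Z)) (FA \<union> FB) + 2 = ncomps (VA - Y) FA + ncomps (VB - Z) FB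
      + (if linked (VA - Y) FA p q \<and> linked (VB - Z) FB p q then 1 else 0)"
    and "card (Y \<union> Z) = card Y + card Z"
proof -
  have *: "VA \<inter> VB = {p, q}" "finite VA" "finite VB" "p \<noteq> q" using assms(1) by (auto simp: join2_def)
  have "VA - (Y \<union> Z) = VA - Y" "VB - (Y \<union> Z) = VB - Z" using * assms by auto
  moreover have "VA \<inter> VB - (Y \<union> Z) = {p, q}" using * assms by auto
  ultimately show "ncomps (VA \<union> VB - (Y \<union> Z)) (FA \<union> FB) + 2 = ncomps (VA - Y) FA + ncomps (VB - Z) FB
      + (if linked (VA - Y) FA p q \<and> linked (VB - Z) FB p q then 1 else 0)"
    using glue2[of VA VB FA FB "Y \<union> Z" p q] assms by (simp add: join2_def)
  have "Y \<inter> Z = {}" using * assms by auto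
  then show "card (Y \<union> Z) = card Y + card Z"
    using card_Un_overlap[of Y Z "{}"] * assms by (simp add: finite_subset)
qed

lemma join1_ncomps: "join1 VA FA VB FB w \<Longrightarrow> ncomps (VA \<union> VB) (FA \<union> FB) + 1 = ncomps VA FA + ncomps VB FB"
  using join1_out(1)[of VA FA VB FB w "{}" "{}"] by simp

lemma join2_ncomps:
  "join2 VA FA VB FB p q \<Longrightarrow> ncomps (VA \<union> VB) (FA \<union> FB) + 2 = ncomps VA FA + ncomps VB FB
     + (if linked VA FA p q \<and> linked VB FB p q then 1 else 0)"
  using join2_out(1)[of VA FA VB FB p q "{}" "{}"] by simp

lemma split_sub: "S \<subseteq> A \<union> B \<Longrightarrow> S = (S \<inter> A) \<union> (S \<inter> B)"
  by blast

section \<open>Tight, separating and wide sets\<close>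

definition tight :: "'a set \<Rightarrow> 'a set set \<Rightarrow> 'a \<Rightarrow> 'a \<Rightarrow> bool" where
  "tight VE FE p q \<longleftrightarrow> (\<exists>S\<subseteq>VE. q \<in> S \<and> p \<notin> S \<and> 2 * card S \<le> ncomps (VE - S) FE)"

text \<open>For inner sets of a piece, toughness alone gives only \<open>2 * card Y + 1\<close>, see
  \<open>piece_bound\<close>. The stronger bound for separating sets lets \<open>path_tight\<close>
  conclude that a set of positive excess leaves the terminals connected.\<close>

definition sep_bound :: "'a set \<Rightarrow> 'a set set \<Rightarrow> 'a \<Rightarrow> 'a \<Rightarrow> bool" where
  "sep_bound VP FP p q \<longleftrightarrow>
     (\<forall>Y\<subseteq>VP. p \<notin> Y \<longrightarrow> q \<notin> Y \<longrightarrow> \<not> linked (VP - Y) FP p q \<longrightarrow> ncomps (VP - Y) FP \<le> 2 * card Y)"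

text \<open>In \<open>wide\<close> the two terminals in \<open>X\<close> are free of charge: the excess of components over twice the
  number of inner vertices of \<open>X\<close> is at least \<open>k\<close>.\<close>

definition wide :: "nat \<Rightarrow> 'a set \<Rightarrow> 'a set set \<Rightarrow> 'a \<Rightarrow> 'a \<Rightarrow> bool" where
  "wide k VP FP p q \<longleftrightarrow> (\<exists>X\<subseteq>VP. p \<in> X \<and> q \<in> X \<and> 2 * card X + k \<le> ncomps (VP - X) FP + 4)"

text \<open>The two tight sets lie in the environment, the other two conditions concern the piece.
  The width is a parameter because parallel joins add widths.\<close>

definition arm :: "nat \<Rightarrow> 'a set \<Rightarrow> 'a set set \<Rightarrow> 'a \<Rightarrow> 'a \<Rightarrow> 'a set \<Rightarrow> 'a set set \<Rightarrow> bool" where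
  "arm k VP FP p q VE FE \<longleftrightarrow>
     tight VE FE p q \<and> tight VE FE q p \<and> sep_bound VP FP p q \<and> wide k VP FP p q"

lemma sep_bound_swap: "sep_bound VP FP p q \<Longrightarrow> sep_bound VP FP q p"
  unfolding sep_bound_def using linked_sym by metis

lemma wide_swap: "wide k VP FP p q \<Longrightarrow> wide k VP FP q p"
  unfolding wide_def by blast

lemma arm_mono: "arm k VP FP p q VE FE \<Longrightarrow> l \<le> k \<Longrightarrow> arm l VP FP p q VE FE"
  unfolding arm_def wide_def by (metis (no_types, lifting) add_left_mono le_trans)

text \<open>Edges form a plain set, as parallel edges are excluded in
  \<open>minimally_half_tough_crit\<close>. The second inequality in \<open>crit\<close> matters for
  \<open>S = {}\<close>, where the first would already hold for a connected graph.\<close>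

locale crit_graph =
  fixes V :: "'a set" and F :: "'a set set"
  assumes fin: "finite V" and edge: "e \<in> F \<Longrightarrow> e \<subseteq> V \<and> card e = 2" and conn: "ncomps V F = 1"
    and tough: "S \<subseteq> V \<Longrightarrow> S \<noteq> {} \<Longrightarrow> ncomps (V - S) F \<le> 2 * card S"
    and crit: "f \<in> F \<Longrightarrow> \<exists>S\<subseteq>V. 2 * card S + 1 \<le> ncomps (V - S) (F - {f}) \<and> 2 \<le> ncomps (V - S) (F - {f})"
begin

text \<open>The environment contains both terminals and may be disconnected; the piece itself is
  connected.\<close>

definition piece :: "'a set \<Rightarrow> 'a set set \<Rightarrow> 'a \<Rightarrow> 'a \<Rightarrow> 'a set \<Rightarrow> 'a set set \<Rightarrow> bool" where
  "piece VP FP p q VE FE \<longleftrightarrow> join2 VP FP VE FE p q \<and> V = VP \<union> VE \<and> F = FP \<union> FE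
     \<and> FP \<inter> FE = {} \<and> ncomps VP FP = 1"

section \<open>Bounds that toughness imposes on a piece and on its environment\<close>

lemma tough1: "S \<subseteq> V \<Longrightarrow> ncomps (V - S) F \<le> 2 * card S + 1"
  using tough[of S] conn by (cases "S = {}") auto

lemma piece_swap: "piece VP FP p q VE FE \<Longrightarrow> piece VP FP q p VE FE"
  unfolding piece_def using join2_swap[of VP FP VE FE p q] by simp

lemma pieceD:
  assumes "piece VP FP p q VE FE"
  shows "join2 VP FP VE FE p q" "V = VP \<union> VE" "F = FP \<union> FE" "FP \<inter> FE = {}" "ncomps VP FP = 1"
    "p \<noteq> q" "p \<in> VP" "q \<in> VP" "p \<in> VE" "q \<in> VE" "VP \<inter> VE = {p, q}" "finite VP" "finite VE"
  using assms unfolding piece_def join2_def by blast+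

lemma piece_edges:
  assumes "piece VP FP p q VE FE"
  shows "\<forall>e\<in>FP. e \<subseteq> VP" "\<forall>e\<in>FE. e \<subseteq> VE"
  using assms unfolding piece_def join2_def by blast+

lemma piece_linked: "piece VP FP p q VE FE \<Longrightarrow> linked VP FP p q"
  using ncomps_one_linked[of VP FP p q] pieceD by metis

text \<open>In the union of \<open>Y\<close> with a tight set, one component is lost at
  \<open>p\<close> and one vertex is saved at \<open>q\<close>. The balance is +1, so toughness
  leaves excess at most -1 for \<open>Y\<close>.\<close>

lemma piece_end_bound:
  assumes pc: "piece VP FP p q VE FE" and t: "tight VE FE p q"
    and Y: "Y \<subseteq> VP" "q \<in> Y" "p \<notin> Y"
  shows "ncomps (VP - Y) FP + 1 \<le> 2 * card Y"
proof -
  note P = pieceD[OF pc]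
  obtain Z where Z: "Z \<subseteq> VE" "q \<in> Z" "p \<notin> Z" "2 * card Z \<le> ncomps (VE - Z) FE"
    using t unfolding tight_def by blast
  note g = join2_half[OF P(1) Y(1) Z(1) Y(3) Z(3) Y(2) Z(2)]
  have "ncomps (V - (Y \<union> Z)) F \<le> 2 * card (Y \<union> Z)" using Y Z P(2) by (intro tough) auto
  then show ?thesis using g Z(4) P(2,3) by simp
qed

lemma piece_bound:
  assumes pc: "piece VP FP p q VE FE" and Y: "Y \<subseteq> VP" "q \<notin> Y" "p \<notin> Y"
  shows "ncomps (VP - Y) FP \<le> 2 * card Y + 1"
proof (cases "Y = {}")
  case True then show ?thesis using pieceD(5)[OF pc] by simp
next
  case False
  note P = pieceD[OF pc]
  note g = join2_out[OF P(1) Y(1), of "{}"]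
  have "ncomps VE FE \<ge> 1" using P(9,13) by (intro ncomps_ge1) auto
  moreover have "ncomps (V - Y) F \<le> 2 * card Y" using False Y P(2) by (intro tough) auto
  ultimately show ?thesis using g(1) Y P(2,3) by (simp split: if_splits)
qed

text \<open>\<open>Y\<close> may be empty, hence \<open>tough1\<close>. The constant two allows for
  an environment that falls apart into two halves.\<close>

lemma env_bound:
  assumes pc: "piece VP FP p q VE FE" and Y: "Y \<subseteq> VE" "q \<notin> Y" "p \<notin> Y"
  shows "ncomps (VE - Y) FE \<le> 2 * card Y + 2"
proof -
  note P = pieceD[OF pc]
  note g = join2_out[OF P(1) _ Y(1), of "{}"]
  have "ncomps (V - Y) F \<le> 2 * card Y + 1" using Y P(2) by (intro tough1) auto
  then show ?thesis using g(1) Y P(2,3,5) by (simp split: if_splits)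
qed

section \<open>Parallel composition\<close>

lemma par_split:
  assumes pc: "piece (VP \<union> VQ) (FP \<union> FQ) p q VE FE" and j: "join2 VP FP VQ FQ p q"
    and d: "FP \<inter> FQ = {}" and n: "ncomps VP FP = 1"
  shows "piece VP FP p q (VQ \<union> VE) (FQ \<union> FE)" "join2 VQ FQ VE FE p q"
proof -
  note P = pieceD[OF pc]
  show "join2 VQ FQ VE FE p q" using P(1) j unfolding join2_def by auto
  show "piece VP FP p q (VQ \<union> VE) (FQ \<union> FE)" unfolding piece_def
    using P(1-4,11) j d n unfolding join2_def by auto
qed

text \<open>The surplus of two that \<open>env_bound\<close> leaves to the environment is used up by
  the two kept terminals, because a separating set closes no cycle. So the bound for
  \<open>VQ\<close> carries over.\<close>

lemma env_sep_bound:
  assumes pc: "piece (VP \<union> VQ) (FP \<union> FQ) p q VE FE" and j: "join2 VQ FQ VE FE p q"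
    and c: "sep_bound VQ FQ p q"
  shows "sep_bound (VQ \<union> VE) (FQ \<union> FE) p q"
  unfolding sep_bound_def
proof (intro allI impI)
  fix Y assume Y: "Y \<subseteq> VQ \<union> VE" "p \<notin> Y" "q \<notin> Y" "\<not> linked (VQ \<union> VE - Y) (FQ \<union> FE) p q"
  let ?Q = "Y \<inter> VQ" and ?E = "Y \<inter> VE"
  note Y' = split_sub[OF Y(1)]
  note g = join2_out[OF j, of ?Q ?E]
  have "\<not> linked (VQ - ?Q) FQ p q"
    using Y(4) linked_mono[of "VQ - ?Q" FQ p q "VQ \<union> VE - Y" "FQ \<union> FE"] by blast
  then have "ncomps (VQ - ?Q) FQ \<le> 2 * card ?Q" using c Y unfolding sep_bound_def by auto
  moreover have "ncomps (VE - ?E) FE \<le> 2 * card ?E + 2" using Y by (intro env_bound[OF pc]) auto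
  ultimately show "ncomps (VQ \<union> VE - Y) (FQ \<union> FE) \<le> 2 * card Y"
    using g Y(2,3) Y' \<open>\<not> linked (VQ - ?Q) FQ p q\<close> by simp
qed

text \<open>A tight set of Q together with E is split into its two parts. The environment of Q is
  tight as well, so \<open>piece_end_bound\<close> gives the part in Q excess at most -1, and the
  part in E has to be tight.\<close>

lemma par_tight:
  assumes pc: "piece (VP \<union> VQ) (FP \<union> FQ) p q VE FE" and j: "join2 VP FP VQ FQ p q"
    and d: "FP \<inter> FQ = {}" and n: "ncomps VQ FQ = 1"
    and t: "tight (VQ \<union> VE) (FQ \<union> FE) p q" "tight (VP \<union> VE) (FP \<union> FE) p q"
  shows "tight VE FE p q"
proof -
  have pcQ: "piece VQ FQ p q (VP \<union> VE) (FP \<union> FE)"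
    using par_split(1)[of VQ VP FQ FP p q VE FE] pc join2_commute[OF j] d n
    by (simp add: Un_commute Int_commute)
  have jQ: "join2 VQ FQ VE FE p q"
    using pieceD(1)[OF pc] j unfolding join2_def by auto
  obtain S where S: "S \<subseteq> VQ \<union> VE" "q \<in> S" "p \<notin> S" "2 * card S \<le> ncomps (VQ \<union> VE - S) (FQ \<union> FE)"
    using t(1) unfolding tight_def by blast
  let ?Q = "S \<inter> VQ" and ?E = "S \<inter> VE"
  have q: "q \<in> VQ" "q \<in> VE" using jQ by (auto simp: join2_def)
  note S' = split_sub[OF S(1)]
  note g = join2_half[OF jQ, of ?Q ?E]
  have "ncomps (VQ - ?Q) FQ + 1 \<le> 2 * card ?Q"
    by (rule piece_end_bound[OF pcQ t(2)]) (use S q in auto)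
  then have "2 * card ?E \<le> ncomps (VE - ?E) FE" using g S q S' by simp
  then show ?thesis unfolding tight_def using S(2,3) q by (intro exI[of _ ?E]) simp
qed

lemma par_sep_bound:
  assumes j: "join2 VP FP VQ FQ p q" and c: "sep_bound VP FP p q" "sep_bound VQ FQ p q"
  shows "sep_bound (VP \<union> VQ) (FP \<union> FQ) p q"
  unfolding sep_bound_def
proof (intro allI impI)
  fix Y assume Y: "Y \<subseteq> VP \<union> VQ" "p \<notin> Y" "q \<notin> Y" "\<not> linked (VP \<union> VQ - Y) (FP \<union> FQ) p q"
  let ?P = "Y \<inter> VP" and ?Q = "Y \<inter> VQ"
  note Y' = split_sub[OF Y(1)]
  note g = join2_out[OF j, of ?P ?Q]
  have n: "\<not> linked (VP - ?P) FP p q" "\<not> linked (VQ - ?Q) FQ p q"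
    using Y(4) linked_mono[of "VP - ?P" FP p q "VP \<union> VQ - Y" "FP \<union> FQ"]
      linked_mono[of "VQ - ?Q" FQ p q "VP \<union> VQ - Y" "FP \<union> FQ"] by blast+
  then have "ncomps (VQ - ?Q) FQ \<le> 2 * card ?Q" "ncomps (VP - ?P) FP \<le> 2 * card ?P"
    using c Y unfolding sep_bound_def by auto
  then show "ncomps (VP \<union> VQ - Y) (FP \<union> FQ) \<le> 2 * card Y" using g Y(2,3) Y' n by simp
qed

text \<open>Widths add up because the only vertices shared by the two sets are the terminals, which
  are free of charge.\<close>

lemma par_wide:
  assumes j: "join2 VP FP VQ FQ p q" and w: "wide k VP FP p q" "wide l VQ FQ p q"
  shows "wide (k + l) (VP \<union> VQ) (FP \<union> FQ) p q"
proof -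
  obtain X where X: "X \<subseteq> VP" "p \<in> X" "q \<in> X" "2 * card X + k \<le> ncomps (VP - X) FP + 4"
    using w(1) unfolding wide_def by blast
  obtain Y where Y: "Y \<subseteq> VQ" "p \<in> Y" "q \<in> Y" "2 * card Y + l \<le> ncomps (VQ - Y) FQ + 4"
    using w(2) unfolding wide_def by blast
  note g = join2_in[OF j X(1) Y(1) X(2) Y(2) X(3) Y(3)]
  have "2 * card (X \<union> Y) + (k + l) \<le> ncomps (VP \<union> VQ - (X \<union> Y)) (FP \<union> FQ) + 4"
    using g X(4) Y(4) by simp
  then show ?thesis unfolding wide_def using X Y by (intro exI[of _ "X \<union> Y"]) auto
qed

lemma par_arm:
  assumes pc: "piece (VP \<union> VQ) (FP \<union> FQ) p q VE FE" and j: "join2 VP FP VQ FQ p q"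
    and d: "FP \<inter> FQ = {}" and n: "ncomps VQ FQ = 1"
    and a: "arm k VP FP p q (VQ \<union> VE) (FQ \<union> FE)" "arm l VQ FQ p q (VP \<union> VE) (FP \<union> FE)"
  shows "arm (k + l) (VP \<union> VQ) (FP \<union> FQ) p q VE FE"
  using a par_tight[OF pc j d n] par_tight[OF piece_swap[OF pc] join2_swap[OF j] d n]
    par_sep_bound[OF j] par_wide[OF j] unfolding arm_def by blast

text \<open>A pendant edge at \<open>q\<close> in the environment: a set that is tight at \<open>q\<close> stays too good
  after \<open>q\<close> is dropped from it.\<close>

lemma leaf_not_tight:
  assumes pc: "piece VP FP p q VE FE" and l: "linked VE FE p q"
    and z: "z \<in> VE" "z \<noteq> q" "{q, z} \<in> FE" "\<And>e. e \<in> FE \<Longrightarrow> q \<in> e \<Longrightarrow> e = {q, z}"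
  shows "\<not> tight VE FE p q"
proof
  note P = pieceD[OF pc]
  assume "tight VE FE p q"
  then obtain S where S: "S \<subseteq> VE" "q \<in> S" "p \<notin> S" "2 * card S \<le> ncomps (VE - S) FE"
    unfolding tight_def by blast
  have finS: "finite S" using S(1) P(13) finite_subset by blast
  let ?S = "S - {q}" and ?F = "FE - {{q, z}}"
  have j: "join1 {q, z} {{q, z}} (VE - {q}) ?F z"
    unfolding join1_def using P(13) piece_edges(2)[OF pc] z(1,2,4) by blast
  have V: "{q, z} \<union> (VE - {q}) = VE" "{{q, z}} \<union> ?F = FE" using z(1,3) P(10) by auto
  have rest: "ncomps (VE - {q} - ?S) ?F = ncomps (VE - S) FE"
  proof -
    have "VE - {q} - ?S = VE - S" using S by auto
    moreover have "ncomps (VE - S) ?F = ncomps (VE - S) FE" by (rule ncomps_cong) (use S(2) in blast)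
    ultimately show ?thesis by simp
  qed
  \<comment> \<open>When \<open>q\<close> is put back, it joins the component of \<open>z\<close>,
    or forms a new one if \<open>z\<close> is deleted. The number of components does not fall, while
    the cost falls by two.\<close>
  have "ncomps (VE - S) FE \<le> ncomps (VE - ?S) FE"
  proof (cases "z \<in> S")
    case True
    have e: "({q, z} \<inter> ?S) \<union> ?S = ?S" "{q, z} - ({q, z} \<inter> ?S) = {q}" using True z(2) by auto
    have "?S \<subseteq> VE - {q}" "z \<in> {q, z} \<inter> ?S" "z \<in> ?S" using S(1) True z(2) by auto
    then show ?thesis
      using join1_in(1)[OF j, of "{q, z} \<inter> ?S" ?S, unfolded V e rest] by simp
  next
    case False
    have "?S \<subseteq> VE - {q}" "z \<notin> ?S" using S(1) False by auto
    moreover have "ncomps {q, z} {{q, z}} \<ge> 1" by (intro ncomps_ge1) auto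
    ultimately show ?thesis
      using join1_out(1)[OF j, of "{}" ?S, unfolded Un_empty_left V rest] by simp
  qed
  then have big: "2 * card ?S + 2 \<le> ncomps (VE - ?S) FE"
    using S(4) card_Suc_Diff1[OF finS S(2)] by linarith
  note g = join2_out(1)[OF P(1), of "{}" ?S]
  \<comment> \<open>Excess two in the environment is too much. For the empty set, the environment
    would be disconnected, contrary to \<open>l\<close>; otherwise keeping both terminals costs two,
    the piece supplies one component, and a positive excess remains.\<close>
  show False
  proof (cases "?S = {}")
    case True
    have "ncomps VE FE = 1" using join2_ncomps[OF P(1)] l piece_linked[OF pc] P(2,3,5) conn by simp
    then show False using big unfolding True by simp
  next
    case False
    have "ncomps (V - ?S) F \<le> 2 * card ?S" using S P(2) False by (intro tough) auto
    moreover have "?S \<subseteq> VE" using S(1) by blast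
    ultimately show False using g big S(3) P(2,3,5) by (simp split: if_splits)
  qed
qed

section \<open>Series composition\<close>

lemma ser_tight:
  assumes pc: "piece (VP \<union> VQ) (FP \<union> FQ) p r VR FR" and j: "join1 VP FP VQ FQ q"
    and q: "p \<in> VP" "q \<noteq> p" "r \<in> VQ" "q \<noteq> r" and n: "ncomps VQ FQ = 1"
    and d: "FP \<inter> FQ = {}"
    and t: "tight (VQ \<union> VR) (FQ \<union> FR) q p" "tight (VP \<union> VR) (FP \<union> FR) q r"
    and w: "wide 2 VP FP p q" "wide 2 VQ FQ q r"
  shows "tight VR FR r p"
proof -
  note P = pieceD[OF pc]
  note PE = piece_edges[OF pc]
  have JE: "\<forall>e\<in>FP. e \<subseteq> VP" "\<forall>e\<in>FQ. e \<subseteq> VQ" and J: "finite VP" "finite VQ" "VP \<inter> VQ = {q}"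
    using j unfolding join1_def by blast+
  have rp: "r \<notin> VP" "p \<notin> VQ" "q \<notin> VR" using J(3) q P(11) by auto
  have "VQ \<inter> VR \<subseteq> {p, r}" "r \<in> VR" using P(11) by auto
  then have QR: "VQ \<inter> VR = {r}" using rp(2) q(3) by auto
  have jQR: "join1 VQ FQ VR FR r" using J(1,2) JE PE P(13) QR unfolding join1_def by blast
  have pcQ: "piece VQ FQ q r (VP \<union> VR) (FP \<union> FR)"
    unfolding piece_def join2_def using J JE PE P(2-4,11,13) q n d by auto
  \<comment> \<open>A tight set that deletes \<open>p\<close> and keeps \<open>q\<close> is
    restricted to \<open>VR\<close>. If it keeps \<open>r\<close>, the excess of its part in
    \<open>VQ\<close> is at most 1, which is just what is lost at \<open>r\<close>, so the
    restriction is tight. If it deletes \<open>r\<close>, toughness is violated.\<close>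
  obtain S where S: "S \<subseteq> VQ \<union> VR" "p \<in> S" "q \<notin> S" "2 * card S \<le> ncomps (VQ \<union> VR - S) (FQ \<union> FR)"
    using t(1) unfolding tight_def by blast
  let ?Q = "S \<inter> VQ" and ?R = "S \<inter> VR"
  note S' = split_sub[OF S(1)]
  have r: "r \<in> VQ" "r \<in> VR" using QR by auto
  show ?thesis
  proof (cases "r \<in> S")
    case True
    note g = join1_in[OF jQR, of ?Q ?R]
    have "ncomps (VQ - ?Q) FQ + 1 \<le> 2 * card ?Q"
      by (rule piece_end_bound[OF pcQ t(2)]) (use S True r in auto)
    then have R: "2 * card ?R \<le> ncomps (VR - ?R) FR + 1" using g S True r S' by simp
    obtain X where X: "X \<subseteq> VP" "p \<in> X" "q \<in> X" "2 * card X + 2 \<le> ncomps (VP - X) FP + 4"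
      using w(1) unfolding wide_def by blast
    obtain Y where Y: "Y \<subseteq> VQ" "q \<in> Y" "r \<in> Y" "2 * card Y + 2 \<le> ncomps (VQ - Y) FQ + 4"
      using w(2) unfolding wide_def by blast
    \<comment> \<open>The shared vertex \<open>q\<close> is deleted on both sides, so
      \<open>X \<union> Y\<close> has excess at least -2. With excess at least -1 of
      \<open>?R\<close> and +4 for the terminals \<open>p\<close> and \<open>r\<close>, the whole
      graph gets excess at least 1.\<close>
    note g1 = join1_in[OF j X(1) Y(1) X(3) Y(2)]
    have g2: "ncomps (V - (X \<union> Y \<union> ?R)) F = ncomps (VP \<union> VQ - (X \<union> Y)) (FP \<union> FQ) + ncomps (VR - ?R) FR"
      "card (X \<union> Y \<union> ?R) + 2 = card (X \<union> Y) + card ?R"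
      using join2_in[OF P(1), of "X \<union> Y" ?R] X(1-3) Y(1-3) S(2) True r P(2,3,9,10) by auto
    have "ncomps (V - (X \<union> Y \<union> ?R)) F \<le> 2 * card (X \<union> Y \<union> ?R)"
      using X Y P(2) by (intro tough) auto
    then show ?thesis using g1 g2 R X(4) Y(4) by simp
  next
    case False
    note g = join1_out[OF jQR, of ?Q ?R]
    have "ncomps (VQ - ?Q) FQ \<le> 2 * card ?Q + 1"
      by (rule piece_bound[OF pcQ]) (use S False in auto)
    then have "2 * card ?R \<le> ncomps (VR - ?R) FR" using g S False S' by simp
    then show ?thesis unfolding tight_def using S(2) P(9) False by (intro exI[of _ ?R]) simp
  qed
qed

text \<open>Two is the width that series joins reproduce: the widths of the two pieces add up to
  four, and the common vertex, now an inner one, costs two.\<close>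

lemma ser_arm:
  assumes pc: "piece (VP \<union> VQ) (FP \<union> FQ) p r VR FR" and j: "join1 VP FP VQ FQ q"
    and q: "p \<in> VP" "q \<noteq> p" "r \<in> VQ" "q \<noteq> r" and n: "ncomps VP FP = 1" "ncomps VQ FQ = 1"
    and d: "FP \<inter> FQ = {}"
    and a: "arm 2 VP FP p q (VQ \<union> VR) (FQ \<union> FR)" "arm 2 VQ FQ q r (VP \<union> VR) (FP \<union> FR)"
  shows "arm 2 (VP \<union> VQ) (FP \<union> FQ) p r VR FR"
proof -
  note P = pieceD[OF pc]
  note PE = piece_edges[OF pc]
  have JE: "\<forall>e\<in>FP. e \<subseteq> VP" "\<forall>e\<in>FQ. e \<subseteq> VQ" and J: "finite VP" "finite VQ" "VP \<inter> VQ = {q}"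
    using j unfolding join1_def by blast+
  have rp: "r \<notin> VP" "p \<notin> VQ" "q \<notin> VR" using J(3) q P(11) by auto
  have pcQ: "piece VQ FQ q r (VP \<union> VR) (FP \<union> FR)"
    unfolding piece_def join2_def using J JE PE P(2-4,11,13) rp q n d by auto
  have pcP: "piece VP FP p q (VQ \<union> VR) (FQ \<union> FR)"
    unfolding piece_def join2_def using J JE PE P(2-4,11,13) rp q n d by auto
  have pc': "piece (VQ \<union> VP) (FQ \<union> FP) r p VR FR"
    using piece_swap[OF pc] by (simp add: Un_commute)
  note A = a[unfolded arm_def]
  have "tight VR FR r p"
    by (rule ser_tight[OF pc j q n(2) d]) (use A in auto)
  moreover have "tight VR FR p r"
    by (rule ser_tight[OF pc' join1_commute[OF j] q(3,4,1,2) n(1)]) (use A d wide_swap in auto)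
  moreover have "wide 2 (VP \<union> VQ) (FP \<union> FQ) p r"
  proof -
    obtain X where X: "X \<subseteq> VP" "p \<in> X" "q \<in> X" "2 * card X + 2 \<le> ncomps (VP - X) FP + 4"
      using A(1) unfolding wide_def by blast
    obtain Y where Y: "Y \<subseteq> VQ" "q \<in> Y" "r \<in> Y" "2 * card Y + 2 \<le> ncomps (VQ - Y) FQ + 4"
      using A(2) unfolding wide_def by blast
    note g1 = join1_in[OF j X(1) Y(1) X(3) Y(2)]
    have "2 * card (X \<union> Y) + 2 \<le> ncomps (VP \<union> VQ - (X \<union> Y)) (FP \<union> FQ) + 4"
      using g1 X(4) Y(4) by simp
    then show ?thesis unfolding wide_def using X Y by (intro exI[of _ "X \<union> Y"]) auto
  qed
  moreover have "sep_bound (VP \<union> VQ) (FP \<union> FQ) p r"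
    unfolding sep_bound_def
  proof (intro allI impI)
    fix Y assume Y: "Y \<subseteq> VP \<union> VQ" "p \<notin> Y" "r \<notin> Y" "\<not> linked (VP \<union> VQ - Y) (FP \<union> FQ) p r"
    let ?P = "Y \<inter> VP" and ?Q = "Y \<inter> VQ"
    note Y' = split_sub[OF Y(1)]
    \<comment> \<open>If \<open>q\<close> is deleted, both parts have excess at most -1, which pays
      for the +2 at \<open>q\<close>. If \<open>q\<close> is kept, a set that separates
      \<open>p\<close> from \<open>r\<close> also separates the terminals of one of the two pieces,
      and the separation bound of that piece saves the missing unit.\<close>
    show "ncomps (VP \<union> VQ - Y) (FP \<union> FQ) \<le> 2 * card Y"
    proof (cases "q \<in> Y")
      case True
      have "ncomps (VP - ?P) FP + 1 \<le> 2 * card ?P"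
        by (rule piece_end_bound[OF pcP]) (use A Y True J in auto)
      moreover have "ncomps (VQ - ?Q) FQ + 1 \<le> 2 * card ?Q"
        by (rule piece_end_bound[OF piece_swap[OF pcQ]]) (use A Y True J in auto)
      moreover have "q \<in> ?P" "q \<in> ?Q" using True J by auto
      ultimately show ?thesis using join1_in[OF j, of ?P ?Q] Y' by simp
    next
      case False
      have b: "ncomps (VP - ?P) FP \<le> 2 * card ?P + 1" "ncomps (VQ - ?Q) FQ \<le> 2 * card ?Q + 1"
        using piece_bound[OF pcP, of ?P] piece_bound[OF pcQ, of ?Q] Y False by auto
      have "\<not> linked (VP - ?P) FP p q \<or> \<not> linked (VQ - ?Q) FQ q r"
      proof (rule ccontr)
        assume "\<not> ?thesis"
        then have "linked (VP \<union> VQ - Y) (FP \<union> FQ) p q" "linked (VP \<union> VQ - Y) (FP \<union> FQ) q r"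
          using linked_mono[of "VP - ?P" FP p q "VP \<union> VQ - Y" "FP \<union> FQ"]
            linked_mono[of "VQ - ?Q" FQ q r "VP \<union> VQ - Y" "FP \<union> FQ"] by blast+
        then show False using Y(4) linked_trans by metis
      qed
      then have "ncomps (VP - ?P) FP \<le> 2 * card ?P \<or> ncomps (VQ - ?Q) FQ \<le> 2 * card ?Q"
      proof
        assume "\<not> linked (VP - ?P) FP p q"
        moreover have "sep_bound VP FP p q" using A by blast
        ultimately have "ncomps (VP - ?P) FP \<le> 2 * card ?P"
          unfolding sep_bound_def using Y(2) False by simp
        then show ?thesis ..
      next
        assume "\<not> linked (VQ - ?Q) FQ q r"
        moreover have "sep_bound VQ FQ q r" using A by blast
        ultimately have "ncomps (VQ - ?Q) FQ \<le> 2 * card ?Q"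
          unfolding sep_bound_def using Y(3) False by simp
        then show ?thesis ..
      qed
      then show ?thesis using b join1_out[OF j, of ?P ?Q] False Y' by fastforce
    qed
  qed
  ultimately show ?thesis by (simp add: arm_def)
qed

section \<open>Pieces between two disjoint halves of the graph\<close>

lemma top_half:
  assumes pc: "piece VP FP p q (VL \<union> VR) (FL \<union> FR)" and LR: "VL \<inter> VR = {}" "p \<in> VL" "q \<in> VR"
    and e: "\<And>e. e \<in> FL \<Longrightarrow> e \<subseteq> VL" "\<And>e. e \<in> FR \<Longrightarrow> e \<subseteq> VR"
    and t: "tight (VL \<union> VR) (FL \<union> FR) p q"
  shows "\<exists>Z\<subseteq>VR. q \<in> Z \<and> 2 * card Z \<le> ncomps (VR - Z) FR + 1"
proof -
  note P = pieceD[OF pc]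
  obtain S where S: "S \<subseteq> VL \<union> VR" "q \<in> S" "p \<notin> S" "2 * card S \<le> ncomps (VL \<union> VR - S) (FL \<union> FR)"
    using t unfolding tight_def by blast
  let ?L = "S \<inter> VL" and ?R = "S \<inter> VR"
  have fin': "finite VL" "finite VR" "finite S" using P(13) S(1) finite_subset[of S "VL \<union> VR"] by simp_all
  have "ncomps (VL \<union> VR - S) (FL \<union> FR) = ncomps (VL - S) FL + ncomps (VR - S) FR"
    using glue0[of VL VR FL FR S] fin' e LR by simp
  moreover have "VL - S = VL - ?L" "VR - S = VR - ?R" by auto
  moreover have "card S = card ?L + card ?R"
    using split_sub[OF S(1)] card_Un_disjoint[of ?L ?R] LR fin' by (metis Int_assoc Int_commute Int_empty_right finite_Int)
  \<comment> \<open>The left half meets the rest of the graph in \<open>p\<close> alone, so a set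
    that keeps \<open>p\<close> has excess at most 1 there. The right half of a tight set therefore
    falls short by at most one.\<close>
  moreover have "ncomps (VL - ?L) FL \<le> 2 * card ?L + 1"
  proof -
    have "VL \<inter> (VP \<union> VR) = {p}" using P(11) LR by blast
    then have j: "join1 VL FL (VP \<union> VR) (FP \<union> FR) p"
      unfolding join1_def
    proof (intro conjI)
      show "\<forall>e\<in>FL. e \<subseteq> VL" using e(1) by blast
      show "\<forall>e\<in>FP \<union> FR. e \<subseteq> VP \<union> VR" using e(2) piece_edges(1)[OF pc] by blast
    qed (use fin' P(12) in simp_all)
    have "ncomps (VP \<union> VR) (FP \<union> FR) \<ge> 1" using fin' P(7,12) by (intro ncomps_ge1) auto
    moreover have "V = VL \<union> (VP \<union> VR)" "F = FL \<union> (FP \<union> FR)" using P(2,3) by auto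
    moreover have "ncomps (V - ?L) F \<le> 2 * card ?L + 1" using P(2) by (intro tough1) auto
    ultimately show ?thesis using join1_out(1)[OF j, of ?L "{}"] S by simp
  qed
  ultimately have "2 * card ?R \<le> ncomps (VR - ?R) FR + 1" using S by simp
  then show ?thesis using S(2) LR(3) by (intro exI[of _ ?R]) simp
qed

text \<open>Each half has a set of excess at least -1 that deletes its terminal. A wide set of the
  piece has excess at least \<open>k\<close> - 4 and the two deleted terminals give +4, so the total
  is at least \<open>k\<close> - 2 and toughness yields the bound. A half consisting of a bare
  terminal offers only excess -2.\<close>

lemma top_arm:
  assumes pc: "piece VP FP p q (VL \<union> VR) (FL \<union> FR)" and LR: "VL \<inter> VR = {}" "p \<in> VL" "q \<in> VR"
    and e: "\<And>e. e \<in> FL \<Longrightarrow> e \<subseteq> VL" "\<And>e. e \<in> FR \<Longrightarrow> e \<subseteq> VR"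
    and a: "arm k VP FP p q (VL \<union> VR) (FL \<union> FR)"
  shows "k \<le> 2" "VL \<noteq> {p}" "VR \<noteq> {q}"
proof -
  note P = pieceD[OF pc]
  note A = a[unfolded arm_def]
  obtain Z where Z: "Z \<subseteq> VR" "q \<in> Z" "2 * card Z \<le> ncomps (VR - Z) FR + 1"
    using top_half[OF pc LR e] A by auto
  obtain Y where Y: "Y \<subseteq> VL" "p \<in> Y" "2 * card Y \<le> ncomps (VL - Y) FL + 1"
    using top_half[of VP FP q p VR VL FR FL] piece_swap[OF pc] LR e A by (auto simp: Un_commute Int_commute)
  have fin': "finite VL" "finite VR" "finite Z" "finite Y" using P(13) finite_subset[OF Y(1)] finite_subset[OF Z(1)] by simp_all
  show "VR \<noteq> {q}"
  proof
    assume "VR = {q}"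
    then have "Z = {q}" using Z by auto
    then show False using Z \<open>VR = {q}\<close> by simp
  qed
  show "VL \<noteq> {p}"
  proof
    assume "VL = {p}"
    then have "Y = {p}" using Y by auto
    then show False using Y \<open>VL = {p}\<close> by simp
  qed
  obtain X where X: "X \<subseteq> VP" "p \<in> X" "q \<in> X" "2 * card X + k \<le> ncomps (VP - X) FP + 4"
    using A unfolding wide_def by blast
  have "VL - (Y \<union> Z) = VL - Y" "VR - (Y \<union> Z) = VR - Z" "Y \<inter> Z = {}" using LR Y Z by auto
  then have g: "ncomps (VL \<union> VR - (Y \<union> Z)) (FL \<union> FR) = ncomps (VL - Y) FL + ncomps (VR - Z) FR"
    "card (Y \<union> Z) = card Y + card Z"
    using glue0[of VL VR FL FR "Y \<union> Z"] fin' e LR by (auto simp: card_Un_disjoint)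
  have "ncomps (V - (X \<union> (Y \<union> Z))) F \<le> 2 * card (X \<union> (Y \<union> Z))" using X Y Z P(2) by (intro tough) auto
  moreover have "Y \<union> Z \<subseteq> VL \<union> VR" using Y(1) Z(1) by blast
  ultimately show "k \<le> 2"
    using join2_in[OF P(1) X(1), of "Y \<union> Z"] g X Y Z P(2,3) by simp
qed

end

section \<open>Paths\<close>

definition path_edges :: "'a list \<Rightarrow> 'a set list" where
  "path_edges vs = map2 (\<lambda>u v. {u, v}) vs (tl vs)"

lemma path_edges_simps [simp]: "path_edges [] = []" "path_edges [v] = []" "path_edges (u # v # vs) = {u, v} # path_edges (v # vs)"
  by (auto simp: path_edges_def)

lemma path_edges_subset: "e \<in> set (path_edges vs) \<Longrightarrow> e \<subseteq> set vs"
  by (induction vs rule: induct_list012) auto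

lemma path_edges_append:
  "xs \<noteq> [] \<Longrightarrow> ys \<noteq> [] \<Longrightarrow> path_edges (xs @ ys) = path_edges xs @ {last xs, hd ys} # path_edges ys"
  by (induction xs rule: induct_list012) (auto simp: neq_Nil_conv)

lemma mset_path_edges_rev: "mset (path_edges (rev vs)) = mset (path_edges vs)"
proof (induction vs rule: induct_list012)
  case (3 x y zs)
  have "path_edges (rev (x # y # zs)) = path_edges (rev (y # zs)) @ [{y, x}]"
    using path_edges_append[of "rev (y # zs)" "[x]"] by simp
  then show ?case using 3 by (simp add: insert_commute)
qed auto

lemma set_path_edges_rev [simp]: "set (path_edges (rev vs)) = set (path_edges vs)"
  using mset_path_edges_rev mset_eq_setD by blast

lemma mset_path_edges_join:
  assumes "vs \<noteq> []" "ws \<noteq> []" "last vs = hd ws"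
  shows "mset (path_edges (vs @ tl ws)) = mset (path_edges vs) + mset (path_edges ws)"
proof (cases "tl ws")
  case Nil then show ?thesis using assms by (cases ws) auto
next
  case (Cons w us)
  then have ws: "ws = last vs # w # us" using assms by (cases ws) auto
  show ?thesis using path_edges_append[of vs "w # us"] assms(1) by (simp add: ws)
qed

lemma path_edges_card: "distinct vs \<Longrightarrow> e \<in> set (path_edges vs) \<Longrightarrow> card e = 2"
  by (induction vs rule: induct_list012) auto

lemma distinct_path_edges: "distinct vs \<Longrightarrow> distinct (path_edges vs)"
proof (induction vs rule: induct_list012)
  case (3 x y zs)
  then show ?case using path_edges_subset[of "{x, y}" "y # zs"] by auto
qed auto

text \<open>This separates the two branches of a pearl: an edge common to both would have to join
  the terminals.\<close>

lemma path_edges_ends: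
  assumes "distinct vs" "length vs \<ge> 3"
  shows "{hd vs, last vs} \<notin> set (path_edges vs)"
proof -
  obtain x y zs where vs: "vs = x # y # zs" "zs \<noteq> []"
    using assms(2) by (cases vs; cases "tl vs"; cases "tl (tl vs)") auto
  have "last vs \<noteq> y" "last vs \<noteq> x" using assms(1) vs by auto
  then have "{x, last vs} \<noteq> {x, y}" by auto
  moreover have "{x, last vs} \<notin> set (path_edges (y # zs))" using path_edges_subset[of "{x, last vs}" "y # zs"] assms(1) vs by auto
  ultimately show ?thesis using vs by simp
qed

lemma path_step_join1:
  assumes "distinct (p # x # ws)"
  shows "join1 {p, x} {{p, x}} (set (x # ws)) (set (path_edges (x # ws))) x"
  using assms path_edges_subset unfolding join1_def by fastforce

text \<open>Deleting an inner vertex of a path adds at most one component, and deleting an end adds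
  none. The induction splits off the first edge. On a one-vertex path both end terms refer to the
  same vertex, and the bound is still exact.\<close>

lemma path_bound:
  assumes "distinct vs" "vs \<noteq> []" "Y \<subseteq> set vs"
  shows "ncomps (set vs - Y) (set (path_edges vs)) + of_bool (hd vs \<in> Y) + of_bool (last vs \<in> Y) \<le> 1 + card Y"
  using assms
proof (induction vs arbitrary: Y rule: induct_list012)
  case (2 v)
  then have "Y = {} \<or> Y = {v}" by auto
  then show ?case by auto
next
  case (3 p x ws)
  let ?vs = "x # ws" and ?Y = "Y \<inter> set (x # ws)"
  note j = path_step_join1[OF 3(3)]
  have eq: "{p, x} \<union> set ?vs = set (p # ?vs)" "{{p, x}} \<union> set (path_edges ?vs) = set (path_edges (p # ?vs))" by auto
  have Y: "Y = (Y \<inter> {p, x}) \<union> ?Y" using 3(5) by auto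
  have IH: "ncomps (set ?vs - ?Y) (set (path_edges ?vs)) + of_bool (x \<in> ?Y) + of_bool (last ?vs \<in> ?Y) \<le> 1 + card ?Y"
    using 3(2)[of ?Y] 3(3) by auto
  have l: "last ?vs \<in> ?Y \<longleftrightarrow> last ?vs \<in> Y" using last_in_set[of ?vs] by blast
  have px: "p \<noteq> x" "p \<notin> set ?vs" using 3(3) by auto
  have cY: "card Y = card ?Y + of_bool (p \<in> Y)"
  proof (cases "p \<in> Y")
    case True
    then have "Y = insert p ?Y" "p \<notin> ?Y" using 3(5) px by auto
    then have "card Y = Suc (card ?Y)" by (metis card_insert_disjoint finite_Int List.finite_set)
    then show ?thesis using True by simp
  next
    case False
    then have "Y = ?Y" using 3(5) by auto
    then show ?thesis using False by simp
  qed
  show ?case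
  proof (cases "x \<in> Y")
    case True
    have "ncomps ({p, x} - Y \<inter> {p, x}) {{p, x}} = of_bool (p \<notin> Y)"
    proof (cases "p \<in> Y")
      case False
      then have "{p, x} - Y \<inter> {p, x} = {p}" using px \<open>x \<in> Y\<close> by auto
      then show ?thesis using False by simp
    qed (use True in \<open>auto simp: Int_absorb1\<close>)
    moreover have m: "x \<in> Y \<inter> {p, x}" "x \<in> ?Y" using True by auto
    note join1_in(1)[OF j Int_lower2 Int_lower2 m, unfolded eq, folded Y]
    ultimately have "ncomps (set (p # ?vs) - Y) (set (path_edges (p # ?vs))) = of_bool (p \<notin> Y) + ncomps (set ?vs - ?Y) (set (path_edges ?vs))"
      by (simp only:)
    then show ?thesis using IH cY l True by (auto simp: of_bool_def split: if_splits)
  next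
    case False
    have "ncomps ({p, x} - Y \<inter> {p, x}) {{p, x}} = 1"
    proof (cases "p \<in> Y")
      case True
      then have "{p, x} - Y \<inter> {p, x} = {x}" using px False by auto
      then show ?thesis by simp
    next
      case False
      then have e: "{p, x} - Y \<inter> {p, x} = {p, x}" using \<open>x \<notin> Y\<close> by auto
      have "linked {p, x} {{p, x}} p x" by (rule linked_edge) auto
      then have "ncomps {p, x} {{p, x}} \<le> 1" by (subst ncomps_le1_iff) (auto intro: linked_sym)
      moreover have "ncomps {p, x} {{p, x}} \<ge> 1" by (rule ncomps_ge1) auto
      ultimately show ?thesis unfolding e by simp
    qed
    moreover have m: "x \<notin> Y \<inter> {p, x}" "x \<notin> ?Y" using False by auto
    note join1_out(1)[OF j Int_lower2 Int_lower2 m, unfolded eq, folded Y]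
    ultimately have "ncomps (set (p # ?vs) - Y) (set (path_edges (p # ?vs))) = ncomps (set ?vs - ?Y) (set (path_edges ?vs))"
      by linarith
    then show ?thesis using IH cY l False by (auto simp: of_bool_def split: if_splits)
  qed
qed simp

lemma path_connected:
  assumes "distinct vs" "vs \<noteq> []"
  shows "ncomps (set vs) (set (path_edges vs)) = 1"
  using path_bound[OF assms, of "{}"] ncomps_ge1[of "set vs" "set (path_edges vs)"] assms(2) by simp

lemma path_sep_bound:
  assumes "distinct vs" "vs \<noteq> []"
  shows "sep_bound (set vs) (set (path_edges vs)) (hd vs) (last vs)"
  unfolding sep_bound_def
proof (intro allI impI)
  fix Y assume Y: "Y \<subseteq> set vs" "\<not> linked (set vs - Y) (set (path_edges vs)) (hd vs) (last vs)"
  have "Y \<noteq> {}"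
    using Y(2) ncomps_one_linked[OF _ path_connected[OF assms], of "hd vs" "last vs"] assms(2) by auto
  then have "card Y \<ge> 1" using finite_subset[OF Y(1)] by (simp add: Suc_le_eq card_gt_0_iff)
  then show "ncomps (set vs - Y) (set (path_edges vs)) \<le> 2 * card Y" using path_bound[OF assms Y(1)] by simp
qed

text \<open>With just the two ends deleted, which are free of charge, some inner vertex remains and
  forms a component.\<close>

lemma path_wide:
  assumes "distinct vs" "length vs \<ge> 3"
  shows "wide 1 (set vs) (set (path_edges vs)) (hd vs) (last vs)"
proof -
  have ne: "vs \<noteq> []" using assms by auto
  have "card {hd vs, last vs} \<le> 2" by (simp add: card_insert_if)
  moreover have "set vs - {hd vs, last vs} \<noteq> {}"
  proof
    assume "set vs - {hd vs, last vs} = {}"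
    then have "card (set vs) \<le> card {hd vs, last vs}" by (intro card_mono) auto
    then show False using calculation assms distinct_card by fastforce
  qed
  then have "ncomps (set vs - {hd vs, last vs}) (set (path_edges vs)) \<ge> 1" by (intro ncomps_ge1) auto
  ultimately show ?thesis unfolding wide_def using ne by (intro exI[of _ "{hd vs, last vs}"]) auto
qed

context crit_graph begin

text \<open>The first edge of the path is critical by a set that contains neither of its ends.\<close>

lemma path_tight:
  assumes pc: "piece (set vs) (set (path_edges vs)) (hd vs) (last vs) VA FA" and d: "distinct vs"
    and c: "sep_bound VA FA (hd vs) (last vs)" and l: "linked VA FA (hd vs) (last vs)"
  shows "tight VA FA (hd vs) (last vs) \<and> length vs \<ge> 3"
proof -
  note P = pieceD[OF pc]
  let ?p = "hd vs" and ?q = "last vs"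
  obtain x ws where vs: "vs = ?p # x # ws"
    using P(6,7) by (cases vs; cases "tl vs") auto
  let ?us = "x # ws" and ?f = "{?p, x}"
  have pus: "?p \<notin> set ?us" "distinct ?us" using d vs by (metis distinct.simps(2))+
  have q: "?q = last ?us" "?q \<in> set ?us" using vs by (metis last_ConsR list.distinct(1), metis last_ConsR last_in_set list.distinct(1))
  have sv: "set vs = insert ?p (set ?us)" "set (path_edges vs) = insert ?f (set (path_edges ?us))"
    using vs by (metis list.simps(15), metis path_edges_simps(3) list.simps(15))
  have fF: "?f \<in> F" "?f \<notin> FA" "?f \<notin> set (path_edges ?us)"
    using sv P(3,4) path_edges_subset[of ?f ?us] pus by auto
  have V: "V = VA \<union> set ?us" "F - {?f} = FA \<union> set (path_edges ?us)" using P(2,3,9) sv fF by auto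
  have "VA \<inter> set ?us \<subseteq> {?p, ?q}" using P(11) sv(1) by blast
  then have int: "VA \<inter> set ?us = {?q}" using P(10) pus(1) q(2) by blast
  \<comment> \<open>Without its first edge, the path is attached to the environment at its last
    vertex alone.\<close>
  have j: "join1 VA FA (set ?us) (set (path_edges ?us)) ?q"
    unfolding join1_def using P(13) piece_edges(2)[OF pc] int path_edges_subset[of _ ?us]
    by (intro conjI ballI) simp_all
  obtain S where S: "S \<subseteq> V" "2 * card S + 1 \<le> ncomps (V - S) (F - {?f})" "2 \<le> ncomps (V - S) (F - {?f})"
    using crit[OF fF(1)] by blast
  \<comment> \<open>A set that meets the deleted edge sees no difference, so its excess would
    violate the toughness of the graph itself.\<close>
  have out: "?p \<notin> S" "x \<notin> S"
  proof -
    have "\<not> ?f \<inter> S \<noteq> {}"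
    proof
      assume n: "?f \<inter> S \<noteq> {}"
      then have "ncomps (V - S) (F - {?f}) = ncomps (V - S) F" by (intro ncomps_cong) auto
      then show False using tough[OF S(1)] S(2) n by auto
    qed
    then show "?p \<notin> S" "x \<notin> S" by auto
  qed
  let ?Y = "S \<inter> VA" and ?Z = "S \<inter> set ?us"
  have S': "S = ?Y \<union> ?Z" using S(1) V(1) by blast
  have h: "(hd ?us \<in> ?Z) = False" "(last ?us \<in> ?Z) = (?q \<in> S)" using out q by auto
  have b: "ncomps (set ?us - ?Z) (set (path_edges ?us)) + of_bool (?q \<in> S) \<le> 1 + card ?Z"
    using path_bound[OF pus(2) list.distinct(2) Int_lower2[of S]]
    by (simp only: h of_bool_eq add_0_right)
  \<comment> \<open>If the last vertex is deleted, it contributes nothing but cost to the remaining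
    path, so the part of \<open>S\<close> in the environment is tight. If it is kept, that part
    alone contradicts toughness.\<close>
  show ?thesis
  proof (cases "?q \<in> S")
    case True
    have qq: "?q \<in> ?Y" "?q \<in> ?Z" using True int by auto
    note g = join1_in[OF j _ _ qq, folded S' V]
    have "card ?Z \<ge> 1" using qq(2) card_gt_0_iff[of ?Z] by fastforce
    then have "2 * card ?Y \<le> ncomps (VA - ?Y) FA" using g b S(2) True by simp
    then have "tight VA FA ?p ?q" unfolding tight_def using out(1) True qq(1)
      by (intro exI[of _ ?Y]) simp
    moreover have "ws \<noteq> []"
    proof
      assume "ws = []"
      then show False using True out(2) q(1) by simp
    qed
    then have "length vs \<ge> 3" using arg_cong[OF vs, of length] by (cases ws) simp_all
    ultimately show ?thesis by blast
  next
    case False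
    have qq: "?q \<notin> ?Y" "?q \<notin> ?Z" using False by auto
    note g = join1_out[OF j _ _ qq, folded S' V]
    have big: "2 * card ?Y + card ?Z + 1 \<le> ncomps (VA - ?Y) FA" using g b S(2) False by simp
    \<comment> \<open>Since the environment still connects the terminals, the whole path can be put
      back without losing a component.\<close>
    have "linked (VA - ?Y) FA ?p ?q"
    proof (rule ccontr)
      assume "\<not> linked (VA - ?Y) FA ?p ?q"
      then have "ncomps (VA - ?Y) FA \<le> 2 * card ?Y" using c out False unfolding sep_bound_def by simp
      then show False using big by simp
    qed
    then have e: "ncomps (V - ?Y) F = ncomps (VA - ?Y) FA"
      using join2_out(1)[OF P(1), of "{}" ?Y, folded P(2,3)] piece_linked[OF pc] P(5) out False by simp
    show ?thesis
    \<comment> \<open>For an empty \<open>?Y\<close> toughness says nothing; there the requirement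
      of at least two components in \<open>crit\<close> is contradicted.\<close>
    proof (cases "?Y = {}")
      case True
      have "ncomps (VA - ?Y) FA = 1" using e conn unfolding True by simp
      then have "card ?Z = 0" using big by simp
      then have "ncomps (V - S) (F - {?f}) \<le> 1" using g(1) b \<open>ncomps (VA - ?Y) FA = 1\<close> by simp
      then show ?thesis using S(3) by simp
    next
      case False
      have "ncomps (V - ?Y) F \<le> 2 * card ?Y" using S(1) False by (intro tough) auto
      then show ?thesis using e big by simp
    qed
  qed
qed

end

section \<open>Binary series and parallel joins\<close>

abbreviation "tverts H \<equiv> verts (grph H)"
abbreviation "tedges H \<equiv> edges (grph H)"
abbreviation "tedge_set H \<equiv> set_mset (edges (grph H))"

lemma mgraph_eqI: "verts G = verts G' \<Longrightarrow> edges G = edges G' \<Longrightarrow> (G :: 'a mgraph) = G'"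
  by simp

lemma all_pairs_two: "(\<forall>i j. i < j \<and> j < length [P, Q] \<longrightarrow> X i j) \<longleftrightarrow> X 0 (Suc 0)"
  by (auto simp: less_Suc_eq)

lemma all_below_two: "(\<forall>i. Suc i < length [P, Q] \<longrightarrow> X i) \<longleftrightarrow> X 0"
  by simp

lemma glue_pair: "G = glue (map grph [P, Q]) \<longleftrightarrow> verts G = tverts P \<union> tverts Q \<and> edges G = tedges P + tedges Q"
  by (cases G) (simp add: glue_def)

lemma series_join_pair:
  "is_series_join [P, Q] H \<longleftrightarrow> snk P = src Q \<and> tverts P \<inter> tverts Q = {snk P} \<and> tverts H = tverts P \<union> tverts Q
     \<and> tedges H = tedges P + tedges Q \<and> src H = src P \<and> snk H = snk Q"
  unfolding is_series_join_def all_pairs_two all_below_two glue_pair by simp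

lemma parallel_join_pair:
  "is_parallel_join [P, Q] H \<longleftrightarrow> src P = src H \<and> src Q = src H \<and> snk P = snk H \<and> snk Q = snk H
     \<and> tverts P \<inter> tverts Q = {src H, snk H} \<and> tverts H = tverts P \<union> tverts Q \<and> tedges H = tedges P + tedges Q"
  unfolding is_parallel_join_def all_pairs_two glue_pair by simp blast

inductive bin_sp :: "'a tgraph \<Rightarrow> bool" where
  edge: "is_single_edge H \<Longrightarrow> bin_sp H"
| series: "bin_sp P \<Longrightarrow> bin_sp Q \<Longrightarrow> is_series_join [P, Q] H \<Longrightarrow> bin_sp H"
| parallel: "bin_sp P \<Longrightarrow> bin_sp Q \<Longrightarrow> is_parallel_join [P, Q] H \<Longrightarrow> bin_sp H"

text \<open>Bracketing to the right: the first piece is disjoint from all later ones except its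
  neighbour, so it meets their union in its sink only.\<close>

lemma series_join_Cons:
  assumes "is_series_join (P # Ps) H" "length Ps \<ge> 2"
  obtains H' where "is_series_join Ps H'" "is_series_join [P, H'] H"
proof
  note D = assms(1)[unfolded is_series_join_def]
  let ?H = "\<lparr>grph = glue (map grph Ps), src = src (hd Ps), snk = snk (last Ps)\<rparr>"
  have nx: "snk ((P # Ps) ! i) = src ((P # Ps) ! Suc i)" if "Suc i < length (P # Ps)" for i
    by (rule D[THEN conjunct2, THEN conjunct1, rule_format, OF that])
  have ov: "tverts ((P # Ps) ! i) \<inter> tverts ((P # Ps) ! j) = (if j = Suc i then {snk ((P # Ps) ! i)} else {})"
    if "i < j" "j < length (P # Ps)" for i j
    by (rule D[THEN conjunct2, THEN conjunct2, THEN conjunct1, rule_format, OF conjI, OF that])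
  have H: "grph H = glue (map grph (P # Ps))" "src H = src P" "snk H = snk (last (P # Ps))"
    using D by simp_all
  have ne: "Ps \<noteq> []" using assms(2) by auto
  show "is_series_join Ps ?H" unfolding is_series_join_def
  proof (intro conjI allI impI)
    fix i assume "Suc i < length Ps"
    then show "snk (Ps ! i) = src (Ps ! Suc i)" using nx[of "Suc i"] by simp
  next
    fix i j assume "i < j \<and> j < length Ps"
    then show "tverts (Ps ! i) \<inter> tverts (Ps ! j) = (if j = Suc i then {snk (Ps ! i)} else {})"
      using ov[of "Suc i" "Suc j"] by simp
  qed (use assms in auto)
  have hd: "hd Ps = Ps ! 0" using ne by (simp add: hd_conv_nth)
  have "tverts P \<inter> tverts Q \<subseteq> {snk P}" if "Q \<in> set Ps" for Q
  proof -
    from that obtain j where "j < length Ps" "Q = Ps ! j" by (metis in_set_conv_nth)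
    then have "tverts P \<inter> tverts Q = (if j = 0 then {snk P} else {})" using ov[of 0 "Suc j"] by simp
    then show ?thesis by (cases "j = 0") simp_all
  qed
  moreover have "tverts P \<inter> tverts (hd Ps) = {snk P}" using ov[of 0 1] ne hd by simp
  then have "snk P \<in> tverts P" "snk P \<in> tverts (hd Ps)" by blast+
  ultimately have "tverts P \<inter> (\<Union>Q\<in>set Ps. tverts Q) = {snk P}" using hd_in_set[OF ne] by blast
  then show "is_series_join [P, ?H] H"
    unfolding series_join_pair using H nx[of 0] ne hd by (simp add: glue_def)
qed

text \<open>Reduces series joins of lists to binary ones, for \<open>bin_sp\<close> in one direction
  of the theorem and for \<open>link\<close> in the other.\<close>

lemma series_closed:
  assumes "is_series_join Ps H" "\<And>P. P \<in> set Ps \<Longrightarrow> X P"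
    and cl: "\<And>P Q H. X P \<Longrightarrow> X Q \<Longrightarrow> is_series_join [P, Q] H \<Longrightarrow> X H"
  shows "X H"
  using assms(1,2)
proof (induction Ps arbitrary: H)
  case Nil then show ?case by (simp add: is_series_join_def)
next
  case (Cons P Ps)
  show ?case
  proof (cases "length Ps \<ge> 2")
    case True
    then obtain H' where H': "is_series_join Ps H'" "is_series_join [P, H'] H"
      using series_join_Cons[OF Cons.prems(1)] by blast
    have "X H'" using Cons.IH[OF H'(1)] Cons.prems(2) by simp
    then show ?thesis using cl[OF _ _ H'(2)] Cons.prems(2) by simp
  next
    case False
    moreover have "length (P # Ps) \<ge> 2" using Cons.prems(1) unfolding is_series_join_def by blast
    ultimately obtain Q where "Ps = [Q]" by (cases Ps; cases "tl Ps") auto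
    then show ?thesis using cl[of P Q H] Cons.prems by simp
  qed
qed

lemma parallel_join_Cons:
  assumes "is_parallel_join (P # Ps) H" "length Ps \<ge> 2"
  obtains H' where "is_parallel_join Ps H'" "is_parallel_join [P, H'] H"
proof
  note D = assms(1)[unfolded is_parallel_join_def]
  let ?H = "\<lparr>grph = glue (map grph Ps), src = src H, snk = snk H\<rparr>"
  have st: "src Q = src H" "snk Q = snk H" if "Q \<in> set (P # Ps)" for Q
    using bspec[OF D[THEN conjunct2, THEN conjunct1] that] by simp_all
  have ov: "tverts ((P # Ps) ! i) \<inter> tverts ((P # Ps) ! j) = {src H, snk H}"
    if "i < j" "j < length (P # Ps)" for i j
    by (rule D[THEN conjunct2, THEN conjunct2, THEN conjunct1, rule_format, OF conjI, OF that])
  have H: "grph H = glue (map grph (P # Ps))"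
    using D by simp
  have ne: "Ps \<noteq> []" using assms(2) by auto
  show "is_parallel_join Ps ?H" unfolding is_parallel_join_def
  proof (intro conjI allI impI ballI)
    fix i j assume "i < j \<and> j < length Ps"
    then show "tverts (Ps ! i) \<inter> tverts (Ps ! j) = {src ?H, snk ?H}"
      using ov[of "Suc i" "Suc j"] by simp
  qed (use assms st in auto)
  have "tverts P \<inter> tverts Q = {src H, snk H}" if "Q \<in> set Ps" for Q
  proof -
    from that obtain j where "j < length Ps" "Q = Ps ! j" by (metis in_set_conv_nth)
    then show ?thesis using ov[of 0 "Suc j"] by simp
  qed
  then have "(\<Union>Q\<in>set Ps. tverts P \<inter> tverts Q) = {src H, snk H}" using ne by simp
  then have "tverts P \<inter> (\<Union>Q\<in>set Ps. tverts Q) = {src H, snk H}" by (simp only: Int_UN_distrib)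
  then show "is_parallel_join [P, ?H] H"
    unfolding parallel_join_pair using H st by (simp add: glue_def)
qed

lemma parallel_closed:
  assumes "is_parallel_join Ps H" "\<And>P. P \<in> set Ps \<Longrightarrow> X P"
    and cl: "\<And>P Q H. X P \<Longrightarrow> X Q \<Longrightarrow> is_parallel_join [P, Q] H \<Longrightarrow> X H"
  shows "X H"
  using assms(1,2)
proof (induction Ps arbitrary: H)
  case Nil then show ?case by (simp add: is_parallel_join_def)
next
  case (Cons P Ps)
  show ?case
  proof (cases "length Ps \<ge> 2")
    case True
    then obtain H' where H': "is_parallel_join Ps H'" "is_parallel_join [P, H'] H"
      using parallel_join_Cons[OF Cons.prems(1)] by blast
    have "X H'" using Cons.IH[OF H'(1)] Cons.prems(2) by simp
    then show ?thesis using cl[OF _ _ H'(2)] Cons.prems(2) by simp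
  next
    case False
    moreover have "length (P # Ps) \<ge> 2" using Cons.prems(1) unfolding is_parallel_join_def by blast
    ultimately obtain Q where "Ps = [Q]" by (cases Ps; cases "tl Ps") auto
    then show ?thesis using cl[of P Q H] Cons.prems by simp
  qed
qed

lemma sp_tgraph_bin_sp: "sp_tgraph H \<Longrightarrow> bin_sp H"
proof (induction rule: sp_tgraph.induct)
  case (series Ps H)
  show ?case by (rule series_closed[OF \<open>is_series_join Ps H\<close> series.IH bin_sp.series])
next
  case (parallel Ps H)
  show ?case by (rule parallel_closed[OF \<open>is_parallel_join Ps H\<close> parallel.IH bin_sp.parallel])
qed (rule bin_sp.edge)

text \<open>The invariant through which the gluing rules are applied. Unlike \<open>bin_sp\<close>,
  it is also established directly for paths and pearls.\<close>

definition proper :: "'a tgraph \<Rightarrow> bool" where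
  "proper H \<longleftrightarrow> finite (tverts H) \<and> (\<forall>e\<in>tedge_set H. e \<subseteq> tverts H \<and> card e = 2) \<and> src H \<in> tverts H \<and> snk H \<in> tverts H
     \<and> src H \<noteq> snk H \<and> ncomps (tverts H) (tedge_set H) = 1"

lemma properD:
  assumes "proper H"
  shows "finite (tverts H)" "src H \<in> tverts H" "snk H \<in> tverts H" "src H \<noteq> snk H" "ncomps (tverts H) (tedge_set H) = 1"
    "\<forall>e\<in>tedge_set H. e \<subseteq> tverts H" "\<forall>e\<in>tedge_set H. card e = 2"
  using assms unfolding proper_def by blast+

lemma proper_linked: "proper H \<Longrightarrow> x \<in> tverts H \<Longrightarrow> y \<in> tverts H \<Longrightarrow> linked (tverts H) (tedge_set H) x y"
  using ncomps_one_linked properD(1,5) by metis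

lemma series_join1:
  assumes "is_series_join [P, Q] H" "proper P" "proper Q"
  shows "join1 (tverts P) (tedge_set P) (tverts Q) (tedge_set Q) (snk P)"
  using assms(1) properD[OF assms(2)] properD[OF assms(3)]
  unfolding series_join_pair join1_def by blast

lemma parallel_join2:
  assumes "is_parallel_join [P, Q] H" "proper P" "proper Q"
  shows "join2 (tverts P) (tedge_set P) (tverts Q) (tedge_set Q) (src H) (snk H)"
  using assms(1) properD[OF assms(2)] properD[OF assms(3)]
  unfolding parallel_join_pair join2_def by metis

lemma series_proper:
  assumes "is_series_join [P, Q] H" "proper P" "proper Q"
  shows "proper H"
proof -
  note J = assms(1)[unfolded series_join_pair]
  note P = properD[OF assms(2)] and Q = properD[OF assms(3)]
  have F: "tedge_set H = tedge_set P \<union> tedge_set Q" using J by simp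
  have "ncomps (tverts H) (tedge_set H) = 1" unfolding F using join1_ncomps[OF series_join1[OF assms]] P(5) Q(5) J by simp
  moreover have "src H \<noteq> snk H"
  proof
    assume "src H = snk H"
    then have "src P = snk Q" using J by simp
    then have "src P \<in> tverts P \<inter> tverts Q" using P(2) Q(3) by simp
    then show False using J P(4) by simp
  qed
  moreover have "\<forall>e\<in>tedge_set H. e \<subseteq> tverts H \<and> card e = 2" unfolding F using P(6,7) Q(6,7) J by blast
  ultimately show ?thesis unfolding proper_def using P(1,2) Q(1,3) J by simp
qed

lemma parallel_proper:
  assumes "is_parallel_join [P, Q] H" "proper P" "proper Q"
  shows "proper H"
proof -
  note J = assms(1)[unfolded parallel_join_pair]
  note P = properD[OF assms(2)] and Q = properD[OF assms(3)]
  have F: "tedge_set H = tedge_set P \<union> tedge_set Q" using J by simp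
  have "linked (tverts P) (tedge_set P) (src H) (snk H)" "linked (tverts Q) (tedge_set Q) (src H) (snk H)"
    using proper_linked[OF assms(2) P(2,3)] proper_linked[OF assms(3) Q(2,3)] J by simp_all
  then have "ncomps (tverts H) (tedge_set H) = 1"
    unfolding F using join2_ncomps[OF parallel_join2[OF assms]] P(5) Q(5) J by simp
  moreover have "\<forall>e\<in>tedge_set H. e \<subseteq> tverts H \<and> card e = 2" unfolding F using P(6,7) Q(6,7) J by blast
  ultimately show ?thesis unfolding proper_def using P(1,2,3,4) Q(1) J by simp
qed

lemma ncomps_edge: "p \<noteq> q \<Longrightarrow> ncomps {p, q} {{p, q}} = 1"
  using path_connected[of "[p, q]"] by simp

lemma single_edge_proper: "is_single_edge H \<Longrightarrow> proper H"
  unfolding is_single_edge_def proper_def by (auto simp: ncomps_edge)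

lemma bin_sp_proper: "bin_sp H \<Longrightarrow> proper H"
  by (induction rule: bin_sp.induct) (auto intro: single_edge_proper series_proper parallel_proper)

section \<open>Paths, pearls and chains of pieces\<close>

definition path_list :: "'a list \<Rightarrow> 'a tgraph \<Rightarrow> bool" where
  "path_list vs H \<longleftrightarrow> distinct vs \<and> length vs \<ge> 2 \<and> tverts H = set vs \<and> tedges H = mset (path_edges vs)
     \<and> src H = hd vs \<and> snk H = last vs"

lemma is_path_iff: "is_path n H \<and> n \<ge> 1 \<longleftrightarrow> (\<exists>vs. path_list vs H \<and> length vs = n + 1)"
  unfolding is_path_def path_list_def path_edges_def by (auto intro!: mgraph_eqI)

lemma path_list_proper:
  assumes "path_list vs H"
  shows "proper H"
proof -
  have d: "distinct vs" "vs \<noteq> []" and *: "tverts H = set vs" "tedge_set H = set (path_edges vs)" "src H = hd vs" "snk H = last vs"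
    using assms by (auto simp: path_list_def)
  have "hd vs \<noteq> last vs"
    using assms unfolding path_list_def by (cases vs; cases "tl vs") auto
  then show ?thesis unfolding proper_def * using path_connected[OF d] d path_edges_subset path_edges_card[OF d(1)] by auto
qed

lemma pearl_iff:
  "is_pearl H \<longleftrightarrow> (\<exists>P Q vs ws. path_list vs P \<and> path_list ws Q \<and> length vs \<ge> 3 \<and> length ws \<ge> 3
     \<and> is_parallel_join [P, Q] H)"
proof
  assume "is_pearl H"
  then obtain P Q m n where *: "is_path m P" "is_path n Q" "m \<ge> 2" "n \<ge> 2" "is_parallel_join [P, Q] H"
    unfolding is_pearl_def by blast
  then show "\<exists>P Q vs ws. path_list vs P \<and> path_list ws Q \<and> length vs \<ge> 3 \<and> length ws \<ge> 3
     \<and> is_parallel_join [P, Q] H"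
    using is_path_iff[of m P] is_path_iff[of n Q] by force
next
  assume "\<exists>P Q vs ws. path_list vs P \<and> path_list ws Q \<and> length vs \<ge> 3 \<and> length ws \<ge> 3
     \<and> is_parallel_join [P, Q] H"
  then obtain P Q vs ws where *: "path_list vs P" "path_list ws Q" "length vs \<ge> 3" "length ws \<ge> 3"
    "is_parallel_join [P, Q] H" by blast
  have "is_path (length vs - 1) P" "is_path (length ws - 1) Q"
    using is_path_iff[of "length vs - 1" P] is_path_iff[of "length ws - 1" Q] *(1-4) by force+
  moreover have "length vs - 1 \<ge> 2" "length ws - 1 \<ge> 2" using *(3,4) by auto
  ultimately show "is_pearl H" unfolding is_pearl_def using *(5) by blast
qed

lemma pearl_proper: "is_pearl H \<Longrightarrow> proper H"
  unfolding pearl_iff using parallel_proper path_list_proper by blast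

text \<open>A series join in which a single piece is allowed, so that a pearl or an edge is itself a
  chain and chains can be appended.\<close>

definition chain :: "'a tgraph list \<Rightarrow> 'a tgraph \<Rightarrow> bool" where
  "chain Ps H \<longleftrightarrow> Ps \<noteq> [] \<and>
     (\<forall>i. Suc i < length Ps \<longrightarrow> snk (Ps ! i) = src (Ps ! Suc i)) \<and>
     (\<forall>i j. i < j \<and> j < length Ps \<longrightarrow>
        tverts (Ps ! i) \<inter> tverts (Ps ! j) = (if j = Suc i then {snk (Ps ! i)} else {})) \<and>
     grph H = glue (map grph Ps) \<and> src H = src (hd Ps) \<and> snk H = snk (last Ps)"

lemma chain_series: "chain Ps H \<Longrightarrow> length Ps \<ge> 2 \<Longrightarrow> is_series_join Ps H"
  unfolding chain_def is_series_join_def by blast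

lemma chain_single: "chain [H] H"
  unfolding chain_def by (auto simp: glue_def)

text \<open>Across the border only the common vertex of \<open>P\<close> and \<open>Q\<close> can be
  shared. It lies in no piece but the last of \<open>Ps\<close> and the first of \<open>Qs\<close>,
  since otherwise one of these two would have equal terminals; this is where \<open>proper\<close>
  enters.\<close>

lemma chain_append:
  assumes c: "chain Ps P" "chain Qs Q" and j: "is_series_join [P, Q] H"
    and pr: "\<And>R. R \<in> set Ps \<union> set Qs \<Longrightarrow> proper R"
  shows "chain (Ps @ Qs) H"
proof -
  note J = j[unfolded series_join_pair]
  have ne: "Ps \<noteq> []" "Qs \<noteq> []" using c by (auto simp: chain_def)
  have P: "\<And>i. Suc i < length Ps \<Longrightarrow> snk (Ps ! i) = src (Ps ! Suc i)"
    "\<And>i j. i < j \<Longrightarrow> j < length Ps \<Longrightarrow> tverts (Ps ! i) \<inter> tverts (Ps ! j) = (if j = Suc i then {snk (Ps ! i)} else {})"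
    "grph P = glue (map grph Ps)" "src P = src (hd Ps)" "snk P = snk (last Ps)"
    using c(1) unfolding chain_def by blast+
  have Q: "\<And>i. Suc i < length Qs \<Longrightarrow> snk (Qs ! i) = src (Qs ! Suc i)"
    "\<And>i j. i < j \<Longrightarrow> j < length Qs \<Longrightarrow> tverts (Qs ! i) \<inter> tverts (Qs ! j) = (if j = Suc i then {snk (Qs ! i)} else {})"
    "grph Q = glue (map grph Qs)" "src Q = src (hd Qs)" "snk Q = snk (last Qs)"
    using c(2) unfolding chain_def by blast+
  let ?c = "snk P"
  have l: "last Ps = Ps ! (length Ps - 1)" "hd Qs = Qs ! 0"
    using ne by (simp_all add: last_conv_nth hd_conv_nth)
  have mem: "Ps ! (length Ps - 1) \<in> set Ps" "Qs ! 0 \<in> set Qs" using ne by auto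
  have inl: "?c \<in> tverts (Ps ! (length Ps - 1))" "?c \<in> tverts (Qs ! 0)"
    using P(5) l J Q(4) properD(3)[OF pr, OF UnI1, OF mem(1)] properD(2)[OF pr, OF UnI2, OF mem(2)] by simp_all
  have PQ: "tverts (Ps ! i) \<inter> tverts (Qs ! j) = (if length Ps + j = Suc i then {snk (Ps ! i)} else {})"
    if ij: "i < length Ps" "j < length Qs" for i j
  proof -
    have "tverts P = (\<Union>R\<in>set Ps. tverts R)" "tverts Q = (\<Union>R\<in>set Qs. tverts R)" by (simp_all add: P(3) Q(3) glue_def)
    then have "tverts (Ps ! i) \<subseteq> tverts P" "tverts (Qs ! j) \<subseteq> tverts Q"
      using UN_upper[OF nth_mem[OF ij(1)], of "\<lambda>R. tverts R"] UN_upper[OF nth_mem[OF ij(2)], of "\<lambda>R. tverts R"] by simp_all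
    then have sub: "tverts (Ps ! i) \<inter> tverts (Qs ! j) \<subseteq> {?c}" using J by blast
    show ?thesis
    proof (cases "length Ps + j = Suc i")
      case True
      then have "i = length Ps - 1" "j = 0" using ij by auto
      moreover have "snk (Ps ! (length Ps - 1)) = ?c" using P(5) l(1) by simp
      ultimately show ?thesis using True sub inl by auto
    next
      case False
      have "\<not> (?c \<in> tverts (Ps ! i) \<and> ?c \<in> tverts (Qs ! j))"
      proof
        assume a: "?c \<in> tverts (Ps ! i) \<and> ?c \<in> tverts (Qs ! j)"
        show False
        proof (cases "i < length Ps - 1")
          case True
          have "length Ps - 1 < length Ps" using ij by linarith
          from P(2)[OF True this] have "?c \<in> (if length Ps - 1 = Suc i then {snk (Ps ! i)} else {})"
            using a inl(1) by (metis IntI)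
          then have "length Ps - 1 = Suc i" "?c = snk (Ps ! i)" by (auto split: if_splits)
          then have "?c = src (last Ps)" using P(1)[of i] l ij by auto
          then show False using P(5) properD(4)[OF pr, of "last Ps"] ne by auto
        next
          case False
          then have "j > 0" using ij \<open>length Ps + j \<noteq> Suc i\<close> by auto
          from Q(2)[OF this ij(2)] have "?c \<in> (if j = Suc 0 then {snk (Qs ! 0)} else {})"
            using a inl(2) by (metis IntI)
          then have "?c = snk (hd Qs)" using l by (auto split: if_splits)
          then show False using J Q(4) properD(4)[OF pr, of "hd Qs"] ne by auto
        qed
      qed
      then show ?thesis using sub False by auto
    qed
  qed
  show ?thesis unfolding chain_def
  proof (intro conjI allI impI)
    fix i assume i: "Suc i < length (Ps @ Qs)"
    consider "Suc i < length Ps" | "Suc i = length Ps" | "i \<ge> length Ps" by linarith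
    then show "snk ((Ps @ Qs) ! i) = src ((Ps @ Qs) ! Suc i)"
    proof cases
      case 2
      then have "i = length Ps - 1" by simp
      then show ?thesis using 2 P(5) l J Q(4) by (simp add: nth_append)
    next
      case 3
      then show ?thesis using i Q(1)[of "i - length Ps"] by (simp add: nth_append Suc_diff_le)
    qed (use P(1) in \<open>simp add: nth_append\<close>)
  next
    fix i j assume ij: "i < j \<and> j < length (Ps @ Qs)"
    consider "j < length Ps" | "i < length Ps" "j \<ge> length Ps" | "i \<ge> length Ps" by linarith
    then show "tverts ((Ps @ Qs) ! i) \<inter> tverts ((Ps @ Qs) ! j) = (if j = Suc i then {snk ((Ps @ Qs) ! i)} else {})"
    proof cases
      case 1 then show ?thesis using ij P(2)[of i j] by (simp add: nth_append)
    next
      case 2 then show ?thesis using ij PQ[of i "j - length Ps"] by (simp add: nth_append)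
    next
      case 3
      then have "i - length Ps < j - length Ps" "j - length Ps < length Qs"
        "j - length Ps = Suc (i - length Ps) \<longleftrightarrow> j = Suc i" using ij by auto
      then show ?thesis using 3 ij Q(2)[of "i - length Ps" "j - length Ps"] by (simp add: nth_append)
    qed
  next
    show "grph H = glue (map grph (Ps @ Qs))"
      using J P(3) Q(3) by (intro mgraph_eqI) (simp_all add: glue_def)
  qed (use J ne P(4) Q(5) in auto)
qed

section \<open>Pieces of a critical graph\<close>

text \<open>Justifies the passage from multisets to sets of edges: in a join without parallel edges,
  the edge sets of the factors are disjoint.\<close>

definition simple :: "'a tgraph \<Rightarrow> bool" where
  "simple H \<longleftrightarrow> (\<forall>e. count (tedges H) e \<le> 1)"

lemma simple_join:
  assumes "tedges H = tedges P + tedges Q" "simple H"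
  shows "simple P" "simple Q" "tedge_set P \<inter> tedge_set Q = {}"
proof -
  have c: "count (tedges P) e + count (tedges Q) e \<le> 1" for e
    using assms by (metis simple_def count_union)
  show "simple P" "simple Q" unfolding simple_def using c by (meson add_leD1 add_leD2)+
  show "tedge_set P \<inter> tedge_set Q = {}"
  proof (rule ccontr)
    assume "tedge_set P \<inter> tedge_set Q \<noteq> {}"
    then obtain e where "e \<in># tedges P" "e \<in># tedges Q" by blast
    then have "count (tedges P) e \<ge> 1" "count (tedges Q) e \<ge> 1" by simp_all
    then show False using c[of e] by linarith
  qed
qed

lemma path_list_join:
  assumes "path_list vs P" "path_list ws Q" "is_series_join [P, Q] H"
  shows "path_list (vs @ tl ws) H"
proof -
  note J = assms(3)[unfolded series_join_pair]
  have P: "distinct vs" "length vs \<ge> 2" "tverts P = set vs" "tedges P = mset (path_edges vs)" "src P = hd vs" "snk P = last vs"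
    using assms(1) by (simp_all add: path_list_def)
  have Q: "distinct ws" "length ws \<ge> 2" "tverts Q = set ws" "tedges Q = mset (path_edges ws)" "src Q = hd ws" "snk Q = last ws"
    using assms(2) by (simp_all add: path_list_def)
  obtain w u us where ws: "ws = w # u # us" using Q(2) by (cases ws; cases "tl ws") auto
  have ne: "vs \<noteq> []" using P(2) by auto
  have w: "w = last vs" "w \<in> set vs" using J P Q ws ne by auto
  have "set vs \<inter> set ws = {w}" using J P Q w by simp
  then have "set vs \<inter> set (tl ws) = {}" using Q(1) ws by auto
  then have "distinct (vs @ tl ws)" using P(1) Q(1) by (simp add: distinct_tl)
  moreover have "tverts H = set (vs @ tl ws)" using J P Q ws w by auto
  moreover have "tedges H = mset (path_edges (vs @ tl ws))"
  proof -
    have "last vs = hd ws" "ws \<noteq> []" using w ws by simp_all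
    then show ?thesis using mset_path_edges_join[OF ne] J P(4) Q(4) by simp
  qed
  moreover have "last (vs @ tl ws) = last ws" "hd (vs @ tl ws) = hd vs" using ws ne by simp_all
  ultimately show ?thesis using P(2,5) Q(6) J unfolding path_list_def by simp
qed

lemma path_head_leaf:
  assumes "distinct vs" "length vs \<ge> 2"
  shows "\<exists>z\<in>set vs. z \<noteq> hd vs \<and> {hd vs, z} \<in> set (path_edges vs) \<and> (\<forall>e\<in>set (path_edges vs). hd vs \<in> e \<longrightarrow> e = {hd vs, z})"
proof -
  obtain p z ws where vs: "vs = p # z # ws" using assms(2) by (cases vs; cases "tl vs") auto
  have "p \<notin> e" if "e \<in> set (path_edges (z # ws))" for e using path_edges_subset[OF that] assms(1) vs by auto
  then show ?thesis using assms(1) vs by auto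
qed

lemma path_last_leaf:
  assumes "distinct vs" "length vs \<ge> 2"
  shows "\<exists>z\<in>set vs. z \<noteq> last vs \<and> {last vs, z} \<in> set (path_edges vs) \<and> (\<forall>e\<in>set (path_edges vs). last vs \<in> e \<longrightarrow> e = {last vs, z})"
  using path_head_leaf[of "rev vs"] assms by (simp add: hd_rev)

context crit_graph begin

lemma series_pieces:
  assumes pc: "piece (tverts H) (tedge_set H) (src H) (snk H) VE FE" and j: "is_series_join [P, Q] H"
    and P: "proper P" and Q: "proper Q" and s: "simple H"
  shows "piece (tverts P) (tedge_set P) (src P) (snk P) (tverts Q \<union> VE) (tedge_set Q \<union> FE)"
    "piece (tverts Q) (tedge_set Q) (src Q) (snk Q) (tverts P \<union> VE) (tedge_set P \<union> FE)"
    "snk P \<notin> VE" "src P \<notin> tverts Q" "snk Q \<notin> tverts P"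
proof -
  note J = j[unfolded series_join_pair]
  have F: "tedge_set H = tedge_set P \<union> tedge_set Q" using J by simp
  note P' = properD[OF P] and Q' = properD[OF Q]
  have d: "tedge_set P \<inter> tedge_set Q = {}" using simple_join(3)[OF _ s] J by blast
  note G = pieceD[OF pc] and GE = piece_edges[OF pc]
  have int: "tverts P \<inter> tverts Q = {snk P}" using J by blast
  have qq: "snk P = src Q" using J by blast
  show *: "src P \<notin> tverts Q" "snk Q \<notin> tverts P"
    using int P'(2,4) Q'(3,4) qq by (metis IntI singletonD)+
  have sub: "(tverts P \<union> tverts Q) \<inter> VE = {src P, snk Q}" using G(11) J by simp
  show q: "snk P \<notin> VE"
  proof
    assume "snk P \<in> VE"
    then have "snk P \<in> {src P, snk Q}" using sub P'(3) by blast
    then show False using P'(4) Q'(4) qq by auto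
  qed
  have sub': "x = src P \<or> x = snk Q" if "x \<in> tverts P \<union> tverts Q" "x \<in> VE" for x
    using IntI[OF that] unfolding sub by blast
  have "src P \<in> VE" "snk Q \<in> VE" using sub by blast+
  moreover have "tverts P \<inter> VE \<subseteq> {src P}" "tverts Q \<inter> VE \<subseteq> {snk Q}" using sub' * by blast+
  ultimately have i: "tverts P \<inter> (tverts Q \<union> VE) = {src P, snk P}" "tverts Q \<inter> (tverts P \<union> VE) = {src Q, snk Q}"
    using int P'(2) Q'(3) qq by auto
  have V: "V = tverts P \<union> (tverts Q \<union> VE)" "V = tverts Q \<union> (tverts P \<union> VE)" "F = tedge_set P \<union> (tedge_set Q \<union> FE)" "F = tedge_set Q \<union> (tedge_set P \<union> FE)"
    using G(2,3) J F by auto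
  have dd: "tedge_set P \<inter> (tedge_set Q \<union> FE) = {}" "tedge_set Q \<inter> (tedge_set P \<union> FE) = {}" using d G(4) F by auto
  have e: "\<forall>e\<in>tedge_set Q \<union> FE. e \<subseteq> tverts Q \<union> VE" "\<forall>e\<in>tedge_set P \<union> FE. e \<subseteq> tverts P \<union> VE" using P'(6) Q'(6) GE by blast+
  show "piece (tverts P) (tedge_set P) (src P) (snk P) (tverts Q \<union> VE) (tedge_set Q \<union> FE)"
    unfolding piece_def join2_def using P'(1,4,5,6) Q'(1) G(13) i(1) V(1,3) dd(1) e(1)
    by (intro conjI) simp_all
  show "piece (tverts Q) (tedge_set Q) (src Q) (snk Q) (tverts P \<union> VE) (tedge_set P \<union> FE)"
    unfolding piece_def join2_def using Q'(1,4,5,6) P'(1) G(13) i(2) V(2,4) dd(2) e(2)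
    by (intro conjI) simp_all
qed

lemma parallel_pieces:
  assumes pc: "piece (tverts H) (tedge_set H) (src H) (snk H) VE FE" and j: "is_parallel_join [P, Q] H"
    and P: "proper P" and Q: "proper Q" and s: "simple H"
  shows "piece (tverts P) (tedge_set P) (src H) (snk H) (tverts Q \<union> VE) (tedge_set Q \<union> FE)"
    "piece (tverts Q) (tedge_set Q) (src H) (snk H) (tverts P \<union> VE) (tedge_set P \<union> FE)"
    "join2 (tverts Q) (tedge_set Q) VE FE (src H) (snk H)" "join2 (tverts P) (tedge_set P) VE FE (src H) (snk H)"
    "piece (tverts P \<union> tverts Q) (tedge_set P \<union> tedge_set Q) (src H) (snk H) VE FE"
    "piece (tverts Q \<union> tverts P) (tedge_set Q \<union> tedge_set P) (src H) (snk H) VE FE"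
proof -
  note J = j[unfolded parallel_join_pair]
  have d: "tedge_set P \<inter> tedge_set Q = {}" "tedge_set Q \<inter> tedge_set P = {}" using simple_join(3)[OF _ s] J by blast+
  note j2 = parallel_join2[OF j P Q]
  show pc1: "piece (tverts P \<union> tverts Q) (tedge_set P \<union> tedge_set Q) (src H) (snk H) VE FE" using pc J by simp
  then show pc2: "piece (tverts Q \<union> tverts P) (tedge_set Q \<union> tedge_set P) (src H) (snk H) VE FE" by (simp only: Un_commute)
  show "piece (tverts P) (tedge_set P) (src H) (snk H) (tverts Q \<union> VE) (tedge_set Q \<union> FE)"
    "join2 (tverts Q) (tedge_set Q) VE FE (src H) (snk H)"
    using par_split[OF pc1 j2 d(1) properD(5)[OF P]] by blast+
  show "piece (tverts Q) (tedge_set Q) (src H) (snk H) (tverts P \<union> VE) (tedge_set P \<union> FE)"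
    "join2 (tverts P) (tedge_set P) VE FE (src H) (snk H)"
    using par_split[OF pc2 join2_commute[OF j2] d(2) properD(5)[OF Q]] by blast+
qed

lemma path_arm:
  assumes pc: "piece (set vs) (set (path_edges vs)) (hd vs) (last vs) VA FA" and d: "distinct vs"
    and c: "sep_bound VA FA (hd vs) (last vs)" and l: "linked VA FA (hd vs) (last vs)"
  shows "arm 1 (set vs) (set (path_edges vs)) (hd vs) (last vs) VA FA \<and> length vs \<ge> 3"
proof -
  have ne: "vs \<noteq> []" using pieceD(7)[OF pc] by auto
  have 1: "tight VA FA (hd vs) (last vs)" "length vs \<ge> 3" using path_tight[OF pc d c l] by auto
  \<comment> \<open>Tightness at the other terminal comes from the last edge, that is, from the
    first edge of the reversed path.\<close>
  have "tight VA FA (hd (rev vs)) (last (rev vs))"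
  proof -
    have "piece (set (rev vs)) (set (path_edges (rev vs))) (hd (rev vs)) (last (rev vs)) VA FA"
      using piece_swap[OF pc] by (simp add: hd_rev last_rev)
    moreover have "sep_bound VA FA (hd (rev vs)) (last (rev vs))"
      using sep_bound_swap[OF c] by (simp add: hd_rev last_rev)
    moreover have "linked VA FA (hd (rev vs)) (last (rev vs))"
      using linked_sym[OF l] by (simp add: hd_rev last_rev)
    ultimately show ?thesis using path_tight[of "rev vs" VA FA] d by simp
  qed
  then have "tight VA FA (last vs) (hd vs)" by (simp add: hd_rev last_rev)
  then show ?thesis using 1 path_sep_bound[OF d ne] path_wide[OF d 1(2)] by (simp add: arm_def)
qed

lemma path_or_arm_sep_bound:
  "path_list vs P \<or> arm k (tverts P) (tedge_set P) (src P) (snk P) VA FA \<Longrightarrow> sep_bound (tverts P) (tedge_set P) (src P) (snk P)"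
  using path_sep_bound[of vs] unfolding path_list_def arm_def by fastforce

text \<open>For either branch, the other one connects the terminals, so the lemma serves connected
  as well as disconnected \<open>VE\<close>. A path branch asks of its partner only the separation
  bound, which paths and arms both have; hence the two branches do not depend on each other in a
  circle.\<close>

lemma parallel_arms:
  assumes pc: "piece (tverts H) (tedge_set H) (src H) (snk H) VE FE" and j: "is_parallel_join [P, Q] H"
    and P: "proper P" and Q: "proper Q" and s: "simple H"
    and cP: "(\<exists>vs. path_list vs P) \<or> arm 2 (tverts P) (tedge_set P) (src P) (snk P) (tverts Q \<union> VE) (tedge_set Q \<union> FE)"
    and cQ: "(\<exists>vs. path_list vs Q) \<or> arm 2 (tverts Q) (tedge_set Q) (src Q) (snk Q) (tverts P \<union> VE) (tedge_set P \<union> FE)"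
  obtains k l where "arm (k + l) (tverts H) (tedge_set H) (src H) (snk H) VE FE"
    "k = 2 \<or> k = 1 \<and> (\<exists>vs. path_list vs P \<and> length vs \<ge> 3)"
    "l = 2 \<or> l = 1 \<and> (\<exists>vs. path_list vs Q \<and> length vs \<ge> 3)"
proof -
  note J = j[unfolded parallel_join_pair]
  note pieces = parallel_pieces[OF pc j P Q s]
  have st: "src P = src H" "snk P = snk H" "src Q = src H" "snk Q = snk H" using J by auto
  have d: "tedge_set P \<inter> tedge_set Q = {}" using simple_join(3)[OF _ s] J by blast
  have sP: "sep_bound (tverts P) (tedge_set P) (src H) (snk H)"
    using cP path_or_arm_sep_bound[of _ P] st by metis
  have sQ: "sep_bound (tverts Q) (tedge_set Q) (src H) (snk H)"
    using cQ path_or_arm_sep_bound[of _ Q] st by metis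
  have "\<exists>k. arm k (tverts P) (tedge_set P) (src H) (snk H) (tverts Q \<union> VE) (tedge_set Q \<union> FE)
      \<and> (k = 2 \<or> k = 1 \<and> (\<exists>vs. path_list vs P \<and> length vs \<ge> 3))"
    using cP
  proof
    assume "\<exists>vs. path_list vs P"
    then obtain vs where vs: "path_list vs P" by blast
    then have v: "distinct vs" "tverts P = set vs" "tedge_set P = set (path_edges vs)" "src H = hd vs" "snk H = last vs"
      using st by (simp_all add: path_list_def)
    have "sep_bound (tverts Q \<union> VE) (tedge_set Q \<union> FE) (src H) (snk H)"
      by (rule env_sep_bound[OF pieces(5,3) sQ])
    moreover have "linked (tverts Q \<union> VE) (tedge_set Q \<union> FE) (src H) (snk H)"
      by (rule linked_mono[OF proper_linked[OF Q properD(2,3)[OF Q], unfolded st]]) auto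
    ultimately have "arm 1 (tverts P) (tedge_set P) (src H) (snk H) (tverts Q \<union> VE) (tedge_set Q \<union> FE) \<and> length vs \<ge> 3"
      using path_arm[of vs "tverts Q \<union> VE" "tedge_set Q \<union> FE"] pieces(1) v(1) unfolding v(2-5) by blast
    then show ?thesis using vs by blast
  qed (use st in auto)
  then obtain k where k: "arm k (tverts P) (tedge_set P) (src H) (snk H) (tverts Q \<union> VE) (tedge_set Q \<union> FE)"
    "k = 2 \<or> k = 1 \<and> (\<exists>vs. path_list vs P \<and> length vs \<ge> 3)" by blast
  have "\<exists>k. arm k (tverts Q) (tedge_set Q) (src H) (snk H) (tverts P \<union> VE) (tedge_set P \<union> FE)
      \<and> (k = 2 \<or> k = 1 \<and> (\<exists>vs. path_list vs Q \<and> length vs \<ge> 3))"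
    using cQ
  proof
    assume "\<exists>vs. path_list vs Q"
    then obtain vs where vs: "path_list vs Q" by blast
    then have v: "distinct vs" "tverts Q = set vs" "tedge_set Q = set (path_edges vs)" "src H = hd vs" "snk H = last vs"
      using st by (simp_all add: path_list_def)
    have "sep_bound (tverts P \<union> VE) (tedge_set P \<union> FE) (src H) (snk H)"
      by (rule env_sep_bound[OF pieces(6,4) sP])
    moreover have "linked (tverts P \<union> VE) (tedge_set P \<union> FE) (src H) (snk H)"
      by (rule linked_mono[OF proper_linked[OF P properD(2,3)[OF P], unfolded st]]) auto
    ultimately have "arm 1 (tverts Q) (tedge_set Q) (src H) (snk H) (tverts P \<union> VE) (tedge_set P \<union> FE) \<and> length vs \<ge> 3"
      using path_arm[of vs "tverts P \<union> VE" "tedge_set P \<union> FE"] pieces(2) v(1) unfolding v(2-5) by blast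
    then show ?thesis using vs by blast
  qed (use st in auto)
  then obtain l where l: "arm l (tverts Q) (tedge_set Q) (src H) (snk H) (tverts P \<union> VE) (tedge_set P \<union> FE)"
    "l = 2 \<or> l = 1 \<and> (\<exists>vs. path_list vs Q \<and> length vs \<ge> 3)" by blast
  have "arm (k + l) (tverts P \<union> tverts Q) (tedge_set P \<union> tedge_set Q) (src H) (snk H) VE FE"
    by (rule par_arm[OF pieces(5) parallel_join2[OF j P Q] d properD(5)[OF Q] k(1) l(1)])
  moreover have "tverts H = tverts P \<union> tverts Q" "tedge_set H = tedge_set P \<union> tedge_set Q" using J by simp_all
  ultimately show thesis using that k(2) l(2) by simp
qed

text \<open>The environment is generalized because each factor receives its sibling as a part of it.
  In a mixed series join, the path ends in a pendant edge at the common vertex, as seen from the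
  arm, and \<open>leaf_not_tight\<close> refutes the tightness claimed by the arm.\<close>

lemma path_or_arm:
  assumes "bin_sp H" "piece (tverts H) (tedge_set H) (src H) (snk H) VE FE" "simple H" "linked VE FE (src H) (snk H)"
  shows "(\<exists>vs. path_list vs H) \<or> arm 2 (tverts H) (tedge_set H) (src H) (snk H) VE FE"
  using assms
proof (induction arbitrary: VE FE rule: bin_sp.induct)
  case (edge H)
  then have "path_list [src H, snk H] H" by (auto simp: path_list_def is_single_edge_def)
  then show ?case by blast
next
  case (series P Q H)
  note J = series.hyps(3)[unfolded series_join_pair]
  have P: "proper P" and Q: "proper Q" using series.hyps bin_sp_proper by auto
  note P' = properD[OF P] and Q' = properD[OF Q]
  note pieces = series_pieces[OF series.prems(1) series.hyps(3) P Q series.prems(2)]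
  have s: "simple P" "simple Q" "tedge_set P \<inter> tedge_set Q = {}" using simple_join[OF _ series.prems(2)] J by blast+
  have F: "tverts H = tverts P \<union> tverts Q" "tedge_set H = tedge_set P \<union> tedge_set Q" using J by simp_all
  have lP: "linked (tverts P) (tedge_set P) (src P) (snk P)" "linked (tverts Q) (tedge_set Q) (src Q) (snk Q)"
    using proper_linked[OF P P'(2,3)] proper_linked[OF Q Q'(2,3)] by simp_all
  have lE: "linked VE FE (src P) (snk Q)" using series.prems(3) J by simp
  have le: "linked (tverts Q \<union> VE) (tedge_set Q \<union> FE) (src P) (snk P)" "linked (tverts P \<union> VE) (tedge_set P \<union> FE) (src Q) (snk Q)"
  proof -
    have "linked (tverts Q \<union> VE) (tedge_set Q \<union> FE) (src P) (snk Q)" by (rule linked_mono[OF lE]) auto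
    moreover have "linked (tverts Q \<union> VE) (tedge_set Q \<union> FE) (snk Q) (src Q)"
      by (rule linked_sym, rule linked_mono[OF lP(2)]) auto
    ultimately have "linked (tverts Q \<union> VE) (tedge_set Q \<union> FE) (src P) (src Q)" by (rule linked_trans)
    then show "linked (tverts Q \<union> VE) (tedge_set Q \<union> FE) (src P) (snk P)" using J by simp
    have "linked (tverts P \<union> VE) (tedge_set P \<union> FE) (src P) (snk Q)" by (rule linked_mono[OF lE]) auto
    moreover have "linked (tverts P \<union> VE) (tedge_set P \<union> FE) (snk P) (src P)"
      by (rule linked_sym, rule linked_mono[OF lP(1)]) auto
    ultimately have "linked (tverts P \<union> VE) (tedge_set P \<union> FE) (snk P) (snk Q)" by (rule linked_trans[rotated])
    then show "linked (tverts P \<union> VE) (tedge_set P \<union> FE) (src Q) (snk Q)" using J by simp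
  qed
  \<comment> \<open>The common vertex is not in the environment, so the end edge of a path factor is
    the only edge at it outside the other factor.\<close>
  have notE: "snk P \<notin> e" if "e \<in> FE" for e
    using piece_edges(2)[OF series.prems(1)] that pieces(3) by blast
  consider vs ws where "path_list vs P" "path_list ws Q"
    | vs where "path_list vs P" "arm 2 (tverts Q) (tedge_set Q) (src Q) (snk Q) (tverts P \<union> VE) (tedge_set P \<union> FE)"
    | ws where "arm 2 (tverts P) (tedge_set P) (src P) (snk P) (tverts Q \<union> VE) (tedge_set Q \<union> FE)" "path_list ws Q"
    | "arm 2 (tverts P) (tedge_set P) (src P) (snk P) (tverts Q \<union> VE) (tedge_set Q \<union> FE)"
      "arm 2 (tverts Q) (tedge_set Q) (src Q) (snk Q) (tverts P \<union> VE) (tedge_set P \<union> FE)"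
    using series.IH(1)[OF pieces(1) s(1) le(1)] series.IH(2)[OF pieces(2) s(2) le(2)] by blast
  then show ?case
  proof cases
    case 1
    then show ?thesis using path_list_join series.hyps(3) by blast
  next
    case 2
    then have v: "distinct vs" "length vs \<ge> 2" "tverts P = set vs" "tedge_set P = set (path_edges vs)" "last vs = src Q"
      using J by (simp_all add: path_list_def)
    obtain z where z: "z \<in> tverts P" "z \<noteq> src Q" "{src Q, z} \<in> tedge_set P" "\<forall>e\<in>tedge_set P. src Q \<in> e \<longrightarrow> e = {src Q, z}"
      using path_last_leaf[OF v(1,2)] unfolding v(3-5) by blast
    have "\<not> tight (tverts P \<union> VE) (tedge_set P \<union> FE) (snk Q) (src Q)"
    proof (rule leaf_not_tight[OF piece_swap[OF pieces(2)] linked_sym[OF le(2)]])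
      show "z \<in> tverts P \<union> VE" "z \<noteq> src Q" "{src Q, z} \<in> tedge_set P \<union> FE" using z(1-3) by auto
      show "e = {src Q, z}" if "e \<in> tedge_set P \<union> FE" "src Q \<in> e" for e using that z(4) notE[of e] J by (metis UnE)
    qed
    then show ?thesis using 2(2) by (simp add: arm_def)
  next
    case 3
    then have v: "distinct ws" "length ws \<ge> 2" "tverts Q = set ws" "tedge_set Q = set (path_edges ws)" "hd ws = snk P"
      using J by (simp_all add: path_list_def)
    obtain z where z: "z \<in> tverts Q" "z \<noteq> snk P" "{snk P, z} \<in> tedge_set Q" "\<forall>e\<in>tedge_set Q. snk P \<in> e \<longrightarrow> e = {snk P, z}"
      using path_head_leaf[OF v(1,2)] unfolding v(3-5) by blast
    have "\<not> tight (tverts Q \<union> VE) (tedge_set Q \<union> FE) (src P) (snk P)"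
    proof (rule leaf_not_tight[OF pieces(1) le(1)])
      show "z \<in> tverts Q \<union> VE" "z \<noteq> snk P" "{snk P, z} \<in> tedge_set Q \<union> FE" using z(1-3) by auto
      show "e = {snk P, z}" if "e \<in> tedge_set Q \<union> FE" "snk P \<in> e" for e using that z(4) notE[of e] by blast
    qed
    then show ?thesis using 3(1) by (simp add: arm_def)
  next
    case 4
    have "arm 2 (tverts P \<union> tverts Q) (tedge_set P \<union> tedge_set Q) (src P) (snk Q) VE FE"
    proof (rule ser_arm)
      show "piece (tverts P \<union> tverts Q) (tedge_set P \<union> tedge_set Q) (src P) (snk Q) VE FE" using series.prems(1) J F by simp
      show "join1 (tverts P) (tedge_set P) (tverts Q) (tedge_set Q) (snk P)" by (rule series_join1[OF series.hyps(3) P Q])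
      show "arm 2 (tverts Q) (tedge_set Q) (snk P) (snk Q) (tverts P \<union> VE) (tedge_set P \<union> FE)" using 4(2) J by simp
      show "snk P \<noteq> snk Q" using J Q'(4) by simp
    qed (use 4(1) P' Q' s in auto)
    then show ?thesis using J F by simp
  qed
next
  case (parallel P Q H)
  note J = parallel.hyps(3)[unfolded parallel_join_pair]
  have P: "proper P" and Q: "proper Q" using parallel.hyps bin_sp_proper by auto
  note P' = properD[OF P] and Q' = properD[OF Q]
  note pieces = parallel_pieces[OF parallel.prems(1) parallel.hyps(3) P Q parallel.prems(2)]
  have st: "src P = src H" "snk P = snk H" "src Q = src H" "snk Q = snk H" using J by auto
  have s: "simple P" "simple Q" using simple_join[OF _ parallel.prems(2)] J by blast+
  have l: "linked (tverts Q \<union> VE) (tedge_set Q \<union> FE) (src P) (snk P)" "linked (tverts P \<union> VE) (tedge_set P \<union> FE) (src Q) (snk Q)"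
    unfolding st using parallel.prems(3) by (auto intro: linked_mono)
  obtain k l where kl: "arm (k + l) (tverts H) (tedge_set H) (src H) (snk H) VE FE"
    "k = 2 \<or> k = 1 \<and> (\<exists>vs. path_list vs P \<and> length vs \<ge> 3)"
    "l = 2 \<or> l = 1 \<and> (\<exists>vs. path_list vs Q \<and> length vs \<ge> 3)"
    by (rule parallel_arms[OF parallel.prems(1) parallel.hyps(3) P Q parallel.prems(2)
          parallel.IH(1)[OF pieces(1)[folded st(1,2)] s(1) l(1)] parallel.IH(2)[OF pieces(2)[folded st(3,4)] s(2) l(2)]])
  \<comment> \<open>Even two paths reach width two together, which is the width that series joins
    preserve.\<close>
  have "2 \<le> k + l" using kl(2,3) by auto
  from arm_mono[OF kl(1) this] show ?case by simp
qed

text \<open>In a series join the other factor moves into the left or the right half, so the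
  environment of each factor remains split. In a parallel join the branches connect each other's
  terminals, so \<open>path_or_arm\<close> applies to both. The clauses on the first and last pieces
  yield single edges at the top, where the halves are bare terminals.\<close>

lemma chain_of_pearls:
  assumes "bin_sp H" "piece (tverts H) (tedge_set H) (src H) (snk H) (VL \<union> VR) (FL \<union> FR)" "simple H"
    and "VL \<inter> VR = {}" "src H \<in> VL" "snk H \<in> VR" "\<forall>e\<in>FL. e \<subseteq> VL" "\<forall>e\<in>FR. e \<subseteq> VR"
  shows "\<exists>Ps. chain Ps H \<and> (\<forall>P\<in>set Ps. is_pearl P \<or> is_single_edge P)
    \<and> (is_single_edge (hd Ps) \<or> VL \<noteq> {src H}) \<and> (is_single_edge (last Ps) \<or> VR \<noteq> {snk H})"
  using assms
proof (induction arbitrary: VL VR FL FR rule: bin_sp.induct)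
  case (edge H)
  then show ?case using chain_single[of H] by (intro exI[of _ "[H]"]) simp
next
  case (series P Q H)
  note J = series.hyps(3)[unfolded series_join_pair]
  have P: "proper P" and Q: "proper Q" using series.hyps bin_sp_proper by auto
  note P' = properD[OF P] and Q' = properD[OF Q]
  note pr = series.prems
  note pieces = series_pieces[OF pr(1) series.hyps(3) P Q pr(2)]
  have s: "simple P" "simple Q" using simple_join[OF _ pr(2)] J by blast+
  have int: "(tverts P \<union> tverts Q) \<inter> (VL \<union> VR) = {src P, snk Q}" using pieceD(11)[OF pr(1)] J by simp
  have mem: "src P \<in> VL" "snk Q \<in> VR" "src P \<notin> VR" "snk Q \<notin> VL" using pr(3-5) J by auto
  have int': "x = src P \<or> x = snk Q" if "x \<in> tverts P \<union> tverts Q" "x \<in> VL \<union> VR" for x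
    using IntI[OF that] unfolding int by blast
  have dis: "VL \<inter> tverts Q = {}" "VR \<inter> tverts P = {}" using int' mem(3,4) pieces(4,5) by blast+
  have e: "\<forall>e\<in>tedge_set Q \<union> FR. e \<subseteq> tverts Q \<union> VR" "\<forall>e\<in>FL \<union> tedge_set P. e \<subseteq> VL \<union> tverts P"
    using P'(6) Q'(6) pr(6,7) by blast+
  have pP: "piece (tverts P) (tedge_set P) (src P) (snk P) (VL \<union> (tverts Q \<union> VR)) (FL \<union> (tedge_set Q \<union> FR))"
    using pieces(1) by (simp only: Un_left_commute)
  have pQ: "piece (tverts Q) (tedge_set Q) (src Q) (snk Q) ((VL \<union> tverts P) \<union> VR) ((FL \<union> tedge_set P) \<union> FR)"
    using pieces(2) by (simp only: ac_simps)
  have "\<exists>Ps. chain Ps P \<and> (\<forall>P\<in>set Ps. is_pearl P \<or> is_single_edge P)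
    \<and> (is_single_edge (hd Ps) \<or> VL \<noteq> {src P}) \<and> (is_single_edge (last Ps) \<or> tverts Q \<union> VR \<noteq> {snk P})"
  proof (rule series.IH(1)[OF pP s(1)])
    show "VL \<inter> (tverts Q \<union> VR) = {}" using dis pr(3) by auto
    show "snk P \<in> tverts Q \<union> VR" using J Q'(2) by simp
  qed (use mem e pr(6) in auto)
  then obtain Ps where Ps: "chain Ps P" "\<forall>P\<in>set Ps. is_pearl P \<or> is_single_edge P"
    "is_single_edge (hd Ps) \<or> VL \<noteq> {src P}" by blast
  have "\<exists>Qs. chain Qs Q \<and> (\<forall>P\<in>set Qs. is_pearl P \<or> is_single_edge P)
    \<and> (is_single_edge (hd Qs) \<or> VL \<union> tverts P \<noteq> {src Q}) \<and> (is_single_edge (last Qs) \<or> VR \<noteq> {snk Q})"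
  proof (rule series.IH(2)[OF pQ s(2)])
    show "(VL \<union> tverts P) \<inter> VR = {}" using dis pr(3) by auto
    show "src Q \<in> VL \<union> tverts P" using J P'(3) by simp
  qed (use mem e pr(7) in auto)
  then obtain Qs where Qs: "chain Qs Q" "\<forall>P\<in>set Qs. is_pearl P \<or> is_single_edge P"
    "is_single_edge (last Qs) \<or> VR \<noteq> {snk Q}" by blast
  have "proper R" if "R \<in> set Ps \<union> set Qs" for R
    using that Ps(2) Qs(2) pearl_proper single_edge_proper by blast
  then have "chain (Ps @ Qs) H" by (rule chain_append[OF Ps(1) Qs(1) series.hyps(3)])
  moreover have "Ps \<noteq> []" "Qs \<noteq> []" using Ps(1) Qs(1) by (simp_all add: chain_def)
  ultimately show ?case using Ps(2,3) Qs(2,3) J by (intro exI[of _ "Ps @ Qs"]) auto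
next
  case (parallel P Q H)
  note pr = parallel.prems
  note J = parallel.hyps(3)[unfolded parallel_join_pair]
  have P: "proper P" and Q: "proper Q" using parallel.hyps bin_sp_proper by auto
  note P' = properD[OF P] and Q' = properD[OF Q]
  note pieces = parallel_pieces[OF pr(1) parallel.hyps(3) P Q pr(2)]
  have st: "src P = src H" "snk P = snk H" "src Q = src H" "snk Q = snk H" using J by auto
  have s: "simple P" "simple Q" using simple_join[OF _ pr(2)] J by blast+
  have l: "linked (tverts Q \<union> (VL \<union> VR)) (tedge_set Q \<union> (FL \<union> FR)) (src P) (snk P)"
    "linked (tverts P \<union> (VL \<union> VR)) (tedge_set P \<union> (FL \<union> FR)) (src Q) (snk Q)"
    using linked_mono[OF proper_linked[OF Q Q'(2,3)]] linked_mono[OF proper_linked[OF P P'(2,3)]] unfolding st by auto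
  obtain k l where kl: "arm (k + l) (tverts H) (tedge_set H) (src H) (snk H) (VL \<union> VR) (FL \<union> FR)"
    "k = 2 \<or> k = 1 \<and> (\<exists>vs. path_list vs P \<and> length vs \<ge> 3)"
    "l = 2 \<or> l = 1 \<and> (\<exists>vs. path_list vs Q \<and> length vs \<ge> 3)"
    by (rule parallel_arms[OF pr(1) parallel.hyps(3) P Q pr(2)
          path_or_arm[OF parallel.hyps(1) pieces(1)[folded st(1,2)] s(1) l(1)]
          path_or_arm[OF parallel.hyps(2) pieces(2)[folded st(3,4)] s(2) l(2)]])
  have top: "k + l \<le> 2" "VL \<noteq> {src H}" "VR \<noteq> {snk H}"
    using top_arm[OF pr(1,3,4,5) _ _ kl(1)] pr(6,7) by blast+
  \<comment> \<open>Both \<open>k\<close> and \<open>l\<close> are at least one and their sum is at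
    most two, so each branch is a single path.\<close>
  then have "is_pearl H" unfolding pearl_iff using kl(2,3) parallel.hyps(3) by auto
  then show ?case using chain_single[of H] top by (intro exI[of _ "[H]"]) simp
qed

end

section \<open>Toughness one half\<close>

lemma num_comps_ncomps:
  assumes "wf_mgraph G"
  shows "num_comps (del_verts G S) = ncomps (verts G - S) (set_mset (edges G))"
proof -
  let ?U = "verts G - S" and ?F = "set_mset (edges G)"
  have "adj (del_verts G S) = step ?U ?F"
    using assms unfolding adj_def del_verts_def step_def wf_mgraph_def by fastforce
  then have r: "reach (del_verts G S) = {(u, v). u \<in> ?U \<and> v \<in> ?U \<and> linked ?U ?F u v}"
    by (auto simp: reach_def linked_def del_verts_def)
  have "reach (del_verts G S) `` {x} = component ?U ?F x" if "x \<in> ?U" for x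
    using that linked_in[of ?U ?F x] unfolding r component_def by auto
  then have "?U // reach (del_verts G S) = component ?U ?F ` ?U"
    unfolding quotient_def by auto
  then show ?thesis by (simp add: num_comps_def ncomps_def del_verts_def)
qed

lemma wf_del_edge: "wf_mgraph G \<Longrightarrow> wf_mgraph (del_edge G e)"
  unfolding wf_mgraph_def del_edge_def by (auto dest: in_diffD)

lemma set_mset_del_edge:
  "set_mset (edges (del_edge G e)) = (if count (edges G) e \<le> 1 then set_mset (edges G) - {e} else set_mset (edges G))"
proof -
  have "x \<in># edges G - {#e#} \<longleftrightarrow> count (edges G) x > (if x = e then 1 else 0)" for x
    by (simp add: in_diff_count)
  note iff = this
  show ?thesis
  proof (rule set_eqI)
    fix x
    show "x \<in># edges (del_edge G e) \<longleftrightarrow>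
        x \<in> (if count (edges G) e \<le> 1 then set_mset (edges G) - {e} else set_mset (edges G))"
      using iff[of x] count_greater_zero_iff[of "edges G" x]
      by (cases "x = e"; cases "count (edges G) e \<le> 1") (auto simp: del_edge_def dest: in_diffD)
  qed
qed

lemma half_tough_iff:
  assumes "wf_mgraph G"
  shows "tough (1/2) G \<longleftrightarrow>
    (\<forall>S\<subseteq>verts G. 2 \<le> ncomps (verts G - S) (set_mset (edges G)) \<longrightarrow> ncomps (verts G - S) (set_mset (edges G)) \<le> 2 * card S)"
  unfolding tough_def cutset_def num_comps_ncomps[OF assms] by (auto simp: Suc_le_eq)

text \<open>If \<open>tough t G\<close> fails, there is a cutset, so the supremum is attained by a
  real number, and this number has to be below \<open>t\<close>.\<close>

lemma toughness_less_iff: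
  assumes "finite (verts G)"
  shows "toughness G < ereal t \<longleftrightarrow> \<not> tough t G"
proof
  assume l: "toughness G < ereal t"
  show "\<not> tough t G"
  proof
    assume "tough t G"
    then have "ereal t \<le> toughness G" unfolding toughness_def by (intro Sup_upper) auto
    then show False using l by simp
  qed
next
  assume n: "\<not> tough t G"
  then obtain S where "cutset G S" unfolding tough_def by blast
  then obtain u where u: "toughness G = ereal u" "tough u G" using toughness_attained[OF assms] by blast
  have "\<not> t \<le> u"
  proof
    assume "t \<le> u"
    then have "tough t G"
      using u(2) unfolding tough_def by (meson mult_right_mono of_nat_0_le_iff order_trans)
    then show False using n by simp
  qed
  then show "toughness G < ereal t" using u(1) by simp
qed

lemma toughness_eq_half:
  assumes "finite (verts G)" "toughness G = ereal (1/2)"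
  shows "tough (1/2) G"
  using toughness_less_iff[OF assms(1), of "1/2"] assms(2) by simp

text \<open>An edge with a parallel copy cannot be critical, because deleting one copy leaves the
  edge set unchanged and with it all component counts.\<close>

lemma minimally_half_tough_crit:
  assumes wf: "wf_mgraph G" and mt: "minimally_tough (1/2) G" and c: "ncomps (verts G) (set_mset (edges G)) = 1"
  shows "crit_graph (verts G) (set_mset (edges G))" and "count (edges G) e \<le> 1"
proof -
  let ?V = "verts G" and ?F = "set_mset (edges G)"
  have fin: "finite ?V" using wf by (simp add: wf_mgraph_def)
  have t: "tough (1/2) G" using mt fin toughness_eq_half unfolding minimally_tough_def by blast
  have nt: "\<not> tough (1/2) (del_edge G e)" if "e \<in> ?F" for e
    using mt that toughness_less_iff[of "del_edge G e" "1/2"] fin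
    unfolding minimally_tough_def by (simp add: del_edge_def)
  show c1: "count (edges G) e \<le> 1" for e
  proof (rule ccontr)
    assume n: "\<not> count (edges G) e \<le> 1"
    then have "e \<in> ?F" using count_greater_zero_iff[of "edges G" e] by linarith
    moreover have eq: "set_mset (edges (del_edge G e)) = ?F" "verts (del_edge G e) = ?V"
      using n set_mset_del_edge[of G e] by (simp_all add: del_edge_def)
    ultimately show False
      using nt[of e] t unfolding half_tough_iff[OF wf] half_tough_iff[OF wf_del_edge[OF wf]] eq by blast
  qed
  show "crit_graph ?V ?F"
  proof
    show "finite ?V" by (rule fin)
    show "e \<subseteq> ?V \<and> card e = 2" if "e \<in> ?F" for e using wf that by (simp add: wf_mgraph_def)
    show "ncomps ?V ?F = 1" by (rule c)
    show "ncomps (?V - S) ?F \<le> 2 * card S" if S: "S \<subseteq> ?V" "S \<noteq> {}" for S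
    proof (cases "2 \<le> ncomps (?V - S) ?F")
      case True then show ?thesis using t half_tough_iff[OF wf] S by blast
    next
      case False
      \<comment> \<open>Here \<open>S\<close> is no cutset, so toughness is silent; but at most one
        component is left and \<open>S\<close> is not empty.\<close>
      have "card S \<ge> 1" using S(2) finite_subset[OF S(1) fin] by (simp add: Suc_le_eq card_gt_0_iff)
      then show ?thesis using False by simp
    qed
    show "\<exists>S\<subseteq>?V. 2 * card S + 1 \<le> ncomps (?V - S) (?F - {f}) \<and> 2 \<le> ncomps (?V - S) (?F - {f})" if f: "f \<in> ?F" for f
    proof -
      have e: "set_mset (edges (del_edge G f)) = ?F - {f}" "verts (del_edge G f) = ?V"
        using c1[of f] set_mset_del_edge[of G f] by (simp_all add: del_edge_def)
      obtain S where "S \<subseteq> ?V" "2 \<le> ncomps (?V - S) (?F - {f})" "\<not> ncomps (?V - S) (?F - {f}) \<le> 2 * card S"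
        using nt[OF f] unfolding half_tough_iff[OF wf_del_edge[OF wf]] e by blast
      then show ?thesis by (intro exI[of _ S]) simp
    qed
  qed
qed

lemma two_single_edges:
  assumes "is_single_edge (hd Ps)" "is_single_edge (last Ps)" "length Ps \<ge> 2"
  shows "length (filter is_single_edge Ps) \<ge> 2"
proof -
  obtain P Qs where Ps: "Ps = P # Qs" "Qs \<noteq> []" using assms(3) by (cases Ps; cases "tl Ps") auto
  then obtain Rs Q where "Qs = Rs @ [Q]" by (metis rev_exhaust)
  then show ?thesis using assms(1,2) Ps by simp
qed

lemma chain_of_minimally_half_tough:
  fixes G :: "'a mgraph"
  assumes sp: "series_parallel G" and mt: "minimally_tough (1/2) G"
  shows "\<exists>Ps H. is_series_join Ps H \<and> grph H = G \<and>
       (\<forall>P \<in> set Ps. is_pearl P \<or> is_single_edge P) \<and>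
       length (filter is_single_edge Ps) \<ge> 2 \<and>
       is_single_edge (hd Ps) \<and> is_single_edge (last Ps)"
proof -
  obtain s t where st: "sp_tgraph \<lparr>grph = G, src = s, snk = t\<rparr>" using sp unfolding series_parallel_def by blast
  define H where "H = \<lparr>grph = G, src = s, snk = t\<rparr>"
  have G: "grph H = G" by (simp add: H_def)
  have b: "bin_sp H" using st sp_tgraph_bin_sp unfolding H_def by blast
  note p = properD[OF bin_sp_proper[OF b]]
  have wf: "wf_mgraph G" using p(1,6,7) unfolding wf_mgraph_def G by blast
  note mcrit = minimally_half_tough_crit[OF wf mt p(5)[unfolded G]]
  interpret crit_graph "verts G" "set_mset (edges G)" by (rule mcrit(1))
  have s: "simple H" unfolding simple_def G using mcrit(2) by blast
  \<comment> \<open>The whole graph is a piece whose environment consists of the two isolated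
    terminals.\<close>
  have pc: "piece (tverts H) (tedge_set H) (src H) (snk H) ({src H} \<union> {snk H}) ({} \<union> {})"
    unfolding piece_def join2_def using p G by auto
  have "\<exists>Ps. chain Ps H \<and> (\<forall>P\<in>set Ps. is_pearl P \<or> is_single_edge P)
    \<and> (is_single_edge (hd Ps) \<or> {src H} \<noteq> {src H}) \<and> (is_single_edge (last Ps) \<or> {snk H} \<noteq> {snk H})"
    by (rule chain_of_pearls[OF b pc s]) (use p(4) in auto)
  then obtain Ps where Ps: "chain Ps H" "\<forall>P\<in>set Ps. is_pearl P \<or> is_single_edge P"
    "is_single_edge (hd Ps)" "is_single_edge (last Ps)" by blast
  \<comment> \<open>A chain with one piece would be a single edge, which is complete and has
    infinite toughness.\<close>
  have len: "length Ps \<ge> 2"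
  proof (rule ccontr)
    assume "\<not> length Ps \<ge> 2"
    moreover have "Ps \<noteq> []" using Ps(1) by (simp add: chain_def)
    ultimately obtain P where P: "Ps = [P]" by (cases Ps; cases "tl Ps") auto
    then have GP: "G = \<lparr>verts = {src P, snk P}, edges = {#{src P, snk P}#}\<rparr>"
      using Ps(1,3) G unfolding chain_def is_single_edge_def by (simp add: glue_def)
    have "toughness G = \<infinity>" by (rule toughness_complete) (auto simp: GP insert_commute)
    then show False using mt by (simp add: minimally_tough_def)
  qed
  then show ?thesis using chain_series[OF Ps(1)] Ps G two_single_edges by blast
qed

section \<open>Chains of pearls and edges\<close>

text \<open>Toughness strengthened for induction. The unit gained per deleted terminal is needed
  because a deleted common vertex is charged once in a series join but twice in its factors; the
  last term admits the single component of the intact piece.\<close>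

definition half_bound :: "'a tgraph \<Rightarrow> bool" where
  "half_bound H \<longleftrightarrow> (\<forall>Y\<subseteq>tverts H. ncomps (tverts H - Y) (tedge_set H) + of_bool (src H \<in> Y) + of_bool (snk H \<in> Y)
     \<le> 2 * card Y + of_bool (Y = {}))"

definition link :: "'a tgraph \<Rightarrow> bool" where
  "link H \<longleftrightarrow> proper H \<and> simple H \<and> half_bound H"

lemma simple_union:
  assumes "tedges H = tedges P + tedges Q" "simple P" "simple Q" "tedge_set P \<inter> tedge_set Q = {}"
  shows "simple H"
  unfolding simple_def
proof
  fix e
  have "count (tedges P) e = 0 \<or> count (tedges Q) e = 0" using assms(4) by (auto simp: count_eq_zero_iff)
  moreover have "count (tedges P) e \<le> 1" "count (tedges Q) e \<le> 1" using assms(2,3) by (simp_all add: simple_def)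
  ultimately show "count (tedges H) e \<le> 1" unfolding assms(1) by auto
qed

lemma path_list_bound:
  assumes "path_list vs H" "Y \<subseteq> tverts H"
  shows "ncomps (tverts H - Y) (tedge_set H) + of_bool (src H \<in> Y) + of_bool (snk H \<in> Y) \<le> 1 + card Y"
  using path_bound[of vs Y] assms unfolding path_list_def by fastforce

lemma path_list_simple: "path_list vs H \<Longrightarrow> simple H"
  unfolding path_list_def simple_def using distinct_path_edges by (metis distinct_count_atmost_1 le_refl zero_le)

lemma path_list_link:
  assumes "path_list vs H"
  shows "link H"
proof -
  have "ncomps (tverts H - Y) (tedge_set H) + of_bool (src H \<in> Y) + of_bool (snk H \<in> Y) \<le> 2 * card Y + of_bool (Y = {})"
    if Y: "Y \<subseteq> tverts H" for Y
  proof -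
    have "Y = {} \<or> 1 \<le> card Y"
      using finite_subset[OF Y] assms by (auto simp: path_list_def Suc_le_eq card_gt_0_iff)
    then show ?thesis using path_list_bound[OF assms Y] by auto
  qed
  then show ?thesis using path_list_proper[OF assms] path_list_simple[OF assms]
    by (simp add: link_def half_bound_def)
qed

lemma single_edge_path_list: "is_single_edge H \<Longrightarrow> path_list [src H, snk H] H"
  by (auto simp: path_list_def is_single_edge_def)

lemma series_link:
  assumes P: "link P" and Q: "link Q" and j: "is_series_join [P, Q] H"
  shows "link H"
proof -
  note J = j[unfolded series_join_pair]
  have p: "proper P" "proper Q" using P Q by (simp_all add: link_def)
  note P' = properD[OF p(1)] and Q' = properD[OF p(2)]
  note j1 = series_join1[OF j p]
  have int: "tverts P \<inter> tverts Q = {snk P}" using J by blast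
  have "tedge_set P \<inter> tedge_set Q = {}"
  proof (rule ccontr)
    assume "tedge_set P \<inter> tedge_set Q \<noteq> {}"
    then obtain e where e: "e \<in> tedge_set P" "e \<in> tedge_set Q" by blast
    then have "e \<subseteq> {snk P}" "card e = 2" using P'(6,7) Q'(6) int by blast+
    then show False using card_mono[of "{snk P}" e] by simp
  qed
  then have s: "simple H" using simple_union[of H P Q] J P Q by (simp add: link_def)
  have "ncomps (tverts H - Y) (tedge_set H) + of_bool (src H \<in> Y) + of_bool (snk H \<in> Y) \<le> 2 * card Y + of_bool (Y = {})"
    if Y: "Y \<subseteq> tverts H" for Y
  proof -
    let ?P = "Y \<inter> tverts P" and ?Q = "Y \<inter> tverts Q"
    have H: "tverts H = tverts P \<union> tverts Q" "tedge_set H = tedge_set P \<union> tedge_set Q" using J by simp_all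
    have Y': "Y = ?P \<union> ?Q" using Y H(1) by blast
    have hb: "half_bound P" "half_bound Q" using P Q by (simp_all add: link_def)
    have st: "src H = src P" "snk H = snk Q" "snk P = src Q" using J by simp_all
    have b: "ncomps (tverts P - ?P) (tedge_set P) + of_bool (src H \<in> Y) + of_bool (snk P \<in> Y) \<le> 2 * card ?P + of_bool (?P = {})"
      "ncomps (tverts Q - ?Q) (tedge_set Q) + of_bool (snk P \<in> Y) + of_bool (snk H \<in> Y) \<le> 2 * card ?Q + of_bool (?Q = {})"
      using hb[THEN iffD1[OF half_bound_def], rule_format, OF Int_lower2[of Y]] P'(2,3) Q'(2,3)
      unfolding st by simp_all
    \<comment> \<open>If the common vertex is deleted, its two terms, one from each factor, pay for
      the double charge of two. If it is kept, the two components that merge there pay for one of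
      the two terms for empty sets.\<close>
    show ?thesis
    proof (cases "snk P \<in> Y")
      case True
      then have m: "snk P \<in> ?P" "snk P \<in> ?Q" using P'(3) Q'(2) J by auto
      then have "?P \<noteq> {}" "?Q \<noteq> {}" by blast+
      then show ?thesis using b join1_in[OF j1 Int_lower2 Int_lower2 m] True
        unfolding H Y'[symmetric] by simp
    next
      case False
      then have m: "snk P \<notin> ?P" "snk P \<notin> ?Q" by auto
      have g: "ncomps (tverts P \<union> tverts Q - Y) (tedge_set P \<union> tedge_set Q) + 1 = ncomps (tverts P - ?P) (tedge_set P) + ncomps (tverts Q - ?Q) (tedge_set Q)"
        "card Y = card ?P + card ?Q"
        using join1_out[OF j1 Int_lower2 Int_lower2 m] unfolding Y'[symmetric] by simp_all
      have e: "Y = {} \<longleftrightarrow> ?P = {} \<and> ?Q = {}" using Y' by blast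
      show ?thesis unfolding H e using g b False
        by (cases "?P = {}"; cases "?Q = {}") simp_all
    qed
  qed
  then show ?thesis using series_proper[OF j p] s by (simp add: link_def half_bound_def)
qed

text \<open>The bounds for the two paths are added, and the constant that remains is absorbed by the
  factor two in front of \<open>card Y\<close>, as \<open>Y\<close> is nonempty. The absence of
  parallel edges rests on the length of the paths: a shared edge would join the terminals.\<close>

lemma pearl_link:
  assumes "is_pearl H"
  shows "link H"
proof -
  obtain P Q us ws where *: "path_list us P" "path_list ws Q" "length us \<ge> 3" "length ws \<ge> 3"
    and j: "is_parallel_join [P, Q] H"
    using assms pearl_iff by blast
  note J = j[unfolded parallel_join_pair]
  have p: "proper P" "proper Q" using * path_list_proper by blast+
  note P' = properD[OF p(1)] and Q' = properD[OF p(2)]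
  note j2 = parallel_join2[OF j p]
  have pr: "proper H" by (rule parallel_proper[OF j p])
  have st: "src P = src H" "snk P = snk H" "src Q = src H" "snk Q = snk H" using J by auto
  have "tedge_set P \<inter> tedge_set Q = {}"
  proof (rule ccontr)
    assume "tedge_set P \<inter> tedge_set Q \<noteq> {}"
    then obtain e where e: "e \<in> tedge_set P" "e \<in> tedge_set Q" by blast
    have "e \<subseteq> tverts P \<inter> tverts Q" "card e = 2" using P'(6,7) Q'(6) e by blast+
    then have "e \<subseteq> {src P, snk P}" using J st by simp
    then have "e = {src P, snk P}" using \<open>card e = 2\<close> P'(4) by (intro card_subset_eq) auto
    then have "{hd us, last us} \<in> set (path_edges us)" using e(1) *(1) by (simp add: path_list_def)
    then show False using path_edges_ends[of us] *(1,3) by (simp add: path_list_def)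
  qed
  then have s: "simple H" using simple_union[of H P Q] J * path_list_simple by blast
  have "ncomps (tverts H - Y) (tedge_set H) + of_bool (src H \<in> Y) + of_bool (snk H \<in> Y) \<le> 2 * card Y + of_bool (Y = {})"
    if Y: "Y \<subseteq> tverts H" for Y
  proof (cases "Y = {}")
    case True
    then show ?thesis using properD(5)[OF pr] by simp
  next
    case False
    let ?P = "Y \<inter> tverts P" and ?Q = "Y \<inter> tverts Q"
    have H: "tverts H = tverts P \<union> tverts Q" "tedge_set H = tedge_set P \<union> tedge_set Q" using J by simp_all
    have Y': "Y = ?P \<union> ?Q" using Y H(1) by blast
    have finY: "finite Y" using Y properD(1)[OF pr] finite_subset by blast
    have c1: "1 \<le> card Y" using False finY by (simp add: Suc_le_eq card_gt_0_iff)
    have b: "ncomps (tverts P - ?P) (tedge_set P) + of_bool (src H \<in> Y) + of_bool (snk H \<in> Y) \<le> 1 + card ?P"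
      "ncomps (tverts Q - ?Q) (tedge_set Q) + of_bool (src H \<in> Y) + of_bool (snk H \<in> Y) \<le> 1 + card ?Q"
      using path_list_bound[OF *(1) Int_lower2[of Y]] path_list_bound[OF *(2) Int_lower2[of Y]]
        P'(2,3) Q'(2,3) unfolding st by simp_all
    have mem: "src H \<in> ?P \<longleftrightarrow> src H \<in> Y" "src H \<in> ?Q \<longleftrightarrow> src H \<in> Y" "snk H \<in> ?P \<longleftrightarrow> snk H \<in> Y"
      "snk H \<in> ?Q \<longleftrightarrow> snk H \<in> Y"
      using P'(2,3) Q'(2,3) unfolding st by auto
    consider "src H \<in> Y" "snk H \<in> Y" | "src H \<notin> Y" "snk H \<in> Y" | "src H \<in> Y" "snk H \<notin> Y"
      | "src H \<notin> Y" "snk H \<notin> Y" by blast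
    then show ?thesis
    proof cases
      case 1
      have "card {src H, snk H} \<le> card Y" using 1 finY by (intro card_mono) auto
      then have "2 \<le> card Y" using properD(4)[OF pr] by simp
      then show ?thesis using b 1 False join2_in[OF j2 Int_lower2[of Y] Int_lower2[of Y]]
        unfolding H Y'[symmetric] mem by simp
    next
      case 2
      then show ?thesis using b c1 False join2_half[OF j2 Int_lower2[of Y] Int_lower2[of Y]]
        unfolding H Y'[symmetric] mem by simp
    next
      case 3
      then show ?thesis using b c1 False join2_half[OF join2_swap[OF j2] Int_lower2[of Y] Int_lower2[of Y]]
        unfolding H Y'[symmetric] mem by simp
    next
      case 4
      then show ?thesis using b c1 False join2_out[OF j2 Int_lower2[of Y] Int_lower2[of Y]]
        unfolding H Y'[symmetric] mem by (simp split: if_splits)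
    qed
  qed
  then show ?thesis using pr s by (simp add: link_def half_bound_def)
qed

section \<open>Cuts that appear when an edge is deleted\<close>

lemma series_context:
  assumes j: "is_series_join Ps H" and pr: "\<And>P. P \<in> set Ps \<Longrightarrow> proper P" and i: "i < length Ps"
  obtains VL VR FL FR where
    "tverts H = VL \<union> tverts (Ps ! i) \<union> VR" "tedge_set H = FL \<union> tedge_set (Ps ! i) \<union> FR"
    "VL \<inter> tverts (Ps ! i) = {src (Ps ! i)}" "VR \<inter> tverts (Ps ! i) = {snk (Ps ! i)}" "VL \<inter> VR = {}"
    "\<forall>e\<in>FL. e \<subseteq> VL" "\<forall>e\<in>FR. e \<subseteq> VR" "finite VL" "finite VR"
    "i > 0 \<longrightarrow> VL \<noteq> {src (Ps ! i)}" "Suc i < length Ps \<longrightarrow> VR \<noteq> {snk (Ps ! i)}"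
proof
  note D = j[unfolded is_series_join_def]
  have nx: "snk (Ps ! k) = src (Ps ! Suc k)" if "Suc k < length Ps" for k
    by (rule D[THEN conjunct2, THEN conjunct1, rule_format, OF that])
  have ov: "tverts (Ps ! k) \<inter> tverts (Ps ! l) = (if l = Suc k then {snk (Ps ! k)} else {})"
    if "k < l" "l < length Ps" for k l
    by (rule D[THEN conjunct2, THEN conjunct2, THEN conjunct1, rule_format, OF conjI, OF that])
  have H: "grph H = glue (map grph Ps)" using D by simp
  have p: "proper (Ps ! k)" if "k < length Ps" for k using pr that by simp
  let ?P = "Ps ! i"
  \<comment> \<open>The terminals are inserted because the unions are empty for the first and the
    last piece.\<close>
  let ?VL = "insert (src ?P) (\<Union>k\<in>{..<i}. tverts (Ps ! k))" and ?FL = "\<Union>k\<in>{..<i}. tedge_set (Ps ! k)"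
  let ?VR = "insert (snk ?P) (\<Union>k\<in>{i<..<length Ps}. tverts (Ps ! k))" and ?FR = "\<Union>k\<in>{i<..<length Ps}. tedge_set (Ps ! k)"
  note P = properD[OF p[OF i]]
  have idx: "{..<length Ps} = {..<i} \<union> {i} \<union> {i<..<length Ps}" using i by auto
  have st: "set Ps = (\<lambda>k. Ps ! k) ` {..<length Ps}" by (auto simp: in_set_conv_nth)
  have "tverts H = (\<Union>k\<in>{..<length Ps}. tverts (Ps ! k))" unfolding H glue_def by (simp add: st)
  then show "tverts H = ?VL \<union> tverts ?P \<union> ?VR" unfolding idx using P(2,3) by auto
  have "tedge_set H = (\<Union>k\<in>{..<length Ps}. tedge_set (Ps ! k))" unfolding H glue_def
    by (auto simp: in_sum_list_mset st)
  then show "tedge_set H = ?FL \<union> tedge_set ?P \<union> ?FR" unfolding idx by auto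
  have L: "tverts (Ps ! k) \<inter> tverts ?P \<subseteq> {src ?P}" if "k < i" for k
    using ov[OF that i] nx[of k] that i by (cases "i = Suc k") simp_all
  have R: "tverts ?P \<inter> tverts (Ps ! k) \<subseteq> {snk ?P}" if "i < k" "k < length Ps" for k
    using ov[OF that] by (cases "k = Suc i") simp_all
  have LR: "tverts (Ps ! k) \<inter> tverts (Ps ! l) = {}" if "k < i" "i < l" "l < length Ps" for k l
    using ov[of k l] that by simp
  show "?VL \<inter> tverts ?P = {src ?P}" using L P(2) by blast
  have "x = snk ?P" if "x \<in> tverts ?P" "x \<in> tverts (Ps ! k)" "i < k" "k < length Ps" for x k
    using R[OF that(3,4)] that(1,2) by blast
  then have "?VR \<inter> tverts ?P \<subseteq> {snk ?P}" by auto
  then show "?VR \<inter> tverts ?P = {snk ?P}" using P(3) by blast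
  have nL: "snk ?P \<notin> tverts (Ps ! k)" if "k < i" for k
    using subsetD[OF L[OF that] IntI[OF _ P(3)]] P(4) by auto
  have nR: "src ?P \<notin> tverts (Ps ! k)" if "i < k" "k < length Ps" for k
    using subsetD[OF R[OF that] IntI[OF P(2)]] P(4) by auto
  show "?VL \<inter> ?VR = {}"
  proof (rule ccontr)
    assume "?VL \<inter> ?VR \<noteq> {}"
    then obtain x where m: "x \<in> ?VL" "x \<in> ?VR" by blast
    have x: "x = src ?P \<or> (\<exists>k<i. x \<in> tverts (Ps ! k))" using m(1) by blast
    have "x = snk ?P \<or> (\<exists>l. i < l \<and> l < length Ps \<and> x \<in> tverts (Ps ! l))" using m(2) by auto
    note x = x this
    show False using x
    proof (elim disjE exE conjE)
      fix k l assume "k < i" "x \<in> tverts (Ps ! k)" "i < l" "l < length Ps" "x \<in> tverts (Ps ! l)"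
      then show False using LR[of k l] by blast
    qed (use P(4) nL nR in auto)
  qed
  have sub: "e \<subseteq> tverts (Ps ! k)" if "k < length Ps" "e \<in> tedge_set (Ps ! k)" for k e
    using properD(6)[OF p[OF that(1)]] that(2) by blast
  show "\<forall>e\<in>?FL. e \<subseteq> ?VL"
  proof
    fix e assume "e \<in> ?FL"
    then obtain k where "k < i" "e \<in> tedge_set (Ps ! k)" by blast
    moreover from this have "e \<subseteq> tverts (Ps ! k)" using sub i by simp
    ultimately show "e \<subseteq> ?VL" by blast
  qed
  show "\<forall>e\<in>?FR. e \<subseteq> ?VR"
  proof
    fix e assume "e \<in> ?FR"
    then obtain k where "k \<in> {i<..<length Ps}" "e \<in> tedge_set (Ps ! k)" by blast
    moreover from this have "e \<subseteq> tverts (Ps ! k)" using sub by simp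
    ultimately show "e \<subseteq> ?VR" by blast
  qed
  show "finite ?VL" "finite ?VR" using properD(1)[OF p] i by auto
  show "i > 0 \<longrightarrow> ?VL \<noteq> {src ?P}"
  proof
    assume that: "i > 0"
    have "proper (Ps ! 0)" "0 < i" using p[OF less_trans[OF that i]] that by simp_all
    then have "src (Ps ! 0) \<in> ?VL" "snk (Ps ! 0) \<in> ?VL" "src (Ps ! 0) \<noteq> snk (Ps ! 0)"
      using properD(2,3,4)[of "Ps ! 0"] by auto
    then show "?VL \<noteq> {src ?P}" by (metis singletonD)
  qed
  show "Suc i < length Ps \<longrightarrow> ?VR \<noteq> {snk ?P}"
  proof
    assume that: "Suc i < length Ps"
    have "proper (Ps ! Suc i)" "Suc i \<in> {i<..<length Ps}" using p that by auto
    then have "src (Ps ! Suc i) \<in> ?VR" "snk (Ps ! Suc i) \<in> ?VR" "src (Ps ! Suc i) \<noteq> snk (Ps ! Suc i)"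
      using properD(2,3,4)[of "Ps ! Suc i"] by blast+
    then show "?VR \<noteq> {snk ?P}" by (metis singletonD)
  qed
qed

text \<open>Deleting the far end \<open>b\<close> of a pearl and an edge on one of its two paths leaves the part
  beyond \<open>b\<close>, the tail of the broken path, and the rest.\<close>

lemma pearl_cut:
  assumes d: "distinct (xs @ ys)" "xs \<noteq> []" "length ys \<ge> 2" "last ys = b" "hd xs = a"
    and ws: "set (xs @ ys) \<inter> W = {a, b}" "\<forall>e\<in>FW. e \<subseteq> W" "finite W"
    and L: "VL \<inter> (set (xs @ ys) \<union> W) = {a}" "\<forall>e\<in>FL. e \<subseteq> VL" "finite VL"
    and R: "VR \<inter> (set (xs @ ys) \<union> W) = {b}" "\<forall>e\<in>FR. e \<subseteq> VR" "finite VR" "VR \<noteq> {b}"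
    and LR: "VL \<inter> VR = {}"
    and V: "V = VL \<union> (set (xs @ ys) \<union> W) \<union> VR" "F \<subseteq> FL \<union> (set (path_edges xs) \<union> set (path_edges ys) \<union> FW) \<union> FR"
  shows "3 \<le> ncomps (V - {b}) F"
proof -
  let ?A = "VL \<union> set xs \<union> W" and ?FA = "FL \<union> set (path_edges xs) \<union> FW"
  have ne: "ys \<noteq> []" using d(3) by auto
  have b: "b \<in> set ys" "b \<notin> set xs" using d(1,4) ne by auto
  have "a \<in> set xs" using d(2,5) by auto
  then have a: "a \<in> set xs" "a \<notin> set ys" using d(1) by auto
  have W: "x = a \<or> x = b" if "x \<in> set xs \<union> set ys" "x \<in> W" for x
    using IntI[of x "set (xs @ ys)" W] that unfolding ws(1) by auto
  have VL: "x = a" if "x \<in> VL" "x \<in> set xs \<union> set ys \<union> W" for x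
    using IntI[of x VL "set (xs @ ys) \<union> W"] that unfolding L(1) by auto
  have VR: "x = b" if "x \<in> VR" "x \<in> set xs \<union> set ys \<union> W" for x
    using IntI[of x VR "set (xs @ ys) \<union> W"] that unfolding R(1) by auto
  have AB: "?A \<inter> set ys \<subseteq> {b}"
  proof
    fix x assume x: "x \<in> ?A \<inter> set ys"
    then have "x \<notin> set xs" "x \<noteq> a" using d(1) a(2) by auto
    then show "x \<in> {b}" using x W[of x] VL[of x] by blast
  qed
  have ABC: "(?A \<union> set ys) \<inter> VR \<subseteq> {b}" using VR LR by blast
  have eA: "e \<subseteq> ?A" if "e \<in> ?FA" for e using that ws(2) L(2) path_edges_subset[of e xs] by blast
  have fA: "finite ?A" using L(3) ws(3) by simp
  have g1: "ncomps (?A \<union> set ys - {b}) (?FA \<union> set (path_edges ys)) = ncomps (?A - {b}) ?FA + ncomps (set ys - {b}) (set (path_edges ys))"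
    by (rule glue0[OF fA _ eA _ AB]) (auto dest: path_edges_subset)
  have g2: "ncomps (?A \<union> set ys \<union> VR - {b}) (?FA \<union> set (path_edges ys) \<union> FR)
     = ncomps (?A \<union> set ys - {b}) (?FA \<union> set (path_edges ys)) + ncomps (VR - {b}) FR"
  proof (rule glue0[OF _ R(3) _ _ ABC])
    show "finite (?A \<union> set ys)" using fA by simp
    show "e \<subseteq> ?A \<union> set ys" if "e \<in> ?FA \<union> set (path_edges ys)" for e using that eA path_edges_subset[of e ys] by blast
    show "e \<subseteq> VR" if "e \<in> FR" for e using that R(2) by blast
  qed
  have "b \<notin> {a}" using a b by auto
  then have "ncomps (?A - {b}) ?FA \<ge> 1" using fA a(1) by (intro ncomps_ge1) auto
  moreover have "ncomps (set ys - {b}) (set (path_edges ys)) \<ge> 1"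
  proof (rule ncomps_ge1)
    show "set ys - {b} \<noteq> {}"
    proof
      assume "set ys - {b} = {}"
      then have "set ys \<subseteq> {b}" by blast
      then have "card (set ys) \<le> 1" using card_mono[of "{b}" "set ys"] by simp
      then show False using d(1,3) distinct_card[of ys] by simp
    qed
  qed simp
  moreover have "ncomps (VR - {b}) FR \<ge> 1"
  proof (rule ncomps_ge1)
    have "b \<in> VR" using R(1) by blast
    then show "VR - {b} \<noteq> {}" using R(4) by blast
  qed (use R(3) in simp)
  ultimately have "3 \<le> ncomps (?A \<union> set ys \<union> VR - {b}) (?FA \<union> set (path_edges ys) \<union> FR)" using g1 g2 by simp
  \<comment> \<open>\<open>F\<close> is only contained in the listed edges; missing edges can but
    increase the number of components.\<close>
  also have "\<dots> \<le> ncomps (?A \<union> set ys \<union> VR - {b}) F"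
    by (rule ncomps_antimono) (use fA R(3) V(2) in auto)
  also have "?A \<union> set ys \<union> VR = V" unfolding V(1) by auto
  finally show ?thesis .
qed

lemma path_edges_split:
  "e \<in> set (path_edges vs) \<Longrightarrow> \<exists>xs ys. vs = xs @ ys \<and> xs \<noteq> [] \<and> ys \<noteq> [] \<and> e = {last xs, hd ys}"
proof (induction vs rule: induct_list012)
  case (3 x y zs)
  show ?case
  proof (cases "e = {x, y}")
    case True
    then show ?thesis by (intro exI[of _ "[x]"] exI[of _ "y # zs"]) simp
  next
    case False
    then obtain xs ys where "y # zs = xs @ ys" "xs \<noteq> []" "ys \<noteq> []" "e = {last xs, hd ys}" using 3 by auto
    then show ?thesis by (intro exI[of _ "x # xs"] exI[of _ ys]) simp
  qed
qed auto

text \<open>As the path has at least three vertices, one of the two parts into which it breaks has a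
  vertex besides its terminal. That terminal is deleted; if it is the first one, the path is
  reversed.\<close>

lemma pearl_edge_cut:
  assumes vs: "distinct vs" "length vs \<ge> 3" "hd vs = a" "last vs = b" "e \<in> set (path_edges vs)"
    and ws: "set vs \<inter> W = {a, b}" "\<forall>e\<in>FW. e \<subseteq> W" "finite W"
    and L: "VL \<inter> (set vs \<union> W) = {a}" "\<forall>e\<in>FL. e \<subseteq> VL" "finite VL" "VL \<noteq> {a}"
    and R: "VR \<inter> (set vs \<union> W) = {b}" "\<forall>e\<in>FR. e \<subseteq> VR" "finite VR" "VR \<noteq> {b}"
    and LR: "VL \<inter> VR = {}"
    and V: "V = VL \<union> (set vs \<union> W) \<union> VR" "F = FL \<union> (set (path_edges vs) \<union> FW) \<union> FR"
  shows "\<exists>v\<in>V. 3 \<le> ncomps (V - {v}) (F - {e})"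
proof -
  obtain xs ys where s: "vs = xs @ ys" "xs \<noteq> []" "ys \<noteq> []" "e = {last xs, hd ys}"
    using path_edges_split[OF vs(5)] by blast
  have F: "F - {e} \<subseteq> FL \<union> (set (path_edges xs) \<union> set (path_edges ys) \<union> FW) \<union> FR"
    unfolding V(2) s(1) path_edges_append[OF s(2,3)] using s(4) by auto
  have "vs \<noteq> []" using vs(2) by auto
  then have "a \<in> set vs" "b \<in> set vs" using vs(3,4) by auto
  then have ab: "a \<in> V" "b \<in> V" using V(1) by auto
  have "length ys \<ge> 2 \<or> length xs \<ge> 2" using vs(2) s(1) by auto
  then show ?thesis
  proof
    assume l: "length ys \<ge> 2"
    have "3 \<le> ncomps (V - {b}) (F - {e})"
    proof (rule pearl_cut[of xs ys b a W FW VL FL VR FR])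
      show "distinct (xs @ ys)" using vs(1) s(1) by simp
      show "last ys = b" "hd xs = a" using vs(3,4) s by auto
    qed (use s l ws L R LR V(1) F in simp_all)
    then show ?thesis using ab by blast
  next
    assume l: "length xs \<ge> 2"
    have st: "set (rev ys @ rev xs) = set vs" using s(1) by auto
    have "3 \<le> ncomps (V - {a}) (F - {e})"
    proof (rule pearl_cut[of "rev ys" "rev xs" a b W FW VR FR VL FL])
      show "distinct (rev ys @ rev xs)" using vs(1) s(1) by auto
      show "last (rev xs) = a" "hd (rev ys) = b" using vs(3,4) s by (auto simp: hd_rev last_rev)
      show "set (rev ys @ rev xs) \<inter> W = {b, a}" "VR \<inter> (set (rev ys @ rev xs) \<union> W) = {b}"
        "VL \<inter> (set (rev ys @ rev xs) \<union> W) = {a}" unfolding st using ws L R by auto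
      show "V = VR \<union> (set (rev ys @ rev xs) \<union> W) \<union> VL" unfolding st V(1) by auto
      show "F - {e} \<subseteq> FR \<union> (set (path_edges (rev ys)) \<union> set (path_edges (rev xs)) \<union> FW) \<union> FL" using F by auto
    qed (use s l ws L R LR in auto)
    then show ?thesis using ab by blast
  qed
qed

text \<open>A single edge is a bridge, so the empty set is a witness. For an edge of a pearl, one
  vertex leaves three components; this needs graph parts beyond both terminals, which exist because
  the end pieces are single edges.\<close>

lemma series_edge_cut:
  assumes j: "is_series_join Ps H" and Ps: "\<forall>P\<in>set Ps. is_pearl P \<or> is_single_edge P"
    and ends: "is_single_edge (hd Ps)" "is_single_edge (last Ps)" and e: "e \<in> tedge_set H"
  shows "\<exists>S\<subseteq>tverts H. 2 * card S < ncomps (tverts H - S) (tedge_set H - {e}) \<and> 2 \<le> ncomps (tverts H - S) (tedge_set H - {e})"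
proof -
  have pr: "proper P" if "P \<in> set Ps" for P using Ps that pearl_proper single_edge_proper by blast
  have "\<exists>P\<in>set Ps. e \<in> tedge_set P" using e j unfolding is_series_join_def
    by (auto simp: glue_def in_sum_list_mset)
  then obtain i where i: "i < length Ps" "e \<in> tedge_set (Ps ! i)" by (metis in_set_conv_nth)
  let ?P = "Ps ! i"
  note P = properD[OF pr[OF nth_mem[OF i(1)]]]
  obtain VL VR FL FR where c:
    "tverts H = VL \<union> tverts ?P \<union> VR" "tedge_set H = FL \<union> tedge_set ?P \<union> FR"
    "VL \<inter> tverts ?P = {src ?P}" "VR \<inter> tverts ?P = {snk ?P}" "VL \<inter> VR = {}"
    "\<forall>e\<in>FL. e \<subseteq> VL" "\<forall>e\<in>FR. e \<subseteq> VR" "finite VL" "finite VR"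
    "i > 0 \<longrightarrow> VL \<noteq> {src ?P}" "Suc i < length Ps \<longrightarrow> VR \<noteq> {snk ?P}"
    by (rule series_context[OF j pr i(1)])
  show ?thesis
  proof (cases "is_single_edge ?P")
    case True
    then have s: "tverts ?P = {src ?P, snk ?P}" "tedge_set ?P = {{src ?P, snk ?P}}" unfolding is_single_edge_def by auto
    have ne: "VL \<noteq> {}" "VR \<noteq> {}" "src ?P \<in> VL" "snk ?P \<in> VR" using c(3,4) by blast+
    have "tverts H = VL \<union> VR" using c(1) s(1) ne by auto
    moreover have "tedge_set H - {e} \<subseteq> FL \<union> FR" using c(2) i(2) s(2) by auto
    moreover have "ncomps (VL \<union> VR) (FL \<union> FR) = ncomps VL FL + ncomps VR FR"
      using glue0[of VL VR FL FR "{}"] c(5-9) by simp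
    moreover have "ncomps VL FL \<ge> 1" "ncomps VR FR \<ge> 1" using ne c(8,9) ncomps_ge1 by blast+
    ultimately have "2 \<le> ncomps (tverts H) (tedge_set H - {e})"
      using ncomps_antimono[of "VL \<union> VR" "tedge_set H - {e}" "FL \<union> FR"] c(8,9) by simp
    then show ?thesis by (intro exI[of _ "{}"]) simp
  next
    case False
    then have pl: "is_pearl ?P" using bspec[OF Ps nth_mem[OF i(1)]] by blast
    have "i \<noteq> 0"
    proof
      assume "i = 0"
      then show False using False ends(1) i(1) by (metis hd_conv_nth length_greater_0_conv)
    qed
    moreover have "Suc i < length Ps"
    proof (rule ccontr)
      assume "\<not> Suc i < length Ps"
      then have "i = length Ps - 1" using i(1) by simp
      then show False using False ends(2) i(1) by (metis last_conv_nth length_greater_0_conv less_nat_zero_code not_gr_zero)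
    qed
    ultimately have ne: "VL \<noteq> {src ?P}" "VR \<noteq> {snk ?P}" using c(10,11) by simp_all
    obtain P1 P2 us ws where *: "path_list us P1" "path_list ws P2" "length us \<ge> 3" "length ws \<ge> 3"
      "is_parallel_join [P1, P2] ?P"
      using pl pearl_iff by blast
    note J = *(5)[unfolded parallel_join_pair]
    have us: "distinct us" "hd us = src ?P" "last us = snk ?P" "tverts P1 = set us" "tedge_set P1 = set (path_edges us)"
      using *(1) J by (auto simp: path_list_def)
    have ws: "distinct ws" "hd ws = src ?P" "last ws = snk ?P" "tverts P2 = set ws" "tedge_set P2 = set (path_edges ws)"
      using *(2) J by (auto simp: path_list_def)
    have int: "set us \<inter> set ws = {src ?P, snk ?P}" "set ws \<inter> set us = {src ?P, snk ?P}"
      using J us(4) ws(4) by auto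
    have VP: "tverts ?P = set us \<union> set ws" "tverts ?P = set ws \<union> set us" using J us(4) ws(4) by auto
    have FP: "tedge_set ?P = set (path_edges us) \<union> set (path_edges ws)" "tedge_set ?P = set (path_edges ws) \<union> set (path_edges us)" using J us(5) ws(5) by auto
    have pes: "\<forall>e\<in>set (path_edges us). e \<subseteq> set us" "\<forall>e\<in>set (path_edges ws). e \<subseteq> set ws" using path_edges_subset by blast+
    have "e \<in> set (path_edges us) \<or> e \<in> set (path_edges ws)" using i(2) FP(1) by blast
    then have "\<exists>v\<in>tverts H. 3 \<le> ncomps (tverts H - {v}) (tedge_set H - {e})"
    proof
      assume a: "e \<in> set (path_edges us)"
      show ?thesis
        by (rule pearl_edge_cut[OF us(1) *(3) us(2,3) a int(1) pes(2) _ c(3)[unfolded VP(1)] c(6,8) ne(1)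
              c(4)[unfolded VP(1)] c(7,9) ne(2) c(5) c(1)[unfolded VP(1)] c(2)[unfolded FP(1)]]) simp
    next
      assume a: "e \<in> set (path_edges ws)"
      show ?thesis
        by (rule pearl_edge_cut[OF ws(1) *(4) ws(2,3) a int(2) pes(1) _ c(3)[unfolded VP(2)] c(6,8) ne(1)
              c(4)[unfolded VP(2)] c(7,9) ne(2) c(5) c(1)[unfolded VP(2)] c(2)[unfolded FP(2)]]) simp
    qed
    then obtain v where "v \<in> tverts H" "3 \<le> ncomps (tverts H - {v}) (tedge_set H - {e})" by blast
    then show ?thesis by (intro exI[of _ "{v}"]) simp
  qed
qed

lemma minimally_half_tough_chain:
  assumes j: "is_series_join Ps H" and Ps: "\<forall>P\<in>set Ps. is_pearl P \<or> is_single_edge P"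
    and ends: "is_single_edge (hd Ps)" "is_single_edge (last Ps)"
  shows "minimally_tough (1/2) (grph H)"
proof -
  let ?G = "grph H"
  have ok: "link P" if "P \<in> set Ps" for P
    using Ps that pearl_link path_list_link single_edge_path_list by blast
  have H: "link H" by (rule series_closed[OF j ok series_link])
  then have pr: "proper H" and s: "simple H" and hb: "half_bound H" by (simp_all add: link_def)
  note p = properD[OF pr]
  have wf: "wf_mgraph ?G" using p(1,6,7) unfolding wf_mgraph_def by blast
  have ht: "tough (1/2) ?G"
    unfolding half_tough_iff[OF wf]
  proof (intro allI impI)
    fix S assume S: "S \<subseteq> tverts H" "2 \<le> ncomps (tverts H - S) (tedge_set H)"
    have "S \<noteq> {}" using S(2) p(5) by auto
    then show "ncomps (tverts H - S) (tedge_set H) \<le> 2 * card S" using hb[unfolded half_bound_def, rule_format, OF S(1)] by simp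
  qed
  obtain P Qs where PQ: "Ps = P # Qs" "length Qs \<ge> 1" using j unfolding is_series_join_def by (cases Ps) auto
  \<comment> \<open>The sink of the first piece is a cut vertex, which bounds the toughness by 1/2
    from above.\<close>
  obtain v where v: "v \<in> tverts H" "2 \<le> ncomps (tverts H - {v}) (tedge_set H)"
  proof -
    obtain Q where Q: "link Q" "is_series_join [P, Q] H"
    proof (cases "length Qs \<ge> 2")
      case True
      obtain Q where Q: "is_series_join Qs Q" "is_series_join [P, Q] H"
        by (rule series_join_Cons[OF j[unfolded PQ(1)] True])
      have "link Q" by (rule series_closed[OF Q(1) ok series_link]) (simp_all add: PQ)
      then show ?thesis using Q(2) by (rule that)
    next
      case False
      then obtain Q where "Qs = [Q]" using PQ(2) by (cases Qs; cases "tl Qs") auto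
      then show ?thesis using that[of Q] j PQ ok by simp
    qed
    note J = Q(2)[unfolded series_join_pair]
    have pp: "proper P" "proper Q" using ok[of P] Q(1) PQ by (simp_all add: link_def)
    note P' = properD[OF pp(1)] and Q' = properD[OF pp(2)]
    have "ncomps (tverts P \<union> tverts Q - ({snk P} \<union> {snk P})) (tedge_set P \<union> tedge_set Q)
       = ncomps (tverts P - {snk P}) (tedge_set P) + ncomps (tverts Q - {snk P}) (tedge_set Q)"
      by (rule join1_in(1)[OF series_join1[OF Q(2) pp]]) (use P'(3) Q'(2) J in simp_all)
    moreover have "ncomps (tverts P - {snk P}) (tedge_set P) \<ge> 1" using P'(1,2,4) by (intro ncomps_ge1) auto
    moreover have "ncomps (tverts Q - {snk P}) (tedge_set Q) \<ge> 1" using Q'(1,3,4) J by (intro ncomps_ge1) auto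
    ultimately show ?thesis using that[of "snk P"] J P'(3) by simp
  qed
  have c: "cutset ?G {v}" using v num_comps_ncomps[OF wf, of "{v}"] by (simp add: cutset_def)
  obtain t where t: "toughness ?G = ereal t" "tough t ?G" "\<forall>t'. tough t' ?G \<longrightarrow> t' \<le> t"
    using toughness_attained[OF p(1) c] by blast
  have "1/2 \<le> t" using t(3) ht by blast
  moreover have "t \<le> 1/2"
  proof -
    have "t * real (num_comps (del_verts ?G {v})) \<le> 1" using t(2) c unfolding tough_def by fastforce
    \<comment> \<open>The lower bound 1/2 makes \<open>t\<close> nonnegative, so two may replace the
      actual number of components.\<close>
    moreover have "t * 2 \<le> t * real (num_comps (del_verts ?G {v}))"
      using \<open>1/2 \<le> t\<close> v(2) num_comps_ncomps[OF wf, of "{v}"] by (intro mult_left_mono) auto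
    ultimately show ?thesis by linarith
  qed
  ultimately have "toughness ?G = ereal (1/2)" using t(1) by simp
  moreover have "toughness (del_edge ?G e) < ereal (1/2)" if e: "e \<in># edges ?G" for e
  proof -
    have "set_mset (edges (del_edge ?G e)) = tedge_set H - {e}" "verts (del_edge ?G e) = tverts H"
      using s set_mset_del_edge[of ?G e] by (simp_all add: simple_def del_edge_def)
    moreover obtain S where "S \<subseteq> tverts H" "2 * card S < ncomps (tverts H - S) (tedge_set H - {e})" "2 \<le> ncomps (tverts H - S) (tedge_set H - {e})"
      using series_edge_cut[OF j Ps ends e] by blast
    ultimately have "\<not> tough (1/2) (del_edge ?G e)"
      unfolding half_tough_iff[OF wf_del_edge[OF wf]] by (metis not_le)
    then show ?thesis using toughness_less_iff[of "del_edge ?G e" "1/2"] p(1) by (simp add: del_edge_def)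
  qed
  ultimately show ?thesis by (simp add: minimally_tough_def)
qed

theorem theorem4p13:
  fixes G :: "'a mgraph"
  assumes "series_parallel G"
  shows "minimally_tough (1/2) G \<longleftrightarrow>
    (\<exists>Ps H. is_series_join Ps H \<and> grph H = G \<and>
       (\<forall>P \<in> set Ps. is_pearl P \<or> is_single_edge P) \<and>
       length (filter is_single_edge Ps) \<ge> 2 \<and>
       is_single_edge (hd Ps) \<and> is_single_edge (last Ps))"
  using chain_of_minimally_half_tough[OF assms] minimally_half_tough_chain by blast

end
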